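(* Let $\Omega\subseteq[0,1]^d$ be a regular domain and $p:\Omega\to\mathbb R$ a function continuous almost everywhere. Let $\mathbf t_1,\ldots,\mathbf t_m$ and the nonzero weights $w_{[\mathbf t_k]_\alpha^+}$ be fixed and independent of $\mathbf n$, and let $W^{\Omega,p}_{\mathbf n}$ be the adjacency matrix of the $d$-level Toeplitz grid graph immersed in $\Omega$, $T^\Omega_{\mathbf n}\langle\{[\mathbf t_1],\mathbf w_1^p\},\ldots,\{[\mathbf t_m],\mathbf w_m^p\}\rangle$. Then $\{W^{\Omega,p}_{\mathbf n}\}_{\mathbf n}\sim_\lambda g$, where $g:\Omega\times[-\pi,\pi]^d\to\mathbb R$, $g(\mathbf x,\boldsymbol\theta)=p(\mathbf x)f(\boldsymbol\theta)$, with $$f(\boldsymbol\theta)=\sum_{k=1}^m\sum_{\alpha=1}^{c_k}2\,w_{[\mathbf t_k]_\alpha^+}\cos([\mathbf t_k]_\alpha^+\cdot\boldsymbol\theta).$$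
   Context: A regular domain is a Lebesgue measurable set $\Omega\subseteq[0,1]^d$ whose boundary has zero Lebesgue measure. Multi-index notation: $\vartriangleleft$ strict lexicographic order; $\mathbf i<\mathbf j$ componentwise; $|\mathbf i|$ componentwise absolute value; $\mathbf n\to\infty$ means $\min_r n_r\to\infty$. Directions: for $\mathbf t\in\mathbb Z^d_{\ge0}\setminus\{\mathbf 0\}$, $[\mathbf t]$ is the set of classes of $\{(\pm t_1,\ldots,\pm t_d)\}$ modulo $\mathbf i\sim-\mathbf i$, $c=|[\mathbf t]|$, each class $[\mathbf t]_\alpha=\{[\mathbf t]_\alpha^+,[\mathbf t]_\alpha^-\}$ with $[\mathbf t]_\alpha^+$ the element with positive first nonzero component. Here $\mathbf 0\vartriangleleft\mathbf t_1\vartriangleleft\cdots\vartriangleleft\mathbf t_m\vartriangleleft\mathbf n-\mathbf 1$, $c_k=|[\mathbf t_k]|$. The $d$-level Toeplitz graph has nodes $v_{\mathbf k}$, $\mathbf 1\le\mathbf k\le\mathbf n$, and weight $w(v_{\mathbf i},v_{\mathbf j})=w_{[\mathbf t_k]_\alpha^+}$ if $|\mathbf i-\mathbf j|=\mathbf t_k$ and $\mathbf i-\mathbf j\in[\mathbf t_k]_\alpha$, else $0$. Grid graph: with $h_r=1/(n_r+1)$, node $v_{\mathbf j}$ is identified with the point $\mathbf x_{\mathbf j}=(j_1h_1,\ldots,j_dh_d)\in(0,1)^d$, and the weight is replaced by $w^p(\mathbf x_{\mathbf i},\mathbf x_{\mathbf j})=p\big(\tfrac{\mathbf x_{\mathbf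 i}+\mathbf x_{\mathbf j}}2\big)w(v_{\mathbf i},v_{\mathbf j})$ (in the paper's construction $p$ is defined on $[0,1]^d$). The graph immersed in $\Omega$ keeps only the nodes $\mathbf x_{\mathbf j}\in\Omega$ with the restricted weight; its adjacency matrix (nodes in lexicographic order) is $W^{\Omega,p}_{\mathbf n}$, of size $n'(\mathbf n)\to\infty$. Eigenvalue distribution: $\{X_{\mathbf n}\}\sim_\lambda g$ (for $X_{\mathbf n}$ of size $d_{\mathbf n}\to\infty$ and measurable $g:D\to\mathbb R$ with $0<\mu(D)<\infty$) means $\lim_{\mathbf n\to\infty}\frac1{d_{\mathbf n}}\sum_{j=1}^{d_{\mathbf n}}F(\lambda_j(X_{\mathbf n}))=\frac1{\mu(D)}\int_DF(g(\mathbf y))d\mathbf y$ for every continuous compactly supported $F:\mathbb C\to\mathbb C$. *)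

theory Defs
  imports "HOL-Analysis.Analysis" "Jordan_Normal_Form.Char_Poly"
begin

text \<open>Dimension d is modelled by a finite type 'd::{finite,wellorder} (coordinates r :: 'd::{finite,wellorder}); the well-order on 'd::{finite,wellorder}
  fixes which coordinate is the "first" one (used for the lexicographic order and for the
  positive representative of a direction class).  Multi-indices are vectors in int ^ 'd::{finite,wellorder}.\<close>

definition lex_less :: "int ^ 'd::{finite,wellorder} \<Rightarrow> int ^ 'd::{finite,wellorder} \<Rightarrow> bool" where
  "lex_less a b \<longleftrightarrow> (\<exists>r. a $ r < b $ r \<and> (\<forall>q<r. a $ q = b $ q))"

definition vabs :: "int ^ 'd::{finite,wellorder} \<Rightarrow> int ^ 'd::{finite,wellorder}" where
  "vabs i = (\<chi> r. \<bar>i $ r\<bar>)"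

definition pos_first :: "int ^ 'd::{finite,wellorder} \<Rightarrow> bool" where
  "pos_first s \<longleftrightarrow> (\<exists>r. 0 < s $ r \<and> (\<forall>q<r. s $ q = 0))"

definition dir_pos_reps :: "int ^ 'd::{finite,wellorder} \<Rightarrow> (int ^ 'd::{finite,wellorder}) set" where
  "dir_pos_reps t = {s. vabs s = t \<and> pos_first s}"

text \<open>Weight of the d-level Toeplitz graph between v_i and v_j; the weight of the class
  [t_k]_alpha is given by w at its positive representative [t_k]_alpha^+.\<close>
definition toeplitz_weight ::
  "(int ^ 'd::{finite,wellorder}) list \<Rightarrow> (int ^ 'd::{finite,wellorder} \<Rightarrow> real) \<Rightarrow> int ^ 'd::{finite,wellorder} \<Rightarrow> int ^ 'd::{finite,wellorder} \<Rightarrow> real" where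
  "toeplitz_weight ts w i j =
     (if (\<exists>k<length ts. vabs (i - j) = ts ! k)
      then (if pos_first (i - j) then w (i - j) else w (j - i)) else 0)"

definition grid_pt :: "nat ^ 'd::{finite,wellorder} \<Rightarrow> int ^ 'd::{finite,wellorder} \<Rightarrow> real ^ 'd::{finite,wellorder}" where
  "grid_pt n j = (\<chi> r. real_of_int (j $ r) / (real (n $ r) + 1))"

definition grid_nodes :: "nat ^ 'd::{finite,wellorder} \<Rightarrow> (int ^ 'd::{finite,wellorder}) set" where
  "grid_nodes n = {k. \<forall>r. 1 \<le> k $ r \<and> k $ r \<le> int (n $ r)}"

definition immersed_nodes :: "nat ^ 'd::{finite,wellorder} \<Rightarrow> (real ^ 'd::{finite,wellorder}) set \<Rightarrow> (int ^ 'd::{finite,wellorder}) list" where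
  "immersed_nodes n \<Omega> =
     (THE xs. sorted_wrt lex_less xs \<and> set xs = {k \<in> grid_nodes n. grid_pt n k \<in> \<Omega>})"

definition immersed_toeplitz_matrix ::
  "(int ^ 'd::{finite,wellorder}) list \<Rightarrow> (int ^ 'd::{finite,wellorder} \<Rightarrow> real) \<Rightarrow> (real ^ 'd::{finite,wellorder}) set \<Rightarrow>
   (real ^ 'd::{finite,wellorder} \<Rightarrow> real) \<Rightarrow> nat ^ 'd::{finite,wellorder} \<Rightarrow> real mat" where
  "immersed_toeplitz_matrix ts w \<Omega> p n =
     (let vs = immersed_nodes n \<Omega>; N = length vs in
      mat N N (\<lambda>(a, b). p ((1/2) *\<^sub>R (grid_pt n (vs ! a) + grid_pt n (vs ! b)))
                         * toeplitz_weight ts w (vs ! a) (vs ! b)))"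

definition eigenvalues_mset :: "real mat \<Rightarrow> complex multiset" where
  "eigenvalues_mset A = proots (char_poly (map_mat complex_of_real A))"

definition multi_top :: "(nat ^ 'd::{finite,wellorder}) filter" where
  "multi_top = (INF k. principal {n. \<forall>r. k \<le> n $ r})"

text \<open>Eigenvalue distribution {X_n} ~_lambda g on D (including the standing requirements:
  sizes tend to infinity, g measurable, 0 < mu(D) < infinity).\<close>
definition eig_distributed ::
  "('i \<Rightarrow> real mat) \<Rightarrow> 'i filter \<Rightarrow> ('b::euclidean_space \<Rightarrow> real) \<Rightarrow> 'b set \<Rightarrow> bool" where
  "eig_distributed X Fl g D \<longleftrightarrow>
     filterlim (\<lambda>n. dim_row (X n)) at_top Fl \<and>
     D \<in> sets lebesgue \<and> 0 < emeasure lebesgue D \<and> emeasure lebesgue D < \<infinity> \<and>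
     g \<in> borel_measurable (lebesgue_on D) \<and>
     (\<forall>F :: complex \<Rightarrow> complex. continuous_on UNIV F \<and> compact (closure {z. F z \<noteq> 0}) \<longrightarrow>
        ((\<lambda>n. (\<Sum>z\<in>#eigenvalues_mset (X n). F z) / of_nat (dim_row (X n)))
          \<longlongrightarrow> (LINT y:D|lebesgue. F (complex_of_real (g y))) / complex_of_real (measure lebesgue D)) Fl)"

definition toeplitz_symbol ::
  "(int ^ 'd::{finite,wellorder}) list \<Rightarrow> (int ^ 'd::{finite,wellorder} \<Rightarrow> real) \<Rightarrow> real ^ 'd::{finite,wellorder} \<Rightarrow> real" where
  "toeplitz_symbol ts w \<theta> =
     (\<Sum>k<length ts. \<Sum>s\<in>dir_pos_reps (ts ! k).
        2 * w s * cos (\<Sum>r\<in>UNIV. real_of_int (s $ r) * \<theta> $ r))"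

definition regular_domain :: "(real ^ 'd::{finite,wellorder}) set \<Rightarrow> bool" where
  "regular_domain \<Omega> \<longleftrightarrow> \<Omega> \<subseteq> cbox 0 1 \<and> \<Omega> \<in> sets lebesgue \<and> frontier \<Omega> \<in> null_sets lebesgue"

end

theory Submission
  imports Defs
begin

text \<open>
  For bounded \<^term>\<open>p\<close> the moments of the spectral distribution are traces of powers, that is,
  weighted sums over closed walks on the grid.  Away from the null set of discontinuities and the
  boundary, the weights along a walk of fixed length all converge to the same value of \<^term>\<open>p\<close>, so
  dominated convergence turns the normalised traces into an integral of a power of \<^term>\<open>p\<close> times the
  number of weighted closed walks, which is the corresponding Fourier coefficient of a power of the
  symbol.  The Weierstrass theorem passes from moments to continuous functions.
  For general \<^term>\<open>p\<close>, clipping its values at height \<open>m\<close> changes only those rows and columns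
  that see a value above \<open>m\<close>; by interlacing this moves the eigenvalue counting function by at most
  the number of such rows, whose proportion tends to 0 as \<open>m\<close> grows.  Values of \<^term>\<open>p\<close> at
  midpoints outside the domain are arbitrary, but such midpoints occur only close to the null
  boundary.
\<close>

section \<open>Hermitian matrices indexed by finite sets\<close>

text \<open>Moments control the limit only when all eigenvalues and all values of the limit function
  lie in one compact interval independent of the size; this confines the moment argument to bounded
  weights. For an unbounded weight the difference between the original and the clipped matrix is not
  small in norm. Only the number of affected rows is under control, so the comparison has to run
  through counting functions and compactly supported test functions.

  Sums over nodes are divided by the number of grid cells in the unit cube rather than by the number
  of nodes, because they are then integrals of step functions. The number of nodes is itself such a
  sum, and the quotient is formed only at the end. The limit over multi-indices is reduced to
  sequences, to which dominated convergence applies. Matrices are functions on a finite set of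
  nodes, so the ordering of the rows is dealt with once, when the characteristic polynomial is
  computed.\<close>

lemma homogeneous_system_nontrivial_solution:
  fixes a :: "'b \<Rightarrow> 'a \<Rightarrow> 'k::field"
  assumes "finite J" "finite I" "card J < card I"
  shows "\<exists>c. (\<exists>i\<in>I. c i \<noteq> 0) \<and> (\<forall>j\<in>J. (\<Sum>i\<in>I. a j i * c i) = 0)"
  using assms
proof (induction J arbitrary: a I rule: finite_induct)
  case empty
  then have "I \<noteq> {}" by auto
  then show ?case by (intro exI[of _ "\<lambda>_. 1"]) auto
next
  case (insert j J)
  show ?case
  proof (cases "\<forall>i\<in>I. a j i = 0")
    case True
    have "card J < card I" using insert by auto
    from insert.IH[OF insert.prems(1) this, of a] True show ?thesis by auto
  next
    case False
    then obtain k where k: "k \<in> I" "a j k \<noteq> 0" by auto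
    define I' where "I' = I - {k}"
    have fin: "finite I'" "k \<notin> I'" and I: "I = insert k I'"
      using insert.prems k by (auto simp: I'_def)
    have "card J < card I'" using insert.hyps insert.prems fin I by auto
    \<comment> \<open>One elimination step: equation \<open>j\<close> is solved for the unknown
      \<open>k\<close>, whose coefficient is nonzero, and substituted into the other equations,
      which then have these coefficients on \<open>I'\<close>.\<close>
    from insert.IH[OF fin(1) this, of "\<lambda>j' i. a j' i - a j' k * a j i / a j k"]
    obtain c where c: "\<exists>i\<in>I'. c i \<noteq> 0"
      "\<And>j'. j' \<in> J \<Longrightarrow> (\<Sum>i\<in>I'. (a j' i - a j' k * a j i / a j k) * c i) = 0" by auto
    define d where "d = c(k := - (\<Sum>i\<in>I'. a j i * c i) / a j k)"
    have sumd: "(\<Sum>i\<in>I. a j' i * d i) = (\<Sum>i\<in>I'. a j' i * c i) - a j' k * (\<Sum>i\<in>I'. a j i * c i) / a j k" for j'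
    proof -
      have "(\<Sum>i\<in>I'. a j' i * d i) = (\<Sum>i\<in>I'. a j' i * c i)"
        using fin by (intro sum.cong) (auto simp: d_def)
      then show ?thesis unfolding I using fin by (simp add: d_def)
    qed
    have "(\<Sum>i\<in>I. a j i * d i) = 0" unfolding sumd using k by simp
    moreover have "(\<Sum>i\<in>I. a j' i * d i) = 0" if "j' \<in> J" for j'
    proof -
      have "0 = (\<Sum>i\<in>I'. a j' i * c i - (a j' k / a j k) * (a j i * c i))"
        using c(2)[OF that] by (simp add: algebra_simps)
      also have "\<dots> = (\<Sum>i\<in>I. a j' i * d i)"
        unfolding sumd by (simp add: sum_subtractf sum_distrib_left sum_divide_distrib)
      finally show ?thesis by simp
    qed
    moreover have "\<exists>i\<in>I. d i \<noteq> 0" using c(1) fin unfolding d_def I by auto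
    ultimately show ?thesis by (intro exI[of _ d]) auto
  qed
qed

text \<open>Factoring a polynomial that annihilates \<^term>\<open>x\<close> produces an eigenvector inside every
  set that contains \<^term>\<open>x\<close> and is invariant under all shifts of the operator.\<close>
lemma eigenvector_in_invariant_set:
  fixes A :: "'a \<Rightarrow> 'a \<Rightarrow> complex"
  assumes fin: "finite V"
    and inv: "\<And>x a. x \<in> S \<Longrightarrow> (\<lambda>i. (\<Sum>k\<in>V. A i k * x k) - a * x i) \<in> S"
    and x: "x \<in> S" "\<exists>i\<in>V. x i \<noteq> 0"
  shows "\<exists>y\<in>S. \<exists>a. (\<exists>i\<in>V. y i \<noteq> 0) \<and> (\<forall>i\<in>V. (\<Sum>k\<in>V. A i k * y k) = a * y i)"
proof -
  define T where "T y = (\<lambda>i. \<Sum>k\<in>V. A i k * y k)" for y :: "'a \<Rightarrow> complex"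
  define shifts where "shifts as = foldr (\<lambda>a y i. T y i - a * y i) as x" for as
  have shifts_S: "shifts as \<in> S" for as
    by (induction as) (use x inv in \<open>auto simp: shifts_def T_def\<close>)
  \<comment> \<open>If a chain of shifts ends in zero on \<open>V\<close>, the last iterate that
    does not vanish on \<open>V\<close> is an eigenvector.\<close>
  have ev: "\<exists>y\<in>S. \<exists>a. (\<exists>i\<in>V. y i \<noteq> 0) \<and> (\<forall>i\<in>V. T y i = a * y i)"
    if "\<forall>i\<in>V. shifts as i = 0" for as
    using that
  proof (induction as)
    case Nil then show ?case using x by (auto simp: shifts_def)
  next
    case (Cons a as)
    show ?case
    proof (cases "\<forall>i\<in>V. shifts as i = 0")
      case True then show ?thesis by (rule Cons.IH)
    next
      case False
      moreover have "\<forall>i\<in>V. T (shifts as) i = a * shifts as i"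
        using Cons.prems by (simp add: shifts_def)
      ultimately show ?thesis using shifts_S by blast
    qed
  qed
  \<comment> \<open>Composing shifts applies the polynomial with roots \<open>as\<close> to the
    operator. Expanding it in the iterates of \<open>x\<close> lets an annihilating polynomial be
    used in factored form.\<close>
  have shifts_poly: "shifts as i = (\<Sum>k\<le>length as. coeff (\<Prod>a\<leftarrow>as. [:- a, 1:]) k * (T ^^ k) x i)" for as i
  proof (induction as arbitrary: i)
    case Nil then show ?case by (simp add: shifts_def)
  next
    case (Cons a as)
    let ?p = "\<Prod>a\<leftarrow>as. [:- a, 1:]" and ?m = "length as"
    have deg: "coeff ?p (Suc ?m) = 0"
      by (rule coeff_eq_0) (simp add: degree_linear_factors[of uminus as])
    have "T (shifts as) i = (\<Sum>j\<in>V. A i j * (\<Sum>k\<le>?m. coeff ?p k * (T ^^ k) x j))"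
      unfolding T_def using Cons.IH by (simp add: T_def)
    also have "\<dots> = (\<Sum>k\<le>?m. coeff ?p k * (\<Sum>j\<in>V. A i j * (T ^^ k) x j))"
      unfolding sum_distrib_left by (subst sum.swap) (simp add: mult.left_commute)
    also have "\<dots> = (\<Sum>k\<le>?m. coeff ?p k * (T ^^ Suc k) x i)"
      by (simp add: T_def)
    finally have T: "T (shifts as) i = (\<Sum>k\<le>?m. coeff ?p k * (T ^^ Suc k) x i)" .
    have "shifts (a # as) i = T (shifts as) i - a * shifts as i"
      by (simp add: shifts_def)
    also have "\<dots> = (\<Sum>k\<le>?m. coeff ?p k * (T ^^ Suc k) x i) - a * (\<Sum>k\<le>?m. coeff ?p k * (T ^^ k) x i)"
      using T Cons.IH by simp
    also have "\<dots> = (\<Sum>k\<le>Suc ?m. coeff (pCons 0 ?p) k * (T ^^ k) x i) - a * (\<Sum>k\<le>Suc ?m. coeff ?p k * (T ^^ k) x i)"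
      using deg by (subst sum.atMost_Suc_shift) simp
    also have "\<dots> = (\<Sum>k\<le>Suc ?m. coeff ([:-a, 1:] * ?p) k * (T ^^ k) x i)"
      unfolding sum_distrib_left sum_subtractf[symmetric]
      by (intro sum.cong refl) (simp add: algebra_simps)
    finally show ?case by simp
  qed
  let ?n = "card V"
  \<comment> \<open>The \<open>card V + 1\<close> vectors \<open>x\<close>, \<open>T x\<close>, ...
    are linearly dependent on \<open>V\<close>; the dependency is a nonzero polynomial annihilating
    \<open>x\<close> there.\<close>
  have "card V < card {..?n}" by simp
  from homogeneous_system_nontrivial_solution[OF fin _ this, of "\<lambda>i k. (T ^^ k) x i"]
  obtain c where c: "\<exists>k\<in>{..?n}. c k \<noteq> 0" "\<And>i. i \<in> V \<Longrightarrow> (\<Sum>k\<le>?n. (T ^^ k) x i * c k) = 0" by auto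
  define q where "q = (\<Sum>k\<le>?n. monom (c k) k)"
  have cq: "coeff q k = (if k \<le> ?n then c k else 0)" for k
    unfolding q_def by (simp add: coeff_sum coeff_monom sum.delta)
  have q0: "q \<noteq> 0" using c(1) cq by (metis atMost_iff coeff_0)
  have degq: "degree q \<le> ?n" by (rule degree_le) (simp add: cq)
  obtain as where as: "Polynomial.smult (lead_coeff q) (\<Prod>a\<leftarrow>as. [:- a, 1:]) = q"
    using fundamental_theorem_algebra_factorized[of q] by blast
  have len: "length as = degree q"
    using arg_cong[OF as, of degree] q0 by (simp add: degree_linear_factors[of uminus as])
  have "shifts as i = 0" if "i \<in> V" for i
  proof -
    have "lead_coeff q * shifts as i = (\<Sum>k\<le>degree q. coeff q k * (T ^^ k) x i)"
      unfolding shifts_poly len sum_distrib_left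
      by (subst (4) as[symmetric]) (simp add: mult.assoc)
    also have "\<dots> = (\<Sum>k\<le>?n. coeff q k * (T ^^ k) x i)"
      using degq by (intro sum.mono_neutral_left) (auto simp: coeff_eq_0)
    also have "\<dots> = (\<Sum>k\<le>?n. (T ^^ k) x i * c k)"
      by (intro sum.cong) (auto simp: cq mult.commute)
    also have "\<dots> = 0" using c(2) that by simp
    finally show ?thesis using q0 by simp
  qed
  then show ?thesis using ev[of as] by (auto simp: T_def)
qed

text \<open>Eigenvectors are labelled by elements of the index set itself: with \<open>J = V\<close>
  orthonormality alone makes the system complete, so multiplicities need no bookkeeping. Smaller
  \<open>J\<close> serve the inductive construction and the spectral subspaces.\<close>

definition orthonormal_eigensystem ::
  "'a set \<Rightarrow> ('a \<Rightarrow> 'a \<Rightarrow> complex) \<Rightarrow> 'a set \<Rightarrow> ('a \<Rightarrow> 'a \<Rightarrow> complex) \<Rightarrow> ('a \<Rightarrow> real) \<Rightarrow> bool" where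
  "orthonormal_eigensystem V A J u l \<longleftrightarrow>
     (\<forall>j\<in>J. \<forall>i\<in>V. (\<Sum>k\<in>V. A i k * u j k) = of_real (l j) * u j i) \<and>
     (\<forall>j\<in>J. \<forall>k\<in>J. (\<Sum>i\<in>V. u j i * cnj (u k i)) = (if j = k then 1 else 0))"

lemma Hermitian_adjoint:
  fixes A :: "'a \<Rightarrow> 'a \<Rightarrow> complex"
  assumes herm: "\<And>i j. i \<in> V \<Longrightarrow> j \<in> V \<Longrightarrow> A i j = cnj (A j i)"
  shows "(\<Sum>i\<in>V. (\<Sum>k\<in>V. A i k * x k) * cnj (y i)) = (\<Sum>k\<in>V. x k * cnj (\<Sum>i\<in>V. A k i * y i))"
proof -
  have "(\<Sum>i\<in>V. (\<Sum>k\<in>V. A i k * x k) * cnj (y i)) = (\<Sum>i\<in>V. \<Sum>k\<in>V. A i k * x k * cnj (y i))"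
    by (simp add: sum_distrib_right)
  also have "\<dots> = (\<Sum>k\<in>V. \<Sum>i\<in>V. A i k * x k * cnj (y i))" by (rule sum.swap)
  also have "\<dots> = (\<Sum>k\<in>V. \<Sum>i\<in>V. x k * cnj (A k i * y i))"
  proof (intro sum.cong refl)
    fix i k assume "k \<in> V" "i \<in> V"
    then have "A i k = cnj (A k i)" using herm by blast
    then show "A i k * x k * cnj (y i) = x k * cnj (A k i * y i)" by simp
  qed
  finally show ?thesis by (simp add: sum_distrib_left)
qed

lemma sum_mult_cnj_self:
  "(\<Sum>i\<in>V. x i * cnj (x i)) = of_real (\<Sum>i\<in>V. (cmod (x i))\<^sup>2)"
  by (simp only: complex_norm_square of_real_sum)

text \<open>Deflation: the orthogonal complement of the eigenvectors found so far is invariant under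
  shifts of a Hermitian operator and, while \<open>J\<close> is smaller than \<open>V\<close>,
  contains a nonzero vector, hence an eigenvector.\<close>

lemma Hermitian_orthonormal_eigensystem_exists:
  fixes A :: "'a \<Rightarrow> 'a \<Rightarrow> complex"
  assumes fin: "finite V"
    and herm: "\<And>i j. i \<in> V \<Longrightarrow> j \<in> V \<Longrightarrow> A i j = cnj (A j i)"
    and J: "J \<subseteq> V"
  shows "\<exists>u l. orthonormal_eigensystem V A J u l"
  using finite_subset[OF J fin] J
proof (induction rule: finite_subset_induct')
  case empty
  then show ?case by (simp add: orthonormal_eigensystem_def)
next
  case (insert j J)
  then obtain u l where ul: "orthonormal_eigensystem V A J u l" by blast
  have eq: "\<And>j i. j \<in> J \<Longrightarrow> i \<in> V \<Longrightarrow> (\<Sum>k\<in>V. A i k * u j k) = of_real (l j) * u j i"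
    and orth: "\<And>j k. j \<in> J \<Longrightarrow> k \<in> J \<Longrightarrow> (\<Sum>i\<in>V. u j i * cnj (u k i)) = (if j = k then 1 else 0)"
    using ul by (auto simp: orthonormal_eigensystem_def)
  define S where "S = {x. \<forall>k\<in>J. (\<Sum>i\<in>V. x i * cnj (u k i)) = 0}"
  have inv: "(\<lambda>i. (\<Sum>k\<in>V. A i k * x k) - a * x i) \<in> S" if "x \<in> S" for x a
    unfolding S_def
  proof (intro CollectI ballI)
    fix k assume k: "k \<in> J"
    have "(\<Sum>i\<in>V. ((\<Sum>k\<in>V. A i k * x k) - a * x i) * cnj (u k i))
      = (\<Sum>i\<in>V. (\<Sum>k\<in>V. A i k * x k) * cnj (u k i)) - a * (\<Sum>i\<in>V. x i * cnj (u k i))"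
      by (simp add: left_diff_distrib sum_subtractf sum_distrib_left mult.assoc)
    also have "\<dots> = (\<Sum>m\<in>V. x m * cnj (\<Sum>i\<in>V. A m i * u k i))"
      using that k by (simp add: S_def Hermitian_adjoint[OF herm])
    also have "\<dots> = of_real (l k) * (\<Sum>m\<in>V. x m * cnj (u k m))"
      using eq[OF k] by (simp add: sum_distrib_left mult.left_commute)
    also have "\<dots> = 0" using that k by (simp add: S_def)
    finally show "(\<Sum>i\<in>V. ((\<Sum>k\<in>V. A i k * x k) - a * x i) * cnj (u k i)) = 0" .
  qed
  have "J \<subset> V" using insert by auto
  then have "card J < card V" using fin psubset_card_mono by blast
  from homogeneous_system_nontrivial_solution[OF \<open>finite J\<close> fin this, of "\<lambda>k i. cnj (u k i)"]
  obtain x where "\<exists>i\<in>V. x i \<noteq> 0" "x \<in> S" by (auto simp: S_def mult.commute)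
  from eigenvector_in_invariant_set[of V S A x, OF fin inv this(2,1)]
  obtain y a where y: "y \<in> S" "\<exists>i\<in>V. y i \<noteq> 0" "\<And>i. i \<in> V \<Longrightarrow> (\<Sum>k\<in>V. A i k * y k) = a * y i" by blast
  define s where "s = (\<Sum>i\<in>V. (cmod (y i))\<^sup>2)"
  have s: "s > 0" unfolding s_def using y(2) fin by (auto intro!: sum_pos2)
  have sv: "of_real s = (\<Sum>i\<in>V. y i * cnj (y i))" by (simp only: s_def sum_mult_cnj_self)
  \<comment> \<open>Moving the operator across the inner product gives \<open>a = cnj a\<close>, so
    the eigenvalue is real.\<close>
  have "a * of_real s = (\<Sum>i\<in>V. (\<Sum>k\<in>V. A i k * y k) * cnj (y i))"
    unfolding sv using y(3) by (simp add: sum_distrib_left mult.assoc)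
  also have "\<dots> = (\<Sum>k\<in>V. y k * cnj (\<Sum>i\<in>V. A k i * y i))" by (rule Hermitian_adjoint[OF herm])
  also have "\<dots> = cnj a * of_real s"
    unfolding sv using y(3) by (simp add: sum_distrib_left mult.left_commute)
  finally have "a = cnj a" using s by simp
  then have a: "a = of_real (Re a)" by (simp add: complex_eq_iff)
  define z where "z = (\<lambda>i. y i / of_real (sqrt s))"
  have z1: "(\<Sum>i\<in>V. z i * cnj (z i)) = 1"
  proof -
    have "(\<Sum>i\<in>V. z i * cnj (z i)) = (\<Sum>i\<in>V. y i * cnj (y i)) / of_real (sqrt s * sqrt s)"
      unfolding sum_divide_distrib z_def
      by (intro sum.cong) (simp_all del: real_sqrt_mult_self)
    then show ?thesis using s by (simp add: sv[symmetric] del: of_real_mult)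
  qed
  have z2: "(\<Sum>i\<in>V. z i * cnj (u k i)) = 0" if "k \<in> J" for k
  proof -
    have "(\<Sum>i\<in>V. z i * cnj (u k i)) = (\<Sum>i\<in>V. y i * cnj (u k i)) / of_real (sqrt s)"
      unfolding sum_divide_distrib z_def by simp
    then show ?thesis using y(1) that by (simp add: S_def)
  qed
  have z3: "(\<Sum>i\<in>V. u k i * cnj (z i)) = 0" if "k \<in> J" for k
    using arg_cong[OF z2[OF that], of cnj] by (simp add: mult.commute)
  have z4: "(\<Sum>k\<in>V. A i k * z k) = of_real (Re a) * z i" if "i \<in> V" for i
  proof -
    have "(\<Sum>k\<in>V. A i k * z k) = (\<Sum>k\<in>V. A i k * y k) / of_real (sqrt s)"
      unfolding sum_divide_distrib z_def by simp
    then show ?thesis using y(3)[OF that] by (simp add: z_def a[symmetric])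
  qed
  have "orthonormal_eigensystem V A (insert j J) (u(j := z)) (l(j := Re a))"
    unfolding orthonormal_eigensystem_def
    using eq orth z1 z2 z3 z4 \<open>j \<notin> J\<close> by auto
  then show ?case by blast
qed

section \<open>Characteristic polynomial and completeness of an eigensystem\<close>

lemma bij_betw_nth_set:
  "distinct vs \<Longrightarrow> bij_betw ((!) vs) {0..<length vs} (set vs)"
  by (rule bij_betw_nth) auto

lemma sum_nth_distinct:
  assumes "distinct vs"
  shows "(\<Sum>a = 0..<length vs. f (vs ! a)) = (\<Sum>i\<in>set vs. f i)"
  using sum.reindex_bij_betw[OF bij_betw_nth_set[OF assms], of f] .

context
  fixes vs :: "'a list" and A :: "'a \<Rightarrow> 'a \<Rightarrow> complex" and u l
  assumes dist: "distinct vs"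
    and sys: "orthonormal_eigensystem (set vs) A (set vs) u l"
begin

private lemma eigen_eq: "j \<in> set vs \<Longrightarrow> i \<in> set vs \<Longrightarrow> (\<Sum>k\<in>set vs. A i k * u j k) = of_real (l j) * u j i"
  and orth: "j \<in> set vs \<Longrightarrow> k \<in> set vs \<Longrightarrow> (\<Sum>i\<in>set vs. u j i * cnj (u k i)) = (if j = k then 1 else 0)"
  using sys unfolding orthonormal_eigensystem_def by blast+

text \<open>The unitary change of basis with the eigenvectors as columns; \<open>Q\<close> is its
  adjoint, and orthonormality says that \<open>Q\<close> is a left inverse.\<close>

private definition P where "P = mat (length vs) (length vs) (\<lambda>(a, b). u (vs ! b) (vs ! a))"
private definition Q where "Q = mat (length vs) (length vs) (\<lambda>(a, b). cnj (u (vs ! a) (vs ! b)))"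

private lemma carrier: "P \<in> carrier_mat (length vs) (length vs)" "Q \<in> carrier_mat (length vs) (length vs)"
  by (auto simp: P_def Q_def)

private lemma QP: "Q * P = 1\<^sub>m (length vs)"
proof (rule eq_matI)
  fix a b assume ab: "a < dim_row (1\<^sub>m (length vs))" "b < dim_col (1\<^sub>m (length vs))"
  have "(Q * P) $$ (a, b) = (\<Sum>k = 0..<length vs. cnj (u (vs ! a) (vs ! k)) * u (vs ! b) (vs ! k))"
    using ab by (simp add: P_def Q_def scalar_prod_def)
  also have "\<dots> = (\<Sum>i\<in>set vs. u (vs ! b) i * cnj (u (vs ! a) i))"
    using sum_nth_distinct[OF dist, of "\<lambda>i. u (vs ! b) i * cnj (u (vs ! a) i)"] by (simp add: mult.commute)
  also have "\<dots> = 1\<^sub>m (length vs) $$ (a, b)"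
    using orth[of "vs ! b" "vs ! a"] ab dist by (simp add: nth_eq_iff_index_eq)
  finally show "(Q * P) $$ (a, b) = 1\<^sub>m (length vs) $$ (a, b)" .
qed (simp_all add: P_def Q_def)

text \<open>For square matrices a one-sided inverse is two-sided; this turns orthonormality into
  completeness.\<close>

private lemma PQ: "P * Q = 1\<^sub>m (length vs)"
  by (rule mat_mult_left_right_inverse[OF carrier(2,1) QP])

lemma eigensystem_complete:
  assumes "i \<in> set vs" "k \<in> set vs"
  shows "(\<Sum>j\<in>set vs. u j i * cnj (u j k)) = (if i = k then 1 else 0)"
proof -
  obtain a b where ab: "a < length vs" "b < length vs" "vs ! a = i" "vs ! b = k"
    using assms by (auto simp: in_set_conv_nth)
  have "(P * Q) $$ (a, b) = (\<Sum>j\<in>set vs. u j i * cnj (u j k))"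
    using ab sum_nth_distinct[OF dist, of "\<lambda>j. u j i * cnj (u j k)"]
    by (simp add: P_def Q_def scalar_prod_def)
  then show ?thesis using ab dist by (auto simp: PQ nth_eq_iff_index_eq)
qed

text \<open>Through \<open>P\<close> and \<open>Q\<close> the matrix is similar to the diagonal
  matrix of the \<open>l j\<close>.\<close>

lemma char_poly_eigensystem:
  "char_poly (mat (length vs) (length vs) (\<lambda>(a, b). A (vs ! a) (vs ! b)))
    = (\<Prod>j\<leftarrow>vs. [:- complex_of_real (l j), 1:])"
proof -
  let ?N = "length vs"
  define M where "M = mat ?N ?N (\<lambda>(a, b). A (vs ! a) (vs ! b))"
  define D where "D = mat ?N ?N (\<lambda>(a, b). if a = b then complex_of_real (l (vs ! a)) else 0)"
  have M: "M \<in> carrier_mat ?N ?N" and D: "D \<in> carrier_mat ?N ?N" by (auto simp: M_def D_def)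
  have "M * P = P * D"
  proof (rule eq_matI)
    fix a b assume "a < dim_row (P * D)" "b < dim_col (P * D)"
    then have ab: "a < ?N" "b < ?N" by (auto simp: P_def D_def)
    have "(M * P) $$ (a, b) = (\<Sum>k = 0..<?N. A (vs ! a) (vs ! k) * u (vs ! b) (vs ! k))"
      using ab by (simp add: M_def P_def scalar_prod_def)
    also have "\<dots> = (\<Sum>k\<in>set vs. A (vs ! a) k * u (vs ! b) k)"
      by (rule sum_nth_distinct[OF dist])
    also have "\<dots> = of_real (l (vs ! b)) * u (vs ! b) (vs ! a)"
      using ab by (intro eigen_eq) auto
    also have "\<dots> = (P * D) $$ (a, b)"
      using ab by (simp add: P_def D_def scalar_prod_def if_distrib cong: if_cong)
    finally show "(M * P) $$ (a, b) = (P * D) $$ (a, b)" .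
  qed (auto simp: M_def P_def D_def)
  then have "P * D * Q = M * P * Q" by simp
  also have "\<dots> = M" using M carrier PQ by (simp add: assoc_mult_mat[of _ ?N ?N _ ?N _ ?N])
  finally have "similar_mat_wit M D P Q"
    by (intro similar_mat_witI[OF PQ QP _ M D carrier]) simp
  then have "char_poly M = char_poly D" by (intro char_poly_similar) (auto simp: similar_mat_def)
  also have "\<dots> = (\<Prod>a\<leftarrow>diag_mat D. [:- a, 1:])"
    by (rule char_poly_upper_triangular[OF D]) (auto simp: D_def)
  also have "diag_mat D = map (\<lambda>j. complex_of_real (l j)) vs"
    by (rule nth_equalityI) (auto simp: diag_mat_def D_def)
  finally show ?thesis by (simp add: M_def o_def)
qed

end

lemma proots_linear_factors:
  fixes f :: "'a \<Rightarrow> 'b::idom"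
  shows "proots (\<Prod>j\<leftarrow>vs. [:- f j, 1:]) = image_mset f (mset vs)"
proof (induction vs)
  case (Cons v vs)
  have "(\<Prod>j\<leftarrow>vs. [:- f j, 1:]) \<noteq> 0" by (induction vs) (simp_all del: mult_pCons_left)
  then show ?case
    using Cons.IH by (simp add: proots_mult del: mult_pCons_left)
qed simp

text \<open>Bridge from roots of the characteristic polynomial to labelled eigenvalues. The
  right-hand side depends on \<open>vs\<close> only through its set, so the order of the nodes drops
  out here.\<close>

lemma eigenvalues_mset_eigensystem:
  fixes a :: "'a \<Rightarrow> 'a \<Rightarrow> real"
  assumes "distinct vs"
    and "orthonormal_eigensystem (set vs) (\<lambda>i j. complex_of_real (a i j)) (set vs) u l"
  shows "eigenvalues_mset (mat (length vs) (length vs) (\<lambda>(r, s). a (vs ! r) (vs ! s)))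
    = {#complex_of_real (l j). j \<in># mset_set (set vs)#}"
proof -
  have "map_mat complex_of_real (mat (length vs) (length vs) (\<lambda>(r, s). a (vs ! r) (vs ! s)))
     = mat (length vs) (length vs) (\<lambda>(r, s). complex_of_real (a (vs ! r) (vs ! s)))"
    by (rule eq_matI) auto
  then have "eigenvalues_mset (mat (length vs) (length vs) (\<lambda>(r, s). a (vs ! r) (vs ! s)))
     = proots (\<Prod>j\<leftarrow>vs. [:- complex_of_real (l j), 1:])"
    unfolding eigenvalues_mset_def by (simp add: char_poly_eigensystem[OF assms])
  also have "\<dots> = {#complex_of_real (l j). j \<in># mset vs#}"
    by (rule proots_linear_factors)
  also have "mset vs = mset_set (set vs)" using assms(1) by (rule mset_set_set[symmetric])
  finally show ?thesis .
qed

text \<open>Parseval's identity and the diagonalised quadratic form. Together they bound the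
  Rayleigh quotient on a spectral subspace by the eigenvalues that span it.\<close>

lemma eigensystem_norm2:
  fixes A :: "'a \<Rightarrow> 'a \<Rightarrow> complex" and c :: "'a \<Rightarrow> complex"
  assumes "finite V" "finite J" "orthonormal_eigensystem V A J u l"
  defines "x \<equiv> (\<lambda>i. \<Sum>j\<in>J. c j * u j i)"
  shows "(\<Sum>i\<in>V. (cmod (x i))\<^sup>2) = (\<Sum>j\<in>J. (cmod (c j))\<^sup>2)"
    and "(\<Sum>i\<in>V. (\<Sum>k\<in>V. A i k * x k) * cnj (x i)) = of_real (\<Sum>j\<in>J. l j * (cmod (c j))\<^sup>2)"
proof -
  have eq: "\<And>j i. j \<in> J \<Longrightarrow> i \<in> V \<Longrightarrow> (\<Sum>k\<in>V. A i k * u j k) = of_real (l j) * u j i"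
    and orth: "\<And>j k. j \<in> J \<Longrightarrow> k \<in> J \<Longrightarrow> (\<Sum>i\<in>V. u j i * cnj (u k i)) = (if j = k then 1 else 0)"
    using assms(3) by (auto simp: orthonormal_eigensystem_def)
  have ip: "(\<Sum>i\<in>V. (\<Sum>j\<in>J. d j * u j i) * cnj (x i)) = (\<Sum>j\<in>J. d j * cnj (c j))" for d
  proof -
    have "(\<Sum>i\<in>V. (\<Sum>j\<in>J. d j * u j i) * cnj (x i))
        = (\<Sum>i\<in>V. \<Sum>j\<in>J. \<Sum>k\<in>J. d j * cnj (c k) * (u j i * cnj (u k i)))"
      unfolding x_def cnj_sum sum_product by (intro sum.cong refl) (simp add: algebra_simps)
    also have "\<dots> = (\<Sum>j\<in>J. \<Sum>k\<in>J. \<Sum>i\<in>V. d j * cnj (c k) * (u j i * cnj (u k i)))"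
      by (subst sum.swap) (intro sum.cong refl sum.swap)
    also have "\<dots> = (\<Sum>j\<in>J. \<Sum>k\<in>J. d j * cnj (c k) * (if j = k then 1 else 0))"
      unfolding sum_distrib_left[symmetric] using orth by (intro sum.cong refl) simp
    also have "\<dots> = (\<Sum>j\<in>J. d j * cnj (c j))"
      using assms(2) by (simp add: if_distrib[of "\<lambda>y. _ * y"] sum.delta cong: if_cong)
    finally show ?thesis .
  qed
  have "complex_of_real (\<Sum>i\<in>V. (cmod (x i))\<^sup>2) = (\<Sum>i\<in>V. x i * cnj (x i))"
    by (simp only: sum_mult_cnj_self)
  also have "\<dots> = (\<Sum>j\<in>J. c j * cnj (c j))" using ip[of c] by (simp add: x_def)
  also have "\<dots> = complex_of_real (\<Sum>j\<in>J. (cmod (c j))\<^sup>2)" by (simp only: sum_mult_cnj_self)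
  finally show "(\<Sum>i\<in>V. (cmod (x i))\<^sup>2) = (\<Sum>j\<in>J. (cmod (c j))\<^sup>2)"
    by (simp only: of_real_eq_iff)
  have Ax: "(\<Sum>k\<in>V. A i k * x k) = (\<Sum>j\<in>J. (of_real (l j) * c j) * u j i)" if "i \<in> V" for i
  proof -
    have "(\<Sum>k\<in>V. A i k * x k) = (\<Sum>j\<in>J. c j * (\<Sum>k\<in>V. A i k * u j k))"
      unfolding x_def sum_distrib_left by (subst sum.swap) (simp add: mult.left_commute)
    then show ?thesis using eq that by (simp add: algebra_simps)
  qed
  have "(\<Sum>i\<in>V. (\<Sum>k\<in>V. A i k * x k) * cnj (x i)) = (\<Sum>j\<in>J. (of_real (l j) * c j) * cnj (c j))"
    using ip[of "\<lambda>j. of_real (l j) * c j"] Ax by simp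
  also have "\<dots> = of_real (\<Sum>j\<in>J. l j * (cmod (c j))\<^sup>2)"
    by (simp only: of_real_sum of_real_mult complex_norm_square mult.assoc)
  finally show "(\<Sum>i\<in>V. (\<Sum>k\<in>V. A i k * x k) * cnj (x i)) = of_real (\<Sum>j\<in>J. l j * (cmod (c j))\<^sup>2)" .
qed

lemma orthonormal_eigensystem_subset:
  "orthonormal_eigensystem V A J u l \<Longrightarrow> I \<subseteq> J \<Longrightarrow> orthonormal_eigensystem V A I u l"
  by (auto simp: orthonormal_eigensystem_def subset_iff)

text \<open>If the inequality failed, a dimension count would produce a nonzero vector, vanishing on
  \<^term>\<open>R\<close>, which lies both in the span of the low eigenvectors of \<^term>\<open>A\<close> and of the high ones
  of \<^term>\<open>B\<close>; the two quadratic forms agree on it.\<close>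
lemma eigenvalue_count_le:
  assumes fin: "finite V" and R: "R \<subseteq> V"
    and AB: "\<And>i j. i \<in> V - R \<Longrightarrow> j \<in> V - R \<Longrightarrow> A i j = B i j"
    and A: "orthonormal_eigensystem V A V u l" and B: "orthonormal_eigensystem V B V v m"
  shows "card {j\<in>V. l j \<le> t} \<le> card {j\<in>V. m j \<le> t} + card R"
proof (rule ccontr)
  assume *: "\<not> ?thesis"
  define I where "I = {j\<in>V. l j \<le> t}"
  define K where "K = {j\<in>V. m j > t}"
  have finI: "finite I" "finite K" "finite R" using fin R by (auto simp: I_def K_def intro: finite_subset)
  have "{j\<in>V. m j \<le> t} = V - K" by (auto simp: K_def)
  then have "card {j\<in>V. m j \<le> t} = card V - card K"
    using finI by (simp add: card_Diff_subset K_def)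
  moreover have "card K \<le> card V" using fin by (auto simp: K_def intro: card_mono)
  ultimately have "card V + card R < card I + card K" using * by (simp add: I_def)
  \<comment> \<open>The unknowns are the coefficients of low eigenvectors of \<open>A\<close>
    (\<open>Inl\<close>) and of high eigenvectors of \<open>B\<close> (\<open>Inr\<close>). The
    equations say that the two combinations agree on \<open>V\<close> (\<open>Inl\<close>) and that
    the first vanishes on \<open>R\<close> (\<open>Inr\<close>).\<close>
  then have "card (V <+> R) < card (I <+> K)" using finI fin by (simp add: card_Plus)
  from homogeneous_system_nontrivial_solution[OF _ _ this, of
      "\<lambda>e w. case e of
         Inl i \<Rightarrow> (case w of Inl j \<Rightarrow> u j i | Inr k \<Rightarrow> - v k i)
       | Inr i \<Rightarrow> (case w of Inl j \<Rightarrow> u j i | Inr k \<Rightarrow> 0)"]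
  obtain c where c0: "\<exists>w\<in>I <+> K. c w \<noteq> 0" and cs: "\<And>e. e \<in> V <+> R \<Longrightarrow> (\<Sum>w\<in>I <+> K. (case e of
         Inl i \<Rightarrow> (case w of Inl j \<Rightarrow> u j i | Inr k \<Rightarrow> - v k i)
       | Inr i \<Rightarrow> (case w of Inl j \<Rightarrow> u j i | Inr k \<Rightarrow> 0)) * c w) = 0"
    using finI fin by auto
  have c: "(\<Sum>j\<in>I. u j i * c (Inl j)) + (\<Sum>k\<in>K. - v k i * c (Inr k)) = 0" if "i \<in> V" for i
    using cs[of "Inl i"] that finI by (simp add: sum.Plus InlI)
  have cR: "(\<Sum>j\<in>I. u j i * c (Inl j)) = 0" if "i \<in> R" for i
    using cs[of "Inr i"] that finI by (simp add: sum.Plus InrI)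
  define x where "x i = (\<Sum>j\<in>I. c (Inl j) * u j i)" for i
  define y where "y i = (\<Sum>j\<in>K. c (Inr j) * v j i)" for i
  have xy: "x i = y i" if "i \<in> V" for i
    using c[OF that] by (simp add: x_def y_def sum_negf mult.commute)
  have xR: "x i = 0" if "i \<in> R" for i
    using cR[OF that] by (simp add: x_def mult.commute)
  note SA = eigensystem_norm2[OF fin finI(1) orthonormal_eigensystem_subset[OF A], of "\<lambda>j. c (Inl j)", folded x_def]
  note SB = eigensystem_norm2[OF fin finI(2) orthonormal_eigensystem_subset[OF B], of "\<lambda>j. c (Inr j)", folded y_def]
  have sub: "I \<subseteq> V" "K \<subseteq> V" by (auto simp: I_def K_def)
  define n where "n = (\<Sum>i\<in>V. (cmod (x i))\<^sup>2)"
  have nI: "n = (\<Sum>j\<in>I. (cmod (c (Inl j)))\<^sup>2)" unfolding n_def by (rule SA(1)[OF sub(1)])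
  have nK: "n = (\<Sum>j\<in>K. (cmod (c (Inr j)))\<^sup>2)"
    unfolding n_def using SB(1)[OF sub(2)] xy by simp
  \<comment> \<open>The nonzero coefficient may belong to either family; as \<open>n\<close> is the
    squared norm of both combinations, the common vector is nonzero in either case.\<close>
  have n0: "n > 0"
  proof -
    from c0 consider j where "j \<in> I" "c (Inl j) \<noteq> 0" | k where "k \<in> K" "c (Inr k) \<noteq> 0" by auto
    then show ?thesis
    proof cases
      case 1 then show ?thesis unfolding nI using finI by (auto intro!: sum_pos2)
    next
      case 2 then show ?thesis unfolding nK using finI by (auto intro!: sum_pos2)
    qed
  qed
  have "(\<Sum>i\<in>V. (\<Sum>k\<in>V. A i k * x k) * cnj (x i)) = (\<Sum>i\<in>V. (\<Sum>k\<in>V. B i k * y k) * cnj (y i))"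
  proof (rule sum.cong[OF refl])
    fix i assume i: "i \<in> V"
    show "(\<Sum>k\<in>V. A i k * x k) * cnj (x i) = (\<Sum>k\<in>V. B i k * y k) * cnj (y i)"
    proof (cases "i \<in> R")
      case True then show ?thesis using xR[of i] xy[OF i] by simp
    next
      case False
      have "(\<Sum>k\<in>V. A i k * x k) = (\<Sum>k\<in>V. B i k * y k)"
      proof (rule sum.cong[OF refl])
        fix k assume k: "k \<in> V"
        show "A i k * x k = B i k * y k"
          using xR xy[OF k] AB[of i k] i k False by (cases "k \<in> R") auto
      qed
      then show ?thesis using xy i by simp
    qed
  qed
  then have "complex_of_real (\<Sum>j\<in>I. l j * (cmod (c (Inl j)))\<^sup>2) = of_real (\<Sum>j\<in>K. m j * (cmod (c (Inr j)))\<^sup>2)"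
    unfolding SA(2)[OF sub(1)] SB(2)[OF sub(2)] .
  then have e: "(\<Sum>j\<in>I. l j * (cmod (c (Inl j)))\<^sup>2) = (\<Sum>j\<in>K. m j * (cmod (c (Inr j)))\<^sup>2)"
    by (simp only: of_real_eq_iff)
  \<comment> \<open>The quadratic form is at most \<open>t * n\<close> on the low side and exceeds
    \<open>t * n\<close> on the high side, since \<open>m j > t\<close> is strict on
    \<open>K\<close> and some coefficient there is nonzero.\<close>
  have "(\<Sum>j\<in>I. l j * (cmod (c (Inl j)))\<^sup>2) \<le> (\<Sum>j\<in>I. t * (cmod (c (Inl j)))\<^sup>2)"
    by (intro sum_mono mult_right_mono) (auto simp: I_def)
  also have "\<dots> = t * n" by (simp add: nI sum_distrib_left)
  also have "\<dots> = (\<Sum>j\<in>K. t * (cmod (c (Inr j)))\<^sup>2)" by (simp add: nK sum_distrib_left)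
  also have "\<dots> < (\<Sum>j\<in>K. m j * (cmod (c (Inr j)))\<^sup>2)"
  proof (rule sum_strict_mono_ex1[OF finI(2)])
    show "\<forall>j\<in>K. t * (cmod (c (Inr j)))\<^sup>2 \<le> m j * (cmod (c (Inr j)))\<^sup>2"
      by (auto simp: K_def intro!: mult_right_mono)
    have "\<exists>k\<in>K. c (Inr k) \<noteq> 0"
    proof (rule ccontr)
      assume "\<not> ?thesis"
      then have "n = 0" unfolding nK by simp
      then show False using n0 by simp
    qed
    then show "\<exists>j\<in>K. t * (cmod (c (Inr j)))\<^sup>2 < m j * (cmod (c (Inr j)))\<^sup>2"
      by (auto simp: K_def intro!: mult_strict_right_mono)
  qed
  finally show False using e by simp
qed

text \<open>Entry \<open>i j\<close> sums the weights of all walks of length \<open>k\<close> from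
  \<open>i\<close> to \<open>j\<close> within \<open>V\<close>. The recursion extends a walk at its
  end and keeps the start fixed.\<close>

primrec matpow :: "'a set \<Rightarrow> ('a \<Rightarrow> 'a \<Rightarrow> real) \<Rightarrow> nat \<Rightarrow> 'a \<Rightarrow> 'a \<Rightarrow> real" where
  "matpow V a 0 = (\<lambda>i j. if i = j then 1 else 0)"
| "matpow V a (Suc k) = (\<lambda>i j. \<Sum>m\<in>V. matpow V a k i m * a m j)"

text \<open>The eigenbasis expansion of a matrix power is proved entrywise, with completeness as the
  base case; in the trace each eigenvector contributes its squared norm 1.\<close>

lemma sum_eigenvalue_powers:
  fixes a :: "'a \<Rightarrow> 'a \<Rightarrow> real"
  assumes fin: "finite V" and sym: "\<And>i j. i \<in> V \<Longrightarrow> j \<in> V \<Longrightarrow> a i j = a j i"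
    and sys: "orthonormal_eigensystem V (\<lambda>i j. complex_of_real (a i j)) V u l"
  shows "(\<Sum>j\<in>V. l j ^ k) = (\<Sum>i\<in>V. matpow V a k i i)"
proof -
  have eq: "\<And>j i. j \<in> V \<Longrightarrow> i \<in> V \<Longrightarrow> (\<Sum>k\<in>V. complex_of_real (a i k) * u j k) = of_real (l j) * u j i"
    and orth: "\<And>j k. j \<in> V \<Longrightarrow> k \<in> V \<Longrightarrow> (\<Sum>i\<in>V. u j i * cnj (u k i)) = (if j = k then 1 else 0)"
    using sys by (auto simp: orthonormal_eigensystem_def)
  obtain vs where vs: "distinct vs" "set vs = V" using finite_distinct_list[OF fin] by auto
  have pw: "complex_of_real (matpow V a k i m) = (\<Sum>j\<in>V. of_real (l j) ^ k * u j i * cnj (u j m))"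
    if "i \<in> V" "m \<in> V" for i m
    using that
  proof (induction k arbitrary: m)
    case 0
    then show ?case using eigensystem_complete[of vs, unfolded vs, OF vs(1) sys] by simp
  next
    case (Suc k)
    have "complex_of_real (matpow V a (Suc k) i m)
        = (\<Sum>p\<in>V. (\<Sum>j\<in>V. of_real (l j) ^ k * u j i * cnj (u j p)) * of_real (a p m))"
      using Suc by simp
    also have "\<dots> = (\<Sum>j\<in>V. \<Sum>p\<in>V. of_real (l j) ^ k * u j i * cnj (u j p) * of_real (a p m))"
      unfolding sum_distrib_right by (rule sum.swap)
    also have "\<dots> = (\<Sum>j\<in>V. of_real (l j) ^ k * u j i * cnj (\<Sum>p\<in>V. of_real (a m p) * u j p))"
      unfolding cnj_sum sum_distrib_left
      by (intro sum.cong refl) (use Suc sym in \<open>simp add: algebra_simps\<close>)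
    also have "\<dots> = (\<Sum>j\<in>V. of_real (l j) ^ Suc k * u j i * cnj (u j m))"
      by (intro sum.cong refl) (use Suc eq in \<open>simp add: algebra_simps\<close>)
    finally show ?case .
  qed
  have "complex_of_real (\<Sum>i\<in>V. matpow V a k i i) = (\<Sum>i\<in>V. \<Sum>j\<in>V. of_real (l j) ^ k * u j i * cnj (u j i))"
    using pw by simp
  also have "\<dots> = (\<Sum>j\<in>V. \<Sum>i\<in>V. of_real (l j) ^ k * u j i * cnj (u j i))" by (rule sum.swap)
  also have "\<dots> = (\<Sum>j\<in>V. of_real (l j) ^ k * (\<Sum>i\<in>V. u j i * cnj (u j i)))"
    by (simp add: sum_distrib_left mult.assoc)
  also have "\<dots> = (\<Sum>j\<in>V. of_real (l j) ^ k)"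
    using orth by simp
  also have "\<dots> = of_real (\<Sum>j\<in>V. l j ^ k)" by simp
  finally show ?thesis by (simp only: of_real_eq_iff)
qed

text \<open>The eigenvalue equation is read at a coordinate where the eigenvector has maximal
  modulus, as in Gershgorin's theorem.\<close>

lemma eigenvalue_abs_le_row_sum:
  fixes A :: "'a \<Rightarrow> 'a \<Rightarrow> complex"
  assumes fin: "finite V" and sys: "orthonormal_eigensystem V A J u l" and j: "j \<in> J"
    and row: "\<And>i. i \<in> V \<Longrightarrow> (\<Sum>k\<in>V. cmod (A i k)) \<le> C"
  shows "\<bar>l j\<bar> \<le> C"
proof -
  have eq: "\<And>i. i \<in> V \<Longrightarrow> (\<Sum>k\<in>V. A i k * u j k) = of_real (l j) * u j i"
    and orth: "(\<Sum>i\<in>V. u j i * cnj (u j i)) = 1"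
    using sys j by (auto simp: orthonormal_eigensystem_def)
  have V: "V \<noteq> {}" using orth by auto
  obtain i where i: "i \<in> V" "\<And>k. k \<in> V \<Longrightarrow> cmod (u j k) \<le> cmod (u j i)"
  proof -
    let ?M = "Max ((\<lambda>k. cmod (u j k)) ` V)"
    have "?M \<in> (\<lambda>k. cmod (u j k)) ` V" using fin V by (intro Max_in) auto
    then obtain i where "i \<in> V" "?M = cmod (u j i)" by blast
    then show ?thesis using that[of i] Max_ge[of "(\<lambda>k. cmod (u j k)) ` V"] fin by auto
  qed
  have pos: "cmod (u j i) > 0"
  proof (rule ccontr)
    assume "\<not> ?thesis"
    then have "u j k = 0" if "k \<in> V" for k using i(2)[OF that] by auto
    then show False using orth by simp
  qed
  have "\<bar>l j\<bar> * cmod (u j i) = cmod (\<Sum>k\<in>V. A i k * u j k)"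
    using eq[OF i(1)] by (simp add: norm_mult)
  also have "\<dots> \<le> (\<Sum>k\<in>V. cmod (A i k) * cmod (u j i))"
    by (intro sum_norm_le) (auto simp: norm_mult intro!: mult_left_mono i)
  also have "\<dots> = (\<Sum>k\<in>V. cmod (A i k)) * cmod (u j i)"
    by (simp add: sum_distrib_right)
  also have "\<dots> \<le> C * cmod (u j i)"
    by (intro mult_right_mono row i) auto
  finally show ?thesis using pos by simp
qed

section \<open>Eigenvalue counting and test functions\<close>

text \<open>\<open>F\<close> is uniformly close to a step function, whose sum over the eigenvalues
  is a linear combination of values of the counting function. \<open>K\<close> depends on
  \<open>F\<close> and \<open>e\<close> alone, so the clipping height can later be chosen after
  \<open>K\<close>.\<close>

lemma sum_close_if_counting_functions_close:
  fixes F :: "real \<Rightarrow> 'b::real_normed_vector"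
  assumes cont: "continuous_on UNIV F" and supp: "\<And>x. L \<le> \<bar>x\<bar> \<Longrightarrow> F x = 0" and e: "0 < e"
  shows "\<exists>K\<ge>0. \<forall>(V::'a set) l m r. finite V \<longrightarrow>
     (\<forall>t. \<bar>real (card {j\<in>V. l j \<le> t}) - real (card {j\<in>V. m j \<le> t})\<bar> \<le> r) \<longrightarrow>
     norm ((\<Sum>j\<in>V. F (l j)) - (\<Sum>j\<in>V. F (m j))) \<le> e * real (card V) + K * r"
proof -
  \<comment> \<open>The maximum with 1 keeps the interval nondegenerate when \<open>L\<close> is not
    positive.\<close>
  define B where "B = max L 1"
  have B: "B > 0" "\<And>x. B \<le> \<bar>x\<bar> \<Longrightarrow> F x = 0" using supp by (auto simp: B_def)
  have "uniformly_continuous_on {-B..B} F"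
    by (intro compact_uniformly_continuous continuous_on_subset[OF cont]) auto
  then obtain d where d: "d > 0" "\<And>x y. x \<in> {-B..B} \<Longrightarrow> y \<in> {-B..B} \<Longrightarrow> dist y x < d \<Longrightarrow> dist (F y) (F x) < e / 2"
    unfolding uniformly_continuous_on_def using e by (metis half_gt_zero)
  obtain N :: nat where N: "2 * B / d < real N" using reals_Archimedean2 by blast
  have N0: "N > 0" using N B d by (cases N) (auto simp: field_simps)
  define h where "h = 2 * B / real N"
  have h: "h > 0" "h < d" "real N * h = 2 * B" using N N0 B d by (auto simp: h_def field_simps)
  define t where "t k = - B + real k * h" for k :: nat
  \<comment> \<open>The steps are open on the left and closed on the right, so that each contributes
    a difference of two values of a counting function of the form
    \<open>card {j\<in>V. l j \<le> t}\<close>.\<close>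
  define G where "G x = (\<Sum>k<N. if t k < x \<and> x \<le> t (Suc k) then F (t k) else 0)" for x
  have t_mono: "t k \<le> t k'" if "k \<le> k'" for k k'
    using that h by (auto simp: t_def intro!: mult_right_mono)
  have t0: "t 0 = - B" "t N = B" using h by (auto simp: t_def)
  have FG: "norm (F x - G x) \<le> e / 2" for x
  proof (cases "x \<le> - B \<or> B < x")
    case True
    have "G x = 0" unfolding G_def
    proof (rule sum.neutral, intro ballI)
      fix k assume "k \<in> {..<N}"
      then have "- B \<le> t k" "t (Suc k) \<le> B" using t_mono[of 0 k] t_mono[of "Suc k" N] t0 by auto
      then show "(if t k < x \<and> x \<le> t (Suc k) then F (t k) else 0) = 0" using True by auto
    qed
    moreover have "F x = 0" using True B by auto
    ultimately show ?thesis using e by simp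
  next
    case False
    \<comment> \<open>The ceiling minus 1, rather than the floor, selects the left end
      \<open>t k\<close> strictly below \<open>x\<close>.\<close>
    define k where "k = nat (\<lceil>(x + B) / h\<rceil> - 1)"
    have pos: "0 < (x + B) / h" using False h by simp
    then have c: "\<lceil>(x + B) / h\<rceil> = int k + 1" unfolding k_def by linarith
    have iff: "t k' < x \<and> x \<le> t (Suc k') \<longleftrightarrow> k' = k" for k'
    proof -
      have "t k' < x \<and> x \<le> t (Suc k') \<longleftrightarrow> real k' < (x + B) / h \<and> (x + B) / h \<le> real k' + 1"
        using h by (auto simp: t_def field_simps)
      also have "\<dots> \<longleftrightarrow> \<lceil>(x + B) / h\<rceil> = int k' + 1" by linarith
      also have "\<dots> \<longleftrightarrow> k' = k" using c by auto
      finally show ?thesis .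
    qed
    have kx: "t k < x" "x \<le> t (Suc k)" using iff[of k] by auto
    have "k < N"
    proof (rule ccontr)
      assume "\<not> k < N"
      then have "B \<le> t k" using t_mono[of N k] t0 by auto
      then show False using kx False by auto
    qed
    then have "G x = F (t k)" unfolding G_def iff by (simp add: sum.delta)
    moreover have "dist x (t k) < d" using kx h by (auto simp: t_def dist_real_def algebra_simps)
    moreover have "t k \<in> {-B..B}" "x \<in> {-B..B}"
      using t_mono[of 0 k] kx t0 False by auto
    ultimately show ?thesis using d(2)[of "t k" x] by (simp add: dist_norm)
  qed
  \<comment> \<open>The factor 2 arises because each step involves the counting function at both of
    its ends.\<close>
  define K where "K = (\<Sum>k<N. 2 * norm (F (t k)))"
  have K: "K \<ge> 0" unfolding K_def by (intro sum_nonneg) auto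
  have "norm ((\<Sum>j\<in>V. F (l j)) - (\<Sum>j\<in>V. F (m j))) \<le> e * real (card V) + K * r"
    if fin: "finite V" and r: "\<And>t. \<bar>real (card {j\<in>V. l j \<le> t}) - real (card {j\<in>V. m j \<le> t})\<bar> \<le> r"
    for V :: "'a set" and l m r
  proof -
    have sumG: "(\<Sum>j\<in>V. G (q j)) = (\<Sum>k<N. (real (card {j\<in>V. q j \<le> t (Suc k)}) - real (card {j\<in>V. q j \<le> t k})) *\<^sub>R F (t k))" for q
    proof -
      have "(\<Sum>j\<in>V. G (q j)) = (\<Sum>k<N. \<Sum>j\<in>V. if t k < q j \<and> q j \<le> t (Suc k) then F (t k) else 0)"
        unfolding G_def by (rule sum.swap)
      also have "\<dots> = (\<Sum>k<N. real (card {j\<in>V. t k < q j \<and> q j \<le> t (Suc k)}) *\<^sub>R F (t k))"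
        using fin by (simp add: sum.inter_filter[symmetric] sum_constant_scaleR)
      also have "\<dots> = (\<Sum>k<N. (real (card {j\<in>V. q j \<le> t (Suc k)}) - real (card {j\<in>V. q j \<le> t k})) *\<^sub>R F (t k))"
      proof (intro sum.cong refl)
        fix k
        have "{j\<in>V. q j \<le> t (Suc k)} = {j\<in>V. t k < q j \<and> q j \<le> t (Suc k)} \<union> {j\<in>V. q j \<le> t k}"
          using t_mono[of k "Suc k"] by auto
        then have "card {j\<in>V. q j \<le> t (Suc k)} = card {j\<in>V. t k < q j \<and> q j \<le> t (Suc k)} + card {j\<in>V. q j \<le> t k}"
          using fin by (simp only:) (intro card_Un_disjoint, auto)
        then show "real (card {j\<in>V. t k < q j \<and> q j \<le> t (Suc k)}) *\<^sub>R F (t k)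
          = (real (card {j\<in>V. q j \<le> t (Suc k)}) - real (card {j\<in>V. q j \<le> t k})) *\<^sub>R F (t k)" by simp
      qed
      finally show ?thesis .
    qed
    have "norm ((\<Sum>j\<in>V. G (l j)) - (\<Sum>j\<in>V. G (m j))) \<le> (\<Sum>k<N. (2 * norm (F (t k))) * r)"
      unfolding sumG sum_subtractf[symmetric] scaleR_left_diff_distrib[symmetric]
    proof (rule sum_norm_le)
      fix k
      let ?x = "real (card {j\<in>V. l j \<le> t (Suc k)}) - real (card {j\<in>V. l j \<le> t k})
        - (real (card {j\<in>V. m j \<le> t (Suc k)}) - real (card {j\<in>V. m j \<le> t k}))"
      have "\<bar>?x\<bar> \<le> 2 * r" using r[of "t k"] r[of "t (Suc k)"] by linarith
      then have "\<bar>?x\<bar> * norm (F (t k)) \<le> 2 * r * norm (F (t k))" by (intro mult_right_mono) auto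
      then show "norm (?x *\<^sub>R F (t k)) \<le> 2 * norm (F (t k)) * r"
        unfolding norm_scaleR by (simp only: mult_ac)
    qed
    also have "\<dots> = K * r" by (simp add: K_def sum_distrib_right)
    finally have 1: "norm ((\<Sum>j\<in>V. G (l j)) - (\<Sum>j\<in>V. G (m j))) \<le> K * r" .
    have 2: "norm ((\<Sum>j\<in>V. F (q j)) - (\<Sum>j\<in>V. G (q j))) \<le> e / 2 * real (card V)" for q
    proof -
      have "norm (\<Sum>j\<in>V. F (q j) - G (q j)) \<le> (\<Sum>j\<in>V. e / 2)"
        by (intro sum_norm_le FG)
      then show ?thesis by (simp add: sum_subtractf mult.commute)
    qed
    have "norm ((\<Sum>j\<in>V. F (l j)) - (\<Sum>j\<in>V. F (m j))) \<le>
       norm ((\<Sum>j\<in>V. F (l j)) - (\<Sum>j\<in>V. G (l j))) + norm ((\<Sum>j\<in>V. G (l j)) - (\<Sum>j\<in>V. G (m j)))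
       + norm ((\<Sum>j\<in>V. F (m j)) - (\<Sum>j\<in>V. G (m j)))"
      by norm
    then show ?thesis using 1 2[of l] 2[of m] by (simp add: field_simps)
  qed
  then show ?thesis using K by blast
qed

section \<open>Multi-indices and grid nodes\<close>

lemma eventually_multi_top:
  "eventually P (multi_top :: (nat ^ 'd::{finite,wellorder}) filter) \<longleftrightarrow> (\<exists>k. \<forall>n. (\<forall>r. k \<le> vec_nth n r) \<longrightarrow> P n)"
proof -
  have "eventually P (multi_top :: (nat ^ 'd::{finite,wellorder}) filter) \<longleftrightarrow> (\<exists>k\<in>UNIV. eventually P (principal {n :: nat ^ 'd::{finite,wellorder}. \<forall>r. k \<le> vec_nth n r}))"
    unfolding multi_top_def
  proof (rule eventually_INF_base)
    fix a b :: nat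
    show "\<exists>x\<in>UNIV. principal {n :: nat ^ 'd::{finite,wellorder}. \<forall>r. x \<le> vec_nth n r}
        \<le> inf (principal {n. \<forall>r. a \<le> vec_nth n r}) (principal {n. \<forall>r. b \<le> vec_nth n r})"
      by (rule bexI[of _ "max a b"]) auto
  qed simp
  then show ?thesis by (auto simp: eventually_principal)
qed

text \<open>If an eventual property failed, each \<open>k\<close> would yield a counterexample with
  all components at least \<open>k\<close>, and these form a sequence. All later limits can thus be
  taken along sequences.\<close>

lemma filterlim_multi_top_sequentially:
  fixes f :: "nat ^ 'd::{finite,wellorder} \<Rightarrow> 'b"
  assumes "\<And>\<nu>. (\<And>k r. k \<le> vec_nth (\<nu> k) r) \<Longrightarrow> filterlim (\<lambda>k. f (\<nu> k)) G sequentially"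
  shows "filterlim f G multi_top"
proof (rule filterlim_iff[THEN iffD2], intro allI impI)
  fix P assume P: "eventually P G"
  show "\<forall>\<^sub>F x in multi_top. P (f x)"
  proof (rule ccontr)
    assume "\<not> ?thesis"
    then have "\<forall>k. \<exists>n. (\<forall>r. k \<le> vec_nth n r) \<and> \<not> P (f n)" unfolding eventually_multi_top by blast
    then obtain \<nu> where \<nu>: "\<And>k r. k \<le> vec_nth (\<nu> k) r" "\<And>k. \<not> P (f (\<nu> k))" by metis
    from assms[OF \<nu>(1)] P have "\<forall>\<^sub>F k in sequentially. P (f (\<nu> k))" by (auto simp: filterlim_iff)
    then show False using \<nu>(2) by (auto simp: eventually_sequentially)
  qed
qed

text \<open>Totality is decided at the first differing coordinate. A linear order has unique
  strictly sorted enumerations of finite sets, which gives meaning to the description in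
  \<open>immersed_nodes\<close>; it also makes a sorted \<open>ts\<close> distinct.\<close>

interpretation lex: linorder "\<lambda>a b :: int ^ 'd::{finite,wellorder}. lex_less a b \<or> a = b" lex_less
proof
  have irr: "\<not> lex_less a a" for a :: "int ^ 'd::{finite,wellorder}" by (simp add: lex_less_def)
  have trans: "lex_less a c" if "lex_less a b" "lex_less b c" for a b c :: "int ^ 'd::{finite,wellorder}"
  proof -
    obtain r s where r: "vec_nth a r < vec_nth b r" "\<And>q. q < r \<Longrightarrow> vec_nth a q = vec_nth b q"
      and s: "vec_nth b s < vec_nth c s" "\<And>q. q < s \<Longrightarrow> vec_nth b q = vec_nth c q"
      using \<open>lex_less a b\<close> \<open>lex_less b c\<close> unfolding lex_less_def by metis
    show ?thesis unfolding lex_less_def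
    proof (intro exI[of _ "min r s"] conjI allI impI)
      show "vec_nth a (min r s) < vec_nth c (min r s)"
        using r s by (cases r s rule: linorder_cases) (auto simp: min_def)
      show "vec_nth a q = vec_nth c q" if "q < min r s" for q using that r s by simp
    qed
  qed
  have total: "lex_less a b \<or> a = b \<or> lex_less b a" for a b :: "int ^ 'd::{finite,wellorder}"
  proof (cases "a = b")
    case False
    then have ex: "\<exists>r. vec_nth a r \<noteq> vec_nth b r" by (auto simp: Finite_Cartesian_Product.vec_eq_iff)
    define r where "r = (LEAST r. vec_nth a r \<noteq> vec_nth b r)"
    have r: "vec_nth a r \<noteq> vec_nth b r" unfolding r_def by (rule LeastI_ex[OF ex])
    have q: "vec_nth a q = vec_nth b q" if "q < r" for q using not_less_Least[OF that[unfolded r_def]] by blast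
    from r show ?thesis unfolding lex_less_def using q by (metis linorder_neqE)
  qed simp
  fix x y z :: "int ^ 'd::{finite,wellorder}"
  show "lex_less x y \<longleftrightarrow> (lex_less x y \<or> x = y) \<and> \<not> (lex_less y x \<or> y = x)"
    using irr trans by blast
  show "lex_less x x \<or> x = x" by simp
  show "lex_less x y \<or> x = y \<Longrightarrow> lex_less y z \<or> y = z \<Longrightarrow> lex_less x z \<or> x = z"
    using trans by blast
  show "lex_less x y \<or> x = y \<Longrightarrow> lex_less y x \<or> y = x \<Longrightarrow> x = y"
    using irr trans by blast
  show "(lex_less x y \<or> x = y) \<or> lex_less y x \<or> y = x" using total by blast
qed

lemma finite_vec_componentwise:
  fixes B :: "'d::finite \<Rightarrow> 'a set"
  assumes "\<And>r. finite (B r)"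
  shows "finite {u :: 'a ^ 'd. \<forall>r. vec_nth u r \<in> B r}"
proof (rule finite_imageD[where f = vec_nth])
  have "vec_nth ` {u :: 'a ^ 'd. \<forall>r. vec_nth u r \<in> B r} \<subseteq> PiE UNIV B" by auto
  then show "finite (vec_nth ` {u :: 'a ^ 'd. \<forall>r. vec_nth u r \<in> B r})"
    by (rule finite_subset) (auto intro!: finite_PiE assms)
  show "inj_on vec_nth {u :: 'a ^ 'd. \<forall>r. vec_nth u r \<in> B r}" by (auto simp: inj_on_def Finite_Cartesian_Product.vec_eq_iff)
qed

definition immersed_set :: "nat ^ 'd::{finite,wellorder} \<Rightarrow> (real ^ 'd::{finite,wellorder}) set \<Rightarrow> (int ^ 'd::{finite,wellorder}) set" where
  "immersed_set n \<Omega> = {k \<in> grid_nodes n. grid_pt n k \<in> \<Omega>}"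

lemma finite_immersed_set: "finite (immersed_set n \<Omega>)"
proof (rule finite_subset)
  show "immersed_set n \<Omega> \<subseteq> {k. \<forall>r. vec_nth k r \<in> {1..int (vec_nth n r)}}"
    by (auto simp: immersed_set_def grid_nodes_def)
qed (intro finite_vec_componentwise finite_atLeastAtMost_int)

lemma immersed_nodes:
  shows "distinct (immersed_nodes n \<Omega>)" and "set (immersed_nodes n \<Omega>) = immersed_set n \<Omega>"
proof -
  have "\<exists>!xs. sorted_wrt lex_less xs \<and> set xs = immersed_set n \<Omega>"
    using lex.finite_set_strict_sorted[OF finite_immersed_set, of n \<Omega>] lex.strict_sorted_equal by metis
  from theI'[OF this] have "sorted_wrt lex_less (immersed_nodes n \<Omega>) \<and> set (immersed_nodes n \<Omega>) = immersed_set n \<Omega>"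
    unfolding immersed_nodes_def immersed_set_def .
  then show "distinct (immersed_nodes n \<Omega>)" "set (immersed_nodes n \<Omega>) = immersed_set n \<Omega>"
    by (auto simp: lex.strict_sorted_iff)
qed

section \<open>Fourier coefficients of the symbol\<close>

definition phase :: "int ^ 'd::{finite,wellorder} \<Rightarrow> real ^ 'd::{finite,wellorder} \<Rightarrow> real" where
  "phase s \<theta> = (\<Sum>r\<in>UNIV. real_of_int (vec_nth s r) * vec_nth \<theta> r)"

definition toeplitz_dirs :: "(int ^ 'd::{finite,wellorder}) list \<Rightarrow> (int ^ 'd::{finite,wellorder}) set" where
  "toeplitz_dirs ts = {u. vabs u \<in> set ts}"

text \<open>The Fourier coefficients of the symbol, extended by 0 to all offsets.\<close>

definition toeplitz_coeff ::
  "(int ^ 'd::{finite,wellorder}) list \<Rightarrow> (int ^ 'd::{finite,wellorder} \<Rightarrow> real) \<Rightarrow> int ^ 'd::{finite,wellorder} \<Rightarrow> real" where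
  "toeplitz_coeff ts w u = (if u \<in> toeplitz_dirs ts then (if pos_first u then w u else w (- u)) else 0)"

lemma toeplitz_weight_eq_coeff: "toeplitz_weight ts w i j = toeplitz_coeff ts w (i - j)"
  by (auto simp: toeplitz_weight_def toeplitz_coeff_def toeplitz_dirs_def in_set_conv_nth)

lemma finite_toeplitz_dirs:
  fixes ts :: "(int ^ 'd::{finite,wellorder}) list"
  shows "finite (toeplitz_dirs ts)"
proof -
  have "toeplitz_dirs ts = (\<Union>t\<in>set ts. {u. vabs u = t})" by (auto simp: toeplitz_dirs_def)
  moreover have "finite {u. vabs u = t}" for t :: "int ^ 'd::{finite,wellorder}"
  proof (rule finite_subset)
    show "{u. vabs u = t} \<subseteq> {u. \<forall>r. vec_nth u r \<in> {- vec_nth t r..vec_nth t r}}"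
      by (auto simp: vabs_def)
  qed (intro finite_vec_componentwise finite_atLeastAtMost_int)
  ultimately show ?thesis by simp
qed

lemma vabs_uminus: "vabs (- u) = vabs u"
  by (simp add: vabs_def)

lemma uminus_in_toeplitz_dirs [simp]: "- u \<in> toeplitz_dirs ts \<longleftrightarrow> u \<in> toeplitz_dirs ts"
  by (simp add: toeplitz_dirs_def vabs_uminus)

text \<open>\<open>pos_first\<close> is comparison with 0 in the lexicographic order, so totality
  singles out exactly one of \<open>u\<close> and \<open>- u\<close>.\<close>

lemma pos_first_uminus:
  fixes u :: "int ^ 'd::{finite,wellorder}"
  assumes "u \<noteq> 0"
  shows "pos_first (- u) \<longleftrightarrow> \<not> pos_first u"
proof -
  have "pos_first u \<longleftrightarrow> lex_less 0 u" "pos_first (- u) \<longleftrightarrow> lex_less u 0"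
    by (auto simp: pos_first_def lex_less_def)
  then show ?thesis using assms lex.less_linear[of u 0] lex.less_asym[of u 0] by auto
qed

context
  fixes ts :: "(int ^ 'd::{finite,wellorder}) list" and w :: "int ^ 'd::{finite,wellorder} \<Rightarrow> real"
  assumes ts_sorted: "sorted_wrt lex_less ts"
    and ts_nonzero: "0 \<notin> set ts"
begin

lemma zero_notin_toeplitz_dirs: "0 \<notin> toeplitz_dirs ts"
proof -
  have "vabs (0 :: int ^ 'd::{finite,wellorder}) = 0" by (simp add: vabs_def Finite_Cartesian_Product.vec_eq_iff)
  then show ?thesis using ts_nonzero by (simp add: toeplitz_dirs_def)
qed

lemma toeplitz_coeff_uminus: "toeplitz_coeff ts w (- u) = toeplitz_coeff ts w u"
proof (cases "u \<in> toeplitz_dirs ts")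
  case True
  then have "u \<noteq> 0" using zero_notin_toeplitz_dirs by auto
  then show ?thesis using True by (simp add: toeplitz_coeff_def pos_first_uminus)
qed (simp add: toeplitz_coeff_def)

text \<open>Each positive direction is paired with its negative: two conjugate characters with equal
  coefficients add up to one cosine. Distinctness of \<open>ts\<close> prevents a direction from
  being counted for two indices \<open>k\<close>.\<close>

lemma toeplitz_symbol_eq:
  "complex_of_real (toeplitz_symbol ts w \<theta>) = (\<Sum>u\<in>toeplitz_dirs ts. of_real (toeplitz_coeff ts w u) * cis (phase u \<theta>))"
proof -
  let ?c = "\<lambda>u. complex_of_real (toeplitz_coeff ts w u) * cis (phase u \<theta>)"
  let ?P = "{u \<in> toeplitz_dirs ts. pos_first u}" and ?N = "{u \<in> toeplitz_dirs ts. \<not> pos_first u}"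
  have nz: "u \<noteq> 0" if "u \<in> toeplitz_dirs ts" for u using that zero_notin_toeplitz_dirs by auto
  have N: "?N = uminus ` ?P"
  proof (intro equalityI subsetI)
    fix u assume "u \<in> ?N"
    then have "- u \<in> ?P" using nz by (auto simp: pos_first_uminus)
    then show "u \<in> uminus ` ?P" by (metis image_eqI minus_minus)
  qed (use nz in \<open>auto simp: pos_first_uminus\<close>)
  have ph: "phase (- u) \<theta> = - phase u \<theta>" for u by (simp add: phase_def sum_negf)
  have "toeplitz_dirs ts = ?P \<union> ?N" by auto
  then have "(\<Sum>u\<in>toeplitz_dirs ts. ?c u) = (\<Sum>u\<in>?P \<union> ?N. ?c u)" by simp
  also have "\<dots> = (\<Sum>u\<in>?P. ?c u) + (\<Sum>u\<in>?N. ?c u)"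
    using finite_toeplitz_dirs[of ts] by (intro sum.union_disjoint) auto
  also have "(\<Sum>u\<in>?N. ?c u) = (\<Sum>u\<in>?P. ?c (- u))"
    unfolding N by (subst sum.reindex) (auto simp: inj_on_def)
  also have "(\<Sum>u\<in>?P. ?c u) + (\<Sum>u\<in>?P. ?c (- u)) = (\<Sum>u\<in>?P. of_real (2 * w u * cos (phase u \<theta>)))"
    unfolding sum.distrib[symmetric]
  proof (intro sum.cong refl)
    fix u assume u: "u \<in> ?P"
    have "?c u + ?c (- u) = of_real (w u) * (cis (phase u \<theta>) + cis (- phase u \<theta>))"
      using u by (simp add: toeplitz_coeff_uminus ph distrib_left) (simp add: toeplitz_coeff_def)
    also have "cis (phase u \<theta>) + cis (- phase u \<theta>) = of_real (2 * cos (phase u \<theta>))"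
      by (simp add: complex_eq_iff)
    finally show "?c u + ?c (- u) = of_real (2 * w u * cos (phase u \<theta>))" by simp
  qed
  also have "\<dots> = of_real (\<Sum>u\<in>?P. 2 * w u * cos (phase u \<theta>))" by simp
  also have "?P = (\<Union>k\<in>{..<length ts}. dir_pos_reps (ts ! k))"
    by (auto simp: dir_pos_reps_def toeplitz_dirs_def in_set_conv_nth)
  also have "(\<Sum>u\<in>\<dots>. 2 * w u * cos (phase u \<theta>)) = (\<Sum>k<length ts. \<Sum>u\<in>dir_pos_reps (ts ! k). 2 * w u * cos (phase u \<theta>))"
  proof (rule sum.UNION_disjoint)
    show "\<forall>k\<in>{..<length ts}. finite (dir_pos_reps (ts ! k))"
      using finite_toeplitz_dirs[of ts]
      by (auto simp: dir_pos_reps_def toeplitz_dirs_def elim!: rev_finite_subset)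
    have "distinct ts" using ts_sorted by (simp add: lex.strict_sorted_iff)
    then show "\<forall>i\<in>{..<length ts}. \<forall>j\<in>{..<length ts}. i \<noteq> j \<longrightarrow> dir_pos_reps (ts ! i) \<inter> dir_pos_reps (ts ! j) = {}"
      by (auto simp: dir_pos_reps_def nth_eq_iff_index_eq)
  qed simp
  finally show ?thesis by (simp add: toeplitz_symbol_def phase_def)
qed

end

lemma phase_inner: "phase s \<theta> = (\<chi> r. real_of_int (vec_nth s r)) \<bullet> \<theta>"
  by (simp add: phase_def inner_vec_def)

lemma continuous_on_toeplitz_symbol: "continuous_on S (toeplitz_symbol ts w)"
proof -
  have "toeplitz_symbol ts w = (\<lambda>\<theta>. \<Sum>k<length ts. \<Sum>s\<in>dir_pos_reps (ts ! k). 2 * w s * cos (phase s \<theta>))"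
    by (simp add: fun_eq_iff toeplitz_symbol_def phase_def)
  then show ?thesis unfolding phase_inner by (simp add: continuous_intros)
qed

section \<open>Orthogonality of characters on the torus\<close>

lemma integral_lborel_prod_Basis:
  fixes f :: "'a::euclidean_space \<Rightarrow> real \<Rightarrow> complex"
  assumes int: "\<And>b. b \<in> Basis \<Longrightarrow> integrable lborel (f b)"
  shows "(\<integral>x. (\<Prod>b\<in>Basis. f b (x \<bullet> b)) \<partial>lborel) = (\<Prod>b\<in>Basis. \<integral>x. f b x \<partial>lborel)"
proof -
  interpret product_sigma_finite "\<lambda>_::'a. lborel :: real measure" by standard
  have [measurable]: "f b \<in> borel_measurable borel" if "b \<in> Basis" for b
    using borel_measurable_integrable[OF int[OF that]] by simp
  have "(\<integral>x. (\<Prod>b\<in>Basis. f b (x \<bullet> b)) \<partial>lborel)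
      = (\<integral>y. (\<Prod>b\<in>Basis. f b ((\<Sum>b'\<in>Basis. y b' *\<^sub>R b') \<bullet> b)) \<partial>(\<Pi>\<^sub>M b\<in>(Basis::'a set). lborel))"
    by (subst lborel_eq, subst integral_distr) auto
  also have "\<dots> = (\<integral>y. (\<Prod>b\<in>Basis. f b (y b)) \<partial>(\<Pi>\<^sub>M b\<in>(Basis::'a set). lborel))"
    by (intro Bochner_Integration.integral_cong refl prod.cong) simp
  also have "\<dots> = (\<Prod>b\<in>Basis. \<integral>x. f b x \<partial>lborel)"
    by (intro product_integral_prod int) auto
  finally show ?thesis .
qed

lemma cis_sum: "finite A \<Longrightarrow> cis (\<Sum>a\<in>A. f a) = (\<Prod>a\<in>A. cis (f a))"
  by (induction A rule: finite_induct) (auto simp: cis_mult[symmetric])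

lemma integral_cis_interval:
  fixes m :: int
  shows "(\<integral>x. indicator {-pi..pi} x *\<^sub>R cis (real_of_int m * x) \<partial>lborel) = (if m = 0 then 2 * pi else 0)"
proof (cases "m = 0")
  case True
  have "(\<integral>x. indicator {-pi..pi} x *\<^sub>R (1 :: complex) \<partial>lborel) = of_real pi - of_real (- pi)"
    by (rule integral_FTC_Icc) (auto intro!: derivative_eq_intros has_vector_derivative_of_real)
  then show ?thesis using True by (simp add: cis_zero)
next
  case False
  define F where "F x = cis (real_of_int m * x) / (\<i> * of_int m)" for x
  have "(\<integral>x. indicator {-pi..pi} x *\<^sub>R cis (real_of_int m * x) \<partial>lborel) = F pi - F (- pi)"
  proof (rule integral_FTC_Icc)
    fix x assume "-pi \<le> x" "x \<le> pi"
    have "((\<lambda>z. exp (\<i> * of_int m * z) / (\<i> * of_int m)) has_field_derivative exp (\<i> * of_int m * of_real x)) (at (of_real x))"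
      using False by (auto intro!: derivative_eq_intros)
    from has_vector_derivative_real_field[OF this]
    have "((\<lambda>x. exp (\<i> * of_int m * of_real x) / (\<i> * of_int m)) has_vector_derivative exp (\<i> * of_int m * of_real x)) (at x within {-pi..pi})"
      by (rule has_vector_derivative_at_within)
    then show "(F has_vector_derivative cis (real_of_int m * x)) (at x within {-pi..pi})"
      by (simp add: F_def[abs_def] cis_conv_exp mult.assoc)
  qed (auto intro!: continuous_intros)
  also have "F pi = F (- pi)"
  proof -
    have "sin (real_of_int m * pi) = 0" by (simp add: sin_zero_iff_int2)
    then have "cis (real_of_int m * pi) = cis (real_of_int m * - pi)" by (simp add: complex_eq_iff)
    then show ?thesis by (simp add: F_def)
  qed
  finally show ?thesis using False by simp
qed

abbreviation (input) torus :: "(real ^ 'd::{finite,wellorder}) set" where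
  "torus \<equiv> cbox (- (\<chi> r. pi)) (\<chi> r. pi)"

text \<open>Indicator and character factor over the coordinates; a single nonzero frequency makes
  its one-dimensional factor vanish, and with it the product.\<close>

lemma integral_torus_character:
  fixes s :: "int ^ 'd::{finite,wellorder}"
  shows "(LINT \<theta>:torus|lborel. cis (phase s \<theta>)) = (if s = 0 then (2 * pi) ^ CARD('d::{finite,wellorder}) else 0)"
proof -
  define c :: "real ^ 'd::{finite,wellorder}" where "c = (\<chi> r. real_of_int (vec_nth s r))"
  have Basis: "\<exists>r. b = axis r (1::real)" if "b \<in> Basis" for b :: "real ^ 'd::{finite,wellorder}"
    using that by (auto simp: Basis_vec_def)
  have cb: "\<exists>r. c \<bullet> b = real_of_int (vec_nth s r)" if "b \<in> Basis" for b
    using Basis[OF that] by (auto simp: c_def inner_axis)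
  have pib: "(\<chi> r. pi) \<bullet> b = pi" if "b \<in> Basis" for b :: "real ^ 'd::{finite,wellorder}"
    using Basis[OF that] by (auto simp: inner_axis)
  have eq: "indicator torus \<theta> *\<^sub>R cis (phase s \<theta>)
      = (\<Prod>b\<in>Basis. indicator {-pi..pi} (\<theta> \<bullet> b) *\<^sub>R cis ((c \<bullet> b) * (\<theta> \<bullet> b)))" for \<theta> :: "real ^ 'd::{finite,wellorder}"
  proof -
    have "cis (phase s \<theta>) = (\<Prod>b\<in>Basis. cis ((c \<bullet> b) * (\<theta> \<bullet> b)))"
      unfolding phase_inner c_def[symmetric] euclidean_inner[of c \<theta>] by (simp add: cis_sum)
    moreover have "\<theta> \<in> torus \<longleftrightarrow> (\<forall>b\<in>Basis. \<theta> \<bullet> b \<in> {-pi..pi})"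
      by (simp add: mem_box pib)
    moreover have "(\<Prod>b\<in>(Basis :: (real ^ 'd::{finite,wellorder}) set). indicator {-pi..pi} (\<theta> \<bullet> b) *\<^sub>R cis ((c \<bullet> b) * (\<theta> \<bullet> b)))
       = of_real (\<Prod>b\<in>Basis. indicator {-pi..pi} (\<theta> \<bullet> b)) * (\<Prod>b\<in>Basis. cis ((c \<bullet> b) * (\<theta> \<bullet> b)))"
      by (simp add: scaleR_conv_of_real prod.distrib)
    moreover have "(\<Prod>b\<in>(Basis :: (real ^ 'd::{finite,wellorder}) set). indicator {-pi..pi} (\<theta> \<bullet> b)) = (if \<forall>b\<in>Basis. \<theta> \<bullet> b \<in> {-pi..pi} then 1 else (0::real))"
      by (auto simp: indicator_def)
    ultimately show ?thesis by (auto simp: indicator_def)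
  qed
  have ii: "integrable lborel (\<lambda>x. indicator {-pi..pi} x *\<^sub>R cis (a * x))" for a
    by (rule borel_integrable_compact) (auto intro!: continuous_intros)
  have "(LINT \<theta>:torus|lborel. cis (phase s \<theta>)) = (\<Prod>b\<in>Basis. \<integral>x. indicator {-pi..pi} x *\<^sub>R cis ((c \<bullet> b) * x) \<partial>lborel)"
    unfolding set_lebesgue_integral_def eq
    by (rule integral_lborel_prod_Basis[of "\<lambda>b x. indicator {-pi..pi} x *\<^sub>R cis ((c \<bullet> b) * x)"]) (rule ii)
  also have "\<dots> = (\<Prod>b\<in>(Basis :: (real ^ 'd::{finite,wellorder}) set). if c \<bullet> b = 0 then complex_of_real (2 * pi) else 0)"
  proof (intro prod.cong refl)
    fix b :: "real ^ 'd::{finite,wellorder}" assume "b \<in> Basis"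
    then obtain r where r: "c \<bullet> b = real_of_int (vec_nth s r)" using cb by blast
    show "(\<integral>x. indicator {-pi..pi} x *\<^sub>R cis ((c \<bullet> b) * x) \<partial>lborel) = (if c \<bullet> b = 0 then complex_of_real (2 * pi) else 0)"
      unfolding r integral_cis_interval by simp
  qed
  also have "\<dots> = (if s = 0 then (2 * pi) ^ CARD('d::{finite,wellorder}) else 0)"
  proof (cases "s = 0")
    case True
    then have "c = 0" by (simp add: c_def Finite_Cartesian_Product.vec_eq_iff)
    then show ?thesis using True by simp
  next
    case False
    then obtain r where "vec_nth s r \<noteq> 0" by (auto simp: Finite_Cartesian_Product.vec_eq_iff)
    then have "c \<bullet> axis r 1 \<noteq> 0" by (simp add: c_def inner_axis)
    moreover have "axis r (1::real) \<in> Basis" by (simp add: axis_in_Basis_iff)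
    ultimately show ?thesis using False by (auto intro!: prod_zero)
  qed
  finally show ?thesis .
qed

text \<open>The \<open>k\<close>-fold convolution power of \<open>c\<close> at \<open>- s\<close>: a
  sum, over all sequences of \<open>k\<close> steps leading from \<open>s\<close> to 0, of the
  products of their weights. At \<open>s = 0\<close> these are the weighted closed walks.\<close>

primrec walk_coeff :: "'a::ab_group_add set \<Rightarrow> ('a \<Rightarrow> real) \<Rightarrow> nat \<Rightarrow> 'a \<Rightarrow> real" where
  "walk_coeff D c 0 = (\<lambda>s. if s = 0 then 1 else 0)"
| "walk_coeff D c (Suc k) = (\<lambda>s. \<Sum>u\<in>D. c u * walk_coeff D c k (s + u))"

text \<open>The extra character makes the induction possible: another factor of the symbol shifts
  the frequency by every direction, which is the recursion of \<open>walk_coeff\<close>.\<close>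

lemma integral_symbol_power_character:
  fixes ts :: "(int ^ 'd::{finite,wellorder}) list"
  assumes "sorted_wrt lex_less ts" "0 \<notin> set ts"
  shows "(LINT \<theta>:torus|lborel. of_real (toeplitz_symbol ts w \<theta>) ^ k * cis (phase s \<theta>))
    = complex_of_real ((2 * pi) ^ CARD('d::{finite,wellorder}) * walk_coeff (toeplitz_dirs ts) (toeplitz_coeff ts w) k s)"
proof (induction k arbitrary: s)
  case 0
  show ?case using integral_torus_character[of s] by simp
next
  case (Suc k)
  have int: "set_integrable lborel torus (\<lambda>\<theta>. complex_of_real (toeplitz_symbol ts w \<theta>) ^ k * cis (phase s \<theta>))" for s :: "int ^ 'd::{finite,wellorder}"
    unfolding set_integrable_def phase_inner
    by (intro borel_integrable_compact continuous_intros continuous_on_toeplitz_symbol compact_cbox)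
  have ph: "phase (s + u) \<theta> = phase u \<theta> + phase s \<theta>" for u and \<theta> :: "real ^ 'd::{finite,wellorder}"
    by (simp add: phase_def sum.distrib distrib_right)
  have "complex_of_real (toeplitz_symbol ts w \<theta>) ^ Suc k * cis (phase s \<theta>)
     = (\<Sum>u\<in>toeplitz_dirs ts. of_real (toeplitz_coeff ts w u) * (of_real (toeplitz_symbol ts w \<theta>) ^ k * cis (phase (s + u) \<theta>)))" for \<theta>
    unfolding power_Suc toeplitz_symbol_eq[OF assms, of w \<theta>] ph cis_mult[symmetric]
    by (simp add: sum_distrib_left sum_distrib_right algebra_simps)
  then have "(LINT \<theta>:torus|lborel. of_real (toeplitz_symbol ts w \<theta>) ^ Suc k * cis (phase s \<theta>))
    = (\<Sum>u\<in>toeplitz_dirs ts. LINT \<theta>:torus|lborel. of_real (toeplitz_coeff ts w u) * (of_real (toeplitz_symbol ts w \<theta>) ^ k * cis (phase (s + u) \<theta>)))"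
    unfolding set_lebesgue_integral_def
    by (simp only: scaleR_sum_right)
      (intro Bochner_Integration.integral_sum set_integrable_mult_right[OF int, unfolded set_integrable_def])
  also have "\<dots> = (\<Sum>u\<in>toeplitz_dirs ts. of_real (toeplitz_coeff ts w u) * complex_of_real ((2 * pi) ^ CARD('d::{finite,wellorder}) * walk_coeff (toeplitz_dirs ts) (toeplitz_coeff ts w) k (s + u)))"
    using Suc.IH by simp
  also have "\<dots> = complex_of_real ((2 * pi) ^ CARD('d::{finite,wellorder}) * walk_coeff (toeplitz_dirs ts) (toeplitz_coeff ts w) (Suc k) s)"
    by (simp add: sum_distrib_left algebra_simps)
  finally show ?case .
qed

lemma integral_symbol_power:
  fixes ts :: "(int ^ 'd::{finite,wellorder}) list"
  assumes "sorted_wrt lex_less ts" "0 \<notin> set ts"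
  shows "(LINT \<theta>:torus|lborel. toeplitz_symbol ts w \<theta> ^ k)
    = (2 * pi) ^ CARD('d::{finite,wellorder}) * walk_coeff (toeplitz_dirs ts) (toeplitz_coeff ts w) k 0"
proof -
  have "complex_of_real (LINT \<theta>:torus|lborel. toeplitz_symbol ts w \<theta> ^ k) = (LINT \<theta>:torus|lborel. of_real (toeplitz_symbol ts w \<theta> ^ k))"
    by (rule set_integral_complex_of_real[symmetric])
  also have "\<dots> = complex_of_real ((2 * pi) ^ CARD('d::{finite,wellorder}) * walk_coeff (toeplitz_dirs ts) (toeplitz_coeff ts w) k 0)"
    using integral_symbol_power_character[OF assms, of w k 0] by (simp add: phase_def)
  finally show ?thesis by (simp only: of_real_eq_iff)
qed

section \<open>Riemann sums over grid cells\<close>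

text \<open>Lebesgue measure on the product is the completion of the Borel product, so measurability
  of a projection is not automatic; it holds because the cylinder over a null set is null.\<close>

lemma fst_measurable_lebesgue:
  "fst \<in> (lebesgue :: ('a::euclidean_space \<times> 'b::euclidean_space) measure) \<rightarrow>\<^sub>M (lebesgue :: 'a measure)"
proof (rule completion.measurable_completion2)
  show m: "fst \<in> (lebesgue :: ('a \<times> 'b) measure) \<rightarrow>\<^sub>M (lborel :: 'a measure)"
    by (intro measurable_completion) (auto intro!: borel_measurable_continuous_onI continuous_intros)
  show "null_sets lborel \<subseteq> null_sets (distr (lebesgue :: ('a \<times> 'b) measure) (lborel :: 'a measure) fst)"
  proof
    fix N :: "'a set" assume N: "N \<in> null_sets lborel"
    have eq: "fst -` N \<inter> space (lebesgue :: ('a \<times> 'b) measure) = N \<times> UNIV" by auto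
    have s: "N \<times> UNIV \<in> sets (lborel :: ('a \<times> 'b) measure)"
      unfolding lborel_prod[symmetric] using N by (intro pair_measureI) auto
    have "emeasure (distr (lebesgue :: ('a \<times> 'b) measure) lborel fst) N = emeasure (lebesgue :: ('a \<times> 'b) measure) (N \<times> UNIV)"
      unfolding eq[symmetric] using N m by (intro emeasure_distr) auto
    also have "\<dots> = emeasure (lborel \<Otimes>\<^sub>M lborel) (N \<times> (UNIV :: 'b set))"
      using s by (simp add: lborel_prod)
    also have "\<dots> = 0"
      using N by (subst lborel.emeasure_pair_measure_Times) auto
    finally show "N \<in> null_sets (distr (lebesgue :: ('a \<times> 'b) measure) lborel fst)"
      using N by (auto simp: null_sets_def)
  qed
qed

lemma AE_lebesgue_fst:
  assumes "AE x in lebesgue. P x"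
  shows "AE z in (lebesgue :: ('a::euclidean_space \<times> 'b::euclidean_space) measure). P (fst z)"
proof -
  obtain N :: "'a set" where N: "N \<in> null_sets lborel" "{x. \<not> P x} \<subseteq> N"
    using assms[unfolded AE_completion_iff] unfolding eventually_ae_filter by auto
  have s: "N \<times> UNIV \<in> sets (lborel \<Otimes>\<^sub>M (lborel :: 'b measure))"
    using N by (intro pair_measureI) auto
  have "emeasure (lborel \<Otimes>\<^sub>M lborel) (N \<times> (UNIV :: 'b set)) = 0"
    using N by (subst lborel.emeasure_pair_measure_Times) auto
  then have "N \<times> UNIV \<in> null_sets (lborel :: ('a \<times> 'b) measure)"
    using s unfolding null_sets_def lborel_prod by simp
  then have "AE z in (lborel :: ('a \<times> 'b) measure). P (fst z)"
    by (rule AE_I') (use N in auto)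
  then show ?thesis by (rule AE_completion)
qed

text \<open>Fubini is available for Borel functions, whereas \<open>f\<close> is only Lebesgue
  measurable. It is replaced by a Borel function equal to it almost everywhere, and the exceptional
  cylinder is null.\<close>

lemma integral_lebesgue_times:
  fixes f :: "'a::euclidean_space \<Rightarrow> real" and g :: "'b::euclidean_space \<Rightarrow> real"
  assumes f: "integrable lebesgue f" and g: "integrable lborel g"
  shows "integrable lebesgue (\<lambda>z. f (fst z) * g (snd z))"
    and "(\<integral>z. f (fst z) * g (snd z) \<partial>lebesgue) = (\<integral>x. f x \<partial>lebesgue) * (\<integral>y. g y \<partial>lborel)"
proof -
  obtain f' where f'[measurable]: "f' \<in> borel_measurable lborel" and ae: "AE x in lborel. f x = f' x"
    using completion_ex_borel_measurable_real[OF borel_measurable_integrable[OF f]] by auto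
  have ae': "AE x in lebesgue. f x = f' x" using ae by (rule AE_completion)
  have g'[measurable]: "g \<in> borel_measurable lborel" using g by auto
  have "integrable lebesgue f'"
    using f ae' f' by (subst integrable_cong_AE[where g = f]) (auto intro: measurable_completion)
  then have if': "integrable lborel f'" using integrable_completion[OF f'] by simp
  have eqi: "integral\<^sup>L lebesgue f = integral\<^sup>L lborel f'"
    using integral_cong_AE[OF borel_measurable_integrable[OF f] measurable_completion[OF f'] ae']
      integral_completion[OF f'] by simp
  let ?h = "\<lambda>z. f' (fst z) * g (snd z)"
  have h[measurable]: "?h \<in> borel_measurable (lborel \<Otimes>\<^sub>M lborel)" by measurable
  have ih: "integrable (lborel \<Otimes>\<^sub>M lborel) ?h"
  proof (rule lborel_pair.Fubini_integrable)
    have "(\<lambda>x. \<integral>y. norm (f' (fst (x, y)) * g (snd (x, y))) \<partial>lborel) = (\<lambda>x. norm (f' x) * (\<integral>y. norm (g y) \<partial>lborel))"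
      by (simp add: abs_mult)
    then show "integrable lborel (\<lambda>x. \<integral>y. norm (f' (fst (x, y)) * g (snd (x, y))) \<partial>lborel)"
      using if' by simp
    show "AE x in lborel. integrable lborel (\<lambda>y. f' (fst (x, y)) * g (snd (x, y)))"
      using g by simp
  qed simp
  have "(\<integral>z. ?h z \<partial>(lborel \<Otimes>\<^sub>M lborel)) = (\<integral>x. (\<integral>y. f' x * g y \<partial>lborel) \<partial>lborel)"
    using lborel_pair.integral_fst'[OF ih] by simp
  then have ie: "(\<integral>z. ?h z \<partial>lborel) = (\<integral>x. f' x \<partial>lborel) * (\<integral>y. g y \<partial>lborel)"
    by (simp add: lborel_prod)
  have hb: "?h \<in> borel_measurable lborel" using h by (simp only: lborel_prod)
  have hl: "?h \<in> borel_measurable lebesgue" using hb by (rule measurable_completion)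
  have aeh: "AE z in lebesgue. ?h z = f (fst z) * g (snd z)"
    using AE_lebesgue_fst[OF ae'] by eventually_elim auto
  have fl: "(\<lambda>z. f (fst z) * g (snd z)) \<in> borel_measurable lebesgue"
    by (rule borel_measurable_AE[OF hl aeh])
  have ihl: "integrable lebesgue ?h" using ih integrable_completion[OF hb] by (simp add: lborel_prod)
  show "integrable lebesgue (\<lambda>z. f (fst z) * g (snd z))"
    using integrable_cong_AE[OF hl fl aeh] ihl by simp
  show "(\<integral>z. f (fst z) * g (snd z) \<partial>lebesgue) = (\<integral>x. f x \<partial>lebesgue) * (\<integral>y. g y \<partial>lborel)"
    using integral_cong_AE[OF hl fl aeh] integral_completion[OF hb] ie eqi by simp
qed

section \<open>Grid cells, and node sums as integrals of step functions\<close>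

definition cell_index :: "nat ^ 'd::{finite,wellorder} \<Rightarrow> real ^ 'd::{finite,wellorder} \<Rightarrow> int ^ 'd::{finite,wellorder}" where
  "cell_index n x = (\<chi> r. \<lfloor>vec_nth x r * (real (vec_nth n r) + 1)\<rfloor>)"

definition grid_vol :: "nat ^ 'd::{finite,wellorder} \<Rightarrow> real" where
  "grid_vol n = (\<Prod>r\<in>UNIV. real (vec_nth n r) + 1)"

lemma grid_vol_pos: "grid_vol n > 0"
  unfolding grid_vol_def by (intro prod_pos) auto

lemma cell_index_eq_iff:
  "cell_index n x = i \<longleftrightarrow> (\<forall>r. vec_nth (grid_pt n i) r \<le> vec_nth x r \<and> vec_nth x r < vec_nth (grid_pt n (\<chi> r. vec_nth i r + 1)) r)"
proof -
  have "\<lfloor>vec_nth x r * (real (vec_nth n r) + 1)\<rfloor> = vec_nth i r \<longleftrightarrow>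
     vec_nth (grid_pt n i) r \<le> vec_nth x r \<and> vec_nth x r < vec_nth (grid_pt n (\<chi> r. vec_nth i r + 1)) r" for r
  proof -
    have "0 < real (vec_nth n r) + 1" by simp
    then show ?thesis by (simp add: grid_pt_def floor_eq_iff pos_divide_le_eq pos_less_divide_eq)
  qed
  then show ?thesis by (simp add: cell_index_def Finite_Cartesian_Product.vec_eq_iff)
qed

text \<open>A half-open cell differs from the closed box with the same corners by a null set
  only.\<close>

lemma cell_lmeasurable:
  fixes i :: "int ^ 'd::{finite,wellorder}"
  shows "{x. cell_index n x = i} \<in> lmeasurable"
    and "measure lebesgue {x. cell_index n x = i} = 1 / grid_vol n"
proof -
  let ?a = "grid_pt n i" and ?b = "grid_pt n (\<chi> r. vec_nth i r + 1)"
  let ?C = "{x. cell_index n x = i}"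
  have "box ?a ?b \<subseteq> ?C" "?C \<subseteq> cbox ?a ?b"
    unfolding cell_index_eq_iff by (auto simp: mem_box_cart less_imp_le)
  then have "sym_diff (cbox ?a ?b) ?C \<subseteq> cbox ?a ?b - box ?a ?b" by auto
  then have neg: "negligible (sym_diff (cbox ?a ?b) ?C)"
    using negligible_frontier_interval negligible_subset by blast
  show "?C \<in> lmeasurable"
    by (rule lmeasurable_negligible_symdiff[OF lmeasurable_cbox neg])
  have "measure lebesgue ?C = measure lebesgue (cbox ?a ?b)"
    by (rule measure_negligible_symdiff[OF lmeasurable_cbox neg])
  also have "\<dots> = (\<Prod>r\<in>UNIV. vec_nth ?b r - vec_nth ?a r)"
  proof -
    have "vec_nth ?a r \<le> vec_nth ?b r" for r by (simp add: grid_pt_def divide_right_mono)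
    then have "?a \<in> cbox ?a ?b" by (simp add: mem_box_cart)
    then show ?thesis by (subst content_cbox_cart[symmetric]) auto
  qed
  also have "\<dots> = (\<Prod>r\<in>UNIV. 1 / (real (vec_nth n r) + 1))"
    by (intro prod.cong refl) (simp add: grid_pt_def diff_divide_distrib[symmetric])
  finally show "measure lebesgue ?C = 1 / grid_vol n"
    by (simp add: grid_vol_def prod_dividef)
qed

text \<open>Each node owns the cell of which it is the lower corner, and all cells have volume
  \<open>1 / grid_vol n\<close>.\<close>

lemma has_bochner_integral_cell_step_function:
  fixes V :: "(int ^ 'd::{finite,wellorder}) set" and \<Phi> :: "int ^ 'd::{finite,wellorder} \<Rightarrow> real"
  assumes fin: "finite V"
  shows "has_bochner_integral lebesgue (\<lambda>x. if cell_index n x \<in> V then \<Phi> (cell_index n x) else 0)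
     ((\<Sum>i\<in>V. \<Phi> i) / grid_vol n)"
proof -
  have "has_bochner_integral lebesgue (\<lambda>x. \<Sum>i\<in>V. indicator {x. cell_index n x = i} x *\<^sub>R \<Phi> i)
     (\<Sum>i\<in>V. measure lebesgue {x. cell_index n x = i} *\<^sub>R \<Phi> i)"
    using cell_lmeasurable(1)[of n] unfolding fmeasurable_def
    by (intro has_bochner_integral_sum has_bochner_integral_indicator) blast+
  moreover have "(\<Sum>i\<in>V. measure lebesgue {x. cell_index n x = i} *\<^sub>R \<Phi> i) = (\<Sum>i\<in>V. \<Phi> i) / grid_vol n"
    by (simp add: cell_lmeasurable(2) sum_divide_distrib)
  moreover have "(\<Sum>i\<in>V. indicator {x. cell_index n x = i} x *\<^sub>R \<Phi> i) = (if cell_index n x \<in> V then \<Phi> (cell_index n x) else 0)" for x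
  proof -
    have "(\<Sum>i\<in>V. indicator {x. cell_index n x = i} x *\<^sub>R \<Phi> i) = (\<Sum>i\<in>V. if cell_index n x = i then \<Phi> i else 0)"
      by (intro sum.cong) (auto simp: indicator_def)
    then show ?thesis using fin by (simp add: sum.delta')
  qed
  ultimately show ?thesis by simp
qed

text \<open>The admissible index range corresponds exactly to the open unit cube, so being a node
  becomes a geometric condition that can be tested along convergent grid points.\<close>

lemma immersed_set_iff: "i \<in> immersed_set n \<Omega> \<longleftrightarrow> grid_pt n i \<in> \<Omega> \<inter> box 0 1"
proof -
  have "1 \<le> vec_nth i r \<and> vec_nth i r \<le> int (vec_nth n r) \<longleftrightarrow> 0 < vec_nth (grid_pt n i) r \<and> vec_nth (grid_pt n i) r < 1" for r
  proof -
    have "0 < real (vec_nth n r) + 1" by simp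
    then have "0 < vec_nth (grid_pt n i) r \<and> vec_nth (grid_pt n i) r < 1 \<longleftrightarrow> 0 < vec_nth i r \<and> real_of_int (vec_nth i r) < real (vec_nth n r) + 1"
      by (simp add: grid_pt_def zero_less_divide_iff divide_less_eq)
    also have "\<dots> \<longleftrightarrow> 1 \<le> vec_nth i r \<and> vec_nth i r \<le> int (vec_nth n r)" by linarith
    finally show ?thesis by blast
  qed
  then show ?thesis by (auto simp: immersed_set_def grid_nodes_def mem_box_cart)
qed

text \<open>The last node in each coordinate still leaves one mesh width up to 1. The indicator of
  the cube can therefore serve as dominating function.\<close>

lemma cell_in_unit_cube:
  assumes "cell_index n x \<in> immersed_set n \<Omega>"
  shows "x \<in> cbox 0 1"
proof -
  have *: "0 < vec_nth (grid_pt n (cell_index n x)) r" "vec_nth (cell_index n x) r \<le> int (vec_nth n r)" for r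
    using assms by (simp_all add: immersed_set_iff mem_box_cart) (use assms in \<open>simp add: immersed_set_def grid_nodes_def\<close>)
  have "0 \<le> vec_nth x r \<and> vec_nth x r \<le> 1" for r
  proof -
    have b: "vec_nth (grid_pt n (cell_index n x)) r \<le> vec_nth x r"
      "vec_nth x r < vec_nth (grid_pt n (\<chi> r. vec_nth (cell_index n x) r + 1)) r"
      using cell_index_eq_iff[of n x "cell_index n x"] by auto
    have "real_of_int (vec_nth (cell_index n x) r) + 1 \<le> real (vec_nth n r) + 1" using *(2)[of r] by linarith
    then have "vec_nth (grid_pt n (\<chi> r. vec_nth (cell_index n x) r + 1)) r \<le> 1" by (simp add: grid_pt_def divide_le_eq)
    then show ?thesis using b *(1)[of r] by linarith
  qed
  then show ?thesis by (simp add: mem_box_cart)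
qed

lemma grid_sum_tendsto:
  fixes \<nu> :: "nat \<Rightarrow> nat ^ 'd::{finite,wellorder}"
  assumes bound: "\<And>k i. i \<in> immersed_set (\<nu> k) \<Omega> \<Longrightarrow> \<bar>\<Phi> k i\<bar> \<le> C"
    and g: "g \<in> borel_measurable lebesgue"
    and lim: "AE x in lebesgue. (\<lambda>k. if cell_index (\<nu> k) x \<in> immersed_set (\<nu> k) \<Omega> then \<Phi> k (cell_index (\<nu> k) x) else 0) \<longlonglongrightarrow> g x"
  shows "(\<lambda>k. (\<Sum>i\<in>immersed_set (\<nu> k) \<Omega>. \<Phi> k i) / grid_vol (\<nu> k)) \<longlonglongrightarrow> (LINT x|lebesgue. g x)"
proof -
  let ?s = "\<lambda>k x. if cell_index (\<nu> k) x \<in> immersed_set (\<nu> k) \<Omega> then \<Phi> k (cell_index (\<nu> k) x) else 0"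
  note hbi = has_bochner_integral_cell_step_function[OF finite_immersed_set, of "\<nu> k" "\<nu> k" \<Omega> "\<Phi> k" for k]
  have "(\<lambda>k. integral\<^sup>L lebesgue (?s k)) \<longlonglongrightarrow> integral\<^sup>L lebesgue g"
  proof (rule integral_dominated_convergence[OF g _ _ lim])
    show "?s k \<in> borel_measurable lebesgue" for k
      by (rule borel_measurable_has_bochner_integral[OF hbi])
    show "integrable lebesgue (\<lambda>x. indicator (cbox 0 (1::real^'d::{finite,wellorder})) x *\<^sub>R \<bar>C\<bar>)"
      by (intro integrable_scaleR_left integrable_real_indicator) (auto simp: emeasure_lborel_cbox_eq)
    show "AE x in lebesgue. norm (?s k x) \<le> indicator (cbox 0 1) x *\<^sub>R \<bar>C\<bar>" for k
    proof (rule AE_I2)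
      fix x
      show "norm (?s k x) \<le> indicator (cbox 0 1) x *\<^sub>R \<bar>C\<bar>"
        using cell_in_unit_cube[of "\<nu> k" x \<Omega>] bound[of "cell_index (\<nu> k) x" k] by (auto simp: indicator_def)
    qed
  qed
  then show ?thesis using has_bochner_integral_integral_eq[OF hbi] by simp
qed

context
  fixes \<nu> :: "nat \<Rightarrow> nat ^ 'd::{finite,wellorder}"
  assumes \<nu>: "\<And>k r. k \<le> vec_nth (\<nu> k) r"
begin

lemma grid_pt_cell_tendsto: "(\<lambda>k. grid_pt (\<nu> k) (cell_index (\<nu> k) x + s)) \<longlonglongrightarrow> x"
proof (rule vec_tendstoI)
  fix r
  let ?N = "\<lambda>k. real (vec_nth (\<nu> k) r) + 1"
  \<comment> \<open>The 1 accounts for rounding down, the absolute value for the offset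
    \<open>s\<close>, both in units of the mesh width, which is at most
    \<open>1 / Suc k\<close>.\<close>
  have "(\<lambda>k. (1 + \<bar>real_of_int (vec_nth s r)\<bar>) * inverse (real (Suc k))) \<longlonglongrightarrow> (1 + \<bar>real_of_int (vec_nth s r)\<bar>) * 0"
    by (intro tendsto_intros LIMSEQ_inverse_real_of_nat)
  then have z: "(\<lambda>k. (1 + \<bar>real_of_int (vec_nth s r)\<bar>) * inverse (real (Suc k))) \<longlonglongrightarrow> 0" by simp
  show "(\<lambda>k. vec_nth (grid_pt (\<nu> k) (cell_index (\<nu> k) x + s)) r) \<longlonglongrightarrow> vec_nth x r"
  proof (rule LIM_zero_cancel, rule Lim_null_comparison[OF _ z], rule always_eventually, rule allI)
    fix k
    have N: "?N k > 0" by simp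
    let ?f = "\<lfloor>vec_nth x r * ?N k\<rfloor>"
    have "vec_nth (grid_pt (\<nu> k) (cell_index (\<nu> k) x + s)) r - vec_nth x r = (real_of_int ?f + real_of_int (vec_nth s r) - vec_nth x r * ?N k) / ?N k"
      using N by (simp add: grid_pt_def cell_index_def field_simps)
    moreover have "\<bar>real_of_int ?f + real_of_int (vec_nth s r) - vec_nth x r * ?N k\<bar> \<le> 1 + \<bar>real_of_int (vec_nth s r)\<bar>"
      by linarith
    ultimately have "norm (vec_nth (grid_pt (\<nu> k) (cell_index (\<nu> k) x + s)) r - vec_nth x r) \<le> (1 + \<bar>real_of_int (vec_nth s r)\<bar>) / ?N k"
      using N by (simp add: divide_right_mono)
    also have "\<dots> \<le> (1 + \<bar>real_of_int (vec_nth s r)\<bar>) / real (Suc k)"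
      using \<nu>[of k r] by (intro divide_left_mono) auto
    finally show "norm (vec_nth (grid_pt (\<nu> k) (cell_index (\<nu> k) x + s)) r - vec_nth x r) \<le> (1 + \<bar>real_of_int (vec_nth s r)\<bar>) * inverse (real (Suc k))"
      by (simp add: divide_inverse)
  qed
qed

text \<open>The fixed offset \<open>s\<close> is what allows entire walks of bounded length to stay
  inside the domain.\<close>

lemma eventually_cell_immersed:
  assumes "\<Omega> \<subseteq> cbox 0 1" "x \<in> interior \<Omega>"
  shows "\<forall>\<^sub>F k in sequentially. cell_index (\<nu> k) x + s \<in> immersed_set (\<nu> k) \<Omega>"
proof -
  have "interior \<Omega> \<subseteq> box 0 1" using interior_mono[OF assms(1)] by (simp add: interior_cbox)
  moreover have "\<forall>\<^sub>F k in sequentially. grid_pt (\<nu> k) (cell_index (\<nu> k) x + s) \<in> interior \<Omega>"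
    by (rule topological_tendstoD[OF grid_pt_cell_tendsto open_interior assms(2)])
  ultimately show ?thesis
    by (auto simp: immersed_set_iff elim!: eventually_mono dest: interior_subset[THEN subsetD])
qed

lemma eventually_cell_not_immersed:
  assumes "x \<notin> closure \<Omega>"
  shows "\<forall>\<^sub>F k in sequentially. cell_index (\<nu> k) x \<notin> immersed_set (\<nu> k) \<Omega>"
proof -
  have "\<forall>\<^sub>F k in sequentially. grid_pt (\<nu> k) (cell_index (\<nu> k) x + 0) \<in> - closure \<Omega>"
    by (rule topological_tendstoD[OF grid_pt_cell_tendsto]) (use assms in auto)
  then show ?thesis
    by (auto simp: immersed_set_iff elim!: eventually_mono dest: closure_subset[THEN subsetD])
qed

text \<open>Off the null frontier every point is interior or exterior, and the node of its cell is
  eventually immersed or eventually not. Besides a uniform bound, the summands therefore need a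
  limit at interior points only.\<close>

lemma grid_sum_tendsto_set_integral:
  assumes reg: "regular_domain \<Omega>"
    and bound: "\<And>k i. i \<in> immersed_set (\<nu> k) \<Omega> \<Longrightarrow> \<bar>\<Phi> k i\<bar> \<le> C"
    and g: "(\<lambda>x. indicator \<Omega> x *\<^sub>R g x) \<in> borel_measurable lebesgue"
    and lim: "AE x in lebesgue. x \<in> interior \<Omega> \<longrightarrow> (\<lambda>k. \<Phi> k (cell_index (\<nu> k) x)) \<longlonglongrightarrow> g x"
  shows "(\<lambda>k. (\<Sum>i\<in>immersed_set (\<nu> k) \<Omega>. \<Phi> k i) / grid_vol (\<nu> k)) \<longlonglongrightarrow> (LINT x:\<Omega>|lebesgue. g x)"
  unfolding set_lebesgue_integral_def
proof (rule grid_sum_tendsto[OF bound g])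
  have "AE x in lebesgue. x \<notin> frontier \<Omega>"
    using reg by (auto simp: regular_domain_def intro: AE_not_in)
  with lim show "AE x in lebesgue. (\<lambda>k. if cell_index (\<nu> k) x \<in> immersed_set (\<nu> k) \<Omega> then \<Phi> k (cell_index (\<nu> k) x) else 0)
     \<longlonglongrightarrow> indicator \<Omega> x *\<^sub>R g x"
  proof eventually_elim
    case (elim x)
    then consider "x \<in> interior \<Omega>" | "x \<notin> closure \<Omega>" by (auto simp: frontier_def)
    then show ?case
    proof cases
      case 1
      have "\<forall>\<^sub>F k in sequentially. cell_index (\<nu> k) x + 0 \<in> immersed_set (\<nu> k) \<Omega>"
        using reg by (intro eventually_cell_immersed 1) (auto simp: regular_domain_def)
      then have "\<forall>\<^sub>F k in sequentially. \<Phi> k (cell_index (\<nu> k) x)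
          = (if cell_index (\<nu> k) x \<in> immersed_set (\<nu> k) \<Omega> then \<Phi> k (cell_index (\<nu> k) x) else 0)"
        by (rule eventually_mono) auto
      moreover have "x \<in> \<Omega>" using 1 interior_subset by blast
      ultimately show ?thesis using elim(1) 1 by (auto intro: Lim_transform_eventually)
    next
      case 2
      have "\<forall>\<^sub>F k in sequentially. 0 = (if cell_index (\<nu> k) x \<in> immersed_set (\<nu> k) \<Omega> then \<Phi> k (cell_index (\<nu> k) x) else 0)"
        using eventually_cell_not_immersed[OF 2] by (rule eventually_mono) auto
      moreover have "x \<notin> \<Omega>" using 2 closure_subset by blast
      ultimately show ?thesis by (auto intro: Lim_transform_eventually[OF tendsto_const])
    qed
  qed
qed

end

section \<open>Traces of powers\<close>

definition grid_matrix ::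
  "(real ^ 'd::{finite,wellorder} \<Rightarrow> real) \<Rightarrow> (int ^ 'd::{finite,wellorder}) list \<Rightarrow> (int ^ 'd::{finite,wellorder} \<Rightarrow> real)
    \<Rightarrow> nat ^ 'd::{finite,wellorder} \<Rightarrow> int ^ 'd::{finite,wellorder} \<Rightarrow> int ^ 'd::{finite,wellorder} \<Rightarrow> real" where
  "grid_matrix q ts w n i j = q ((1/2) *\<^sub>R (grid_pt n i + grid_pt n j)) * toeplitz_coeff ts w (i - j)"

lemma immersed_toeplitz_matrix_eq:
  "immersed_toeplitz_matrix ts w \<Omega> q n =
    mat (length (immersed_nodes n \<Omega>)) (length (immersed_nodes n \<Omega>))
      (\<lambda>(a, b). grid_matrix q ts w n (immersed_nodes n \<Omega> ! a) (immersed_nodes n \<Omega> ! b))"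
  by (simp add: immersed_toeplitz_matrix_def Let_def grid_matrix_def toeplitz_weight_eq_coeff)

lemma dim_row_immersed_toeplitz_matrix:
  "dim_row (immersed_toeplitz_matrix ts w \<Omega> q n) = card (immersed_set n \<Omega>)"
  using distinct_card[OF immersed_nodes(1)[of n \<Omega>]] immersed_nodes(2)[of n \<Omega>]
  by (simp add: immersed_toeplitz_matrix_eq)

text \<open>The cells of the nodes are disjoint and lie in the unit cube, so their total volume is
  at most 1.\<close>

lemma card_immersed_set_le:
  fixes n :: "nat ^ 'd::{finite,wellorder}"
  shows "real (card (immersed_set n \<Omega>)) \<le> grid_vol n"
proof -
  have "(\<Sum>i\<in>immersed_set n \<Omega>. 1) / grid_vol n = (LINT x|lebesgue. (if cell_index n x \<in> immersed_set n \<Omega> then 1 else 0))"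
    using has_bochner_integral_cell_step_function[OF finite_immersed_set, of n n \<Omega> "\<lambda>_. 1"]
    by (simp add: has_bochner_integral_iff)
  also have "\<dots> \<le> (LINT x|lebesgue. indicator (cbox 0 (1 :: real ^ 'd::{finite,wellorder})) x)"
  proof (rule Bochner_Integration.integral_mono)
    show "integrable lebesgue (\<lambda>x. if cell_index n x \<in> immersed_set n \<Omega> then 1 else (0::real))"
      using has_bochner_integral_cell_step_function[OF finite_immersed_set, of n n \<Omega> "\<lambda>_. 1"]
      by (simp add: has_bochner_integral_iff)
    show "integrable lebesgue (indicat_real (cbox 0 (1 :: real ^ 'd::{finite,wellorder})))"
      by (intro integrable_real_indicator) (auto simp: emeasure_lborel_cbox_eq)
  qed (use cell_in_unit_cube in \<open>fastforce simp: indicator_def\<close>)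
  also have "\<dots> = 1"
  proof -
    have "(0 :: real ^ 'd::{finite,wellorder}) \<in> cbox 0 1" by (simp add: mem_box_cart)
    then have "measure lborel (cbox 0 (1 :: real ^ 'd::{finite,wellorder})) = 1"
      by (subst content_cbox_cart) auto
    then show ?thesis by simp
  qed
  finally show ?thesis using grid_vol_pos[of n] by (simp add: divide_le_eq)
qed

text \<open>Nonzero entries of a column sit at offsets from a fixed finite set. Summing over offsets
  gives an index set independent of the size, over which limits are taken termwise.\<close>

lemma sum_toeplitz_reindex:
  fixes V :: "(int ^ 'd::{finite,wellorder}) set"
  assumes fin: "finite V"
  shows "(\<Sum>m\<in>V. f m * toeplitz_coeff ts w (m - j))
    = (\<Sum>u\<in>toeplitz_dirs ts. if j + u \<in> V then f (j + u) * toeplitz_coeff ts w u else 0)"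
proof -
  let ?T = "(\<lambda>u. j + u) ` toeplitz_dirs ts"
  have "(\<Sum>u\<in>toeplitz_dirs ts. if j + u \<in> V then f (j + u) * toeplitz_coeff ts w u else 0)
    = (\<Sum>m\<in>?T. if m \<in> V then f m * toeplitz_coeff ts w (m - j) else 0)"
    by (subst sum.reindex) (auto simp: inj_on_def intro!: sum.cong)
  also have "\<dots> = (\<Sum>m\<in>?T \<inter> V. f m * toeplitz_coeff ts w (m - j))"
    using finite_toeplitz_dirs[of ts] by (simp add: sum.inter_restrict)
  also have "\<dots> = (\<Sum>m\<in>V. f m * toeplitz_coeff ts w (m - j))"
  proof (rule sum.mono_neutral_left[OF fin])
    show "\<forall>m\<in>V - ?T \<inter> V. f m * toeplitz_coeff ts w (m - j) = 0"
    proof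
      fix m assume m: "m \<in> V - ?T \<inter> V"
      have "m - j \<notin> toeplitz_dirs ts"
      proof
        assume "m - j \<in> toeplitz_dirs ts"
        then have "j + (m - j) \<in> ?T" by (rule imageI)
        then show False using m by simp
      qed
      then show "f m * toeplitz_coeff ts w (m - j) = 0" by (simp add: toeplitz_coeff_def)
    qed
  qed auto
  finally show ?thesis by simp
qed

lemma sum_abs_grid_matrix_le:
  fixes V :: "(int ^ 'd::{finite,wellorder}) set"
  assumes fin: "finite V" and q: "\<And>x. \<bar>q x\<bar> \<le> M"
  shows "(\<Sum>m\<in>V. \<bar>grid_matrix q ts w n m j\<bar>) \<le> M * (\<Sum>u\<in>toeplitz_dirs ts. \<bar>toeplitz_coeff ts w u\<bar>)"
proof -
  have M: "0 \<le> M" using q[of undefined] by linarith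
  have "(\<Sum>m\<in>V. \<bar>grid_matrix q ts w n m j\<bar>) \<le> (\<Sum>m\<in>V. M * \<bar>toeplitz_coeff ts w (m - j)\<bar>)"
    using q by (intro sum_mono) (simp add: grid_matrix_def abs_mult mult_right_mono)
  \<comment> \<open>Writing the absolute value as sign times coefficient brings the sum into the
    form required for reindexing.\<close>
  also have "\<dots> = (\<Sum>m\<in>V. M * sgn (toeplitz_coeff ts w (m - j)) * toeplitz_coeff ts w (m - j))"
    by (intro sum.cong refl) (simp add: abs_sgn mult_ac)
  also have "\<dots> = (\<Sum>u\<in>toeplitz_dirs ts. if j + u \<in> V then M * sgn (toeplitz_coeff ts w ((j + u) - j)) * toeplitz_coeff ts w u else 0)"
    by (rule sum_toeplitz_reindex[OF fin])
  also have "\<dots> \<le> (\<Sum>u\<in>toeplitz_dirs ts. M * \<bar>toeplitz_coeff ts w u\<bar>)"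
    using M by (intro sum_mono) (simp add: abs_sgn mult_ac, simp add: abs_sgn[symmetric])
  finally show ?thesis by (simp add: sum_distrib_left)
qed

lemma abs_matpow_le:
  fixes a :: "'a \<Rightarrow> 'a \<Rightarrow> real"
  assumes "finite V" and col: "\<And>j. (\<Sum>m\<in>V. \<bar>a m j\<bar>) \<le> B"
  shows "\<bar>matpow V a e i j\<bar> \<le> B ^ e"
proof (induction e arbitrary: j)
  case (Suc e)
  have B: "0 \<le> B" by (rule order_trans[OF _ col[of undefined]]) (auto intro: sum_nonneg)
  have "\<bar>matpow V a (Suc e) i j\<bar> \<le> (\<Sum>m\<in>V. \<bar>matpow V a e i m * a m j\<bar>)" by simp
  also have "\<dots> \<le> (\<Sum>m\<in>V. B ^ e * \<bar>a m j\<bar>)"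
    using Suc.IH by (intro sum_mono) (simp add: abs_mult mult_right_mono)
  also have "\<dots> \<le> B ^ e * B"
    unfolding sum_distrib_left[symmetric] using col B by (intro mult_left_mono) auto
  finally show ?case by (simp add: mult.commute)
qed simp

text \<open>The growth condition on \<open>\<nu>\<close> is the one delivered by the reduction from
  \<open>multi_top\<close>. \<open>p\<close> is total, but constrained only within
  \<open>\<Omega>\<close>.\<close>

locale immersed_toeplitz_sequence =
  fixes \<Omega> :: "(real ^ 'd::{finite,wellorder}) set" and p :: "real ^ 'd::{finite,wellorder} \<Rightarrow> real"
    and ts :: "(int ^ 'd::{finite,wellorder}) list" and w :: "int ^ 'd::{finite,wellorder} \<Rightarrow> real"
    and \<nu> :: "nat \<Rightarrow> nat ^ 'd::{finite,wellorder}"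
  assumes reg: "regular_domain \<Omega>"
    and p_cont: "AE x in lebesgue. x \<in> \<Omega> \<longrightarrow> continuous (at x within \<Omega>) p"
    and ts_sorted: "sorted_wrt lex_less ts"
    and ts_nonzero: "0 \<notin> set ts"
    and \<nu>: "\<And>k r. k \<le> vec_nth (\<nu> k) r"
begin

abbreviation "V k \<equiv> immersed_set (\<nu> k) \<Omega>"
abbreviation "dirs \<equiv> toeplitz_dirs ts"
abbreviation "coef \<equiv> toeplitz_coeff ts w"
abbreviation "symb \<equiv> toeplitz_symbol ts w"
abbreviation "gmat q k \<equiv> grid_matrix q ts w (\<nu> k)"

lemma domain: "\<Omega> \<subseteq> cbox 0 1" "\<Omega> \<in> sets lebesgue" "\<Omega> \<in> lmeasurable"
proof -
  show sub: "\<Omega> \<subseteq> cbox 0 1" and sets: "\<Omega> \<in> sets lebesgue" using reg by (auto simp: regular_domain_def)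
  show "\<Omega> \<in> lmeasurable"
    using bounded_subset[OF bounded_cbox sub] sets by (rule bounded_set_imp_lmeasurable)
qed

text \<open>At an interior point continuity within \<open>\<Omega>\<close> is ordinary continuity,
  so \<open>p\<close> may be followed along midpoints not known to lie in
  \<open>\<Omega>\<close>.\<close>

lemma isCont_AE: "AE x in lebesgue. x \<in> interior \<Omega> \<longrightarrow> isCont p x"
  using p_cont
proof eventually_elim
  case (elim x)
  show ?case
  proof
    assume x: "x \<in> interior \<Omega>"
    then have "x \<in> \<Omega>" using interior_subset by blast
    then show "isCont p x" using elim at_within_interior[OF x] by simp
  qed
qed

text \<open>On the set of its continuity points \<open>p\<close> is continuous, and this set is
  Lebesgue measurable because it misses only a null part of \<open>\<Omega>\<close>.\<close>

lemma p_measurable: "(\<lambda>x. indicator \<Omega> x * p x) \<in> borel_measurable lebesgue"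
proof -
  define S where "S = {x\<in>\<Omega>. continuous (at x within \<Omega>) p}"
  have ae: "AE x in lebesgue. x \<in> \<Omega> \<longleftrightarrow> x \<in> S"
    using p_cont by eventually_elim (auto simp: S_def)
  have S: "S \<in> sets lebesgue" by (rule completion.in_sets_AE[OF ae domain(2)]) auto
  have "continuous_on S p" unfolding continuous_on_eq_continuous_within
    by (auto simp: S_def intro: continuous_within_subset)
  then have "p \<in> borel_measurable (lebesgue_on S)"
    by (rule continuous_imp_measurable_on_sets_lebesgue[OF _ S])
  then have "(\<lambda>x. if x \<in> S then p x else 0) \<in> borel_measurable lebesgue"
    using borel_measurable_if[OF S] by blast
  then show ?thesis
    by (rule borel_measurable_AE) (use ae in \<open>eventually_elim, auto simp: indicator_def\<close>)
qed

lemma comp_p_measurable: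
  assumes "continuous_on UNIV (h :: real \<Rightarrow> real)"
  shows "(\<lambda>x. indicator \<Omega> x * h (p x)) \<in> borel_measurable lebesgue"
proof -
  have [measurable]: "h \<in> borel_measurable borel" using assms by (rule borel_measurable_continuous_onI)
  have [measurable]: "\<Omega> \<in> sets lebesgue" by (rule domain)
  note p_measurable[measurable]
  have "(\<lambda>x. indicator \<Omega> x * h (indicator \<Omega> x * p x)) \<in> borel_measurable lebesgue" by measurable
  also have "(\<lambda>x. indicator \<Omega> x * h (indicator \<Omega> x * p x)) = (\<lambda>x. indicator \<Omega> x * h (p x))"
    by (auto simp: indicator_def)
  finally show ?thesis .
qed

lemma grid_sum_comp_tendsto:
  assumes bound: "\<And>k i. i \<in> V k \<Longrightarrow> \<bar>\<Phi> k i\<bar> \<le> C" and h: "continuous_on UNIV h"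
    and lim: "\<And>x. x \<in> interior \<Omega> \<Longrightarrow> isCont p x \<Longrightarrow> (\<lambda>k. \<Phi> k (cell_index (\<nu> k) x)) \<longlonglongrightarrow> h (p x)"
  shows "(\<lambda>k. (\<Sum>i\<in>V k. \<Phi> k i) / grid_vol (\<nu> k)) \<longlonglongrightarrow> (LINT x:\<Omega>|lebesgue. h (p x))"
proof (rule grid_sum_tendsto_set_integral[OF \<nu> reg bound])
  show "(\<lambda>x. indicator \<Omega> x *\<^sub>R h (p x)) \<in> borel_measurable lebesgue"
    using comp_p_measurable[OF h] by simp
  show "AE x in lebesgue. x \<in> interior \<Omega> \<longrightarrow> (\<lambda>k. \<Phi> k (cell_index (\<nu> k) x)) \<longlonglongrightarrow> h (p x)"
    using isCont_AE by eventually_elim (use lim in auto)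
qed

lemma midpoint_tendsto:
  "(\<lambda>k. (1/2) *\<^sub>R (grid_pt (\<nu> k) (cell_index (\<nu> k) x + s) + grid_pt (\<nu> k) (cell_index (\<nu> k) x + s'))) \<longlonglongrightarrow> x"
proof -
  have "(\<lambda>k. (1/2) *\<^sub>R (grid_pt (\<nu> k) (cell_index (\<nu> k) x + s) + grid_pt (\<nu> k) (cell_index (\<nu> k) x + s'))) \<longlonglongrightarrow> (1/2) *\<^sub>R (x + x)"
    by (intro tendsto_intros grid_pt_cell_tendsto \<nu>)
  then show ?thesis by (simp add: scaleR_2[symmetric])
qed

text \<open>The end node carries a free offset \<open>s'\<close> because the recursion moves it by
  one direction per step. All midpoints along a walk of fixed length converge to \<open>x\<close>,
  so each step contributes a factor \<open>q x\<close>.\<close>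

lemma matpow_tendsto:
  assumes x: "x \<in> interior \<Omega>" and q: "isCont q x"
  shows "(\<lambda>k. matpow (V k) (gmat q k) e (cell_index (\<nu> k) x + s) (cell_index (\<nu> k) x + s')) \<longlonglongrightarrow>
    q x ^ e * walk_coeff dirs coef e (s' - s)"
proof (induction e arbitrary: s')
  case 0
  then show ?case by simp
next
  case (Suc e)
  let ?i = "\<lambda>k. cell_index (\<nu> k) x"
  let ?mid = "\<lambda>k u. (1/2) *\<^sub>R (grid_pt (\<nu> k) (?i k + (s' + u)) + grid_pt (\<nu> k) (?i k + s'))"
  have "(\<lambda>k. \<Sum>u\<in>dirs. matpow (V k) (gmat q k) e (?i k + s) (?i k + (s' + u)) * q (?mid k u) * coef u)
     \<longlonglongrightarrow> (\<Sum>u\<in>dirs. q x ^ e * walk_coeff dirs coef e ((s' + u) - s) * q x * coef u)"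
    by (intro tendsto_sum tendsto_mult tendsto_const Suc.IH isCont_tendsto_compose[OF q] midpoint_tendsto)
  also have "(\<Sum>u\<in>dirs. q x ^ e * walk_coeff dirs coef e ((s' + u) - s) * q x * coef u)
      = q x ^ Suc e * walk_coeff dirs coef (Suc e) (s' - s)"
    by (simp add: sum_distrib_left algebra_simps)
  finally have lim: "(\<lambda>k. \<Sum>u\<in>dirs. matpow (V k) (gmat q k) e (?i k + s) (?i k + (s' + u)) * q (?mid k u) * coef u)
     \<longlonglongrightarrow> q x ^ Suc e * walk_coeff dirs coef (Suc e) (s' - s)" .
  \<comment> \<open>There are finitely many directions, so from some \<open>k\<close> on no
    neighbour of the end node is cut off by the boundary.\<close>
  have "\<forall>\<^sub>F k in sequentially. \<forall>u\<in>dirs. ?i k + (s' + u) \<in> V k"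
    by (intro eventually_ball_finite finite_toeplitz_dirs ballI eventually_cell_immersed \<nu> domain x)
  then have "\<forall>\<^sub>F k in sequentially. (\<Sum>u\<in>dirs. matpow (V k) (gmat q k) e (?i k + s) (?i k + (s' + u)) * q (?mid k u) * coef u)
     = matpow (V k) (gmat q k) (Suc e) (?i k + s) (?i k + s')"
  proof eventually_elim
    case (elim k)
    have "matpow (V k) (gmat q k) (Suc e) (?i k + s) (?i k + s') =
      (\<Sum>m\<in>V k. (matpow (V k) (gmat q k) e (?i k + s) m * q ((1/2) *\<^sub>R (grid_pt (\<nu> k) m + grid_pt (\<nu> k) (?i k + s')))) * coef (m - (?i k + s')))"
      by (simp add: grid_matrix_def mult.assoc)
    also have "\<dots> = (\<Sum>u\<in>dirs. if (?i k + s') + u \<in> V k then (matpow (V k) (gmat q k) e (?i k + s) ((?i k + s') + u) * q ((1/2) *\<^sub>R (grid_pt (\<nu> k) ((?i k + s') + u) + grid_pt (\<nu> k) (?i k + s')))) * coef u else 0)"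
      by (rule sum_toeplitz_reindex[OF finite_immersed_set])
    also have "\<dots> = (\<Sum>u\<in>dirs. matpow (V k) (gmat q k) e (?i k + s) (?i k + (s' + u)) * q (?mid k u) * coef u)"
      using elim by (intro sum.cong) (auto simp: add.assoc)
    finally show ?case by simp
  qed
  then show ?case by (rule Lim_transform_eventually[OF lim])
qed

text \<open>The l1 norm of the Fourier coefficients dominates both the symbol and the row sums of
  the Toeplitz part.\<close>

definition coef_norm :: real where "coef_norm = (\<Sum>u\<in>dirs. \<bar>coef u\<bar>)"

lemma grid_matrix_sym: "gmat q k i j = gmat q k j i"
proof -
  have "coef (i - j) = coef (j - i)"
    using toeplitz_coeff_uminus[OF ts_sorted ts_nonzero, of w "j - i"] by simp
  then show ?thesis by (simp add: grid_matrix_def add.commute)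
qed

lemma abs_symb_le: "\<bar>symb \<theta>\<bar> \<le> coef_norm"
proof -
  have "\<bar>symb \<theta>\<bar> = cmod (\<Sum>u\<in>dirs. of_real (coef u) * cis (phase u \<theta>))"
    unfolding toeplitz_symbol_eq[OF ts_sorted ts_nonzero, symmetric] by simp
  also have "\<dots> \<le> (\<Sum>u\<in>dirs. \<bar>coef u\<bar>)"
    by (intro sum_norm_le) (simp add: norm_mult)
  finally show ?thesis by (simp add: coef_norm_def)
qed

abbreviation "eigensystem q k u l \<equiv> orthonormal_eigensystem (V k) (\<lambda>i j. complex_of_real (gmat q k i j)) (V k) u l"

lemma eigensystem_exists: "\<exists>u l. eigensystem q k u l"
  by (rule Hermitian_orthonormal_eigensystem_exists[OF finite_immersed_set]) (auto simp: grid_matrix_sym)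

lemma eigenvalue_bound:
  assumes "eigensystem q k u l" "j \<in> V k" "\<And>x. \<bar>q x\<bar> \<le> M"
  shows "\<bar>l j\<bar> \<le> M * coef_norm"
proof (rule eigenvalue_abs_le_row_sum[OF finite_immersed_set assms(1,2)])
  fix i
  show "(\<Sum>m\<in>V k. cmod (complex_of_real (gmat q k i m))) \<le> M * coef_norm"
    using sum_abs_grid_matrix_le[where q = q and V = "V k" and M = M and ts = ts and w = w and n = "\<nu> k" and j = i, OF finite_immersed_set assms(3)]
    by (simp add: grid_matrix_sym[of q k i] coef_norm_def)
qed

text \<open>The sum of the powers is a trace, hence a node sum whose terms are bounded independently
  of the size and converge by \<open>matpow_tendsto\<close> with zero offsets.\<close>

lemma moments_tendsto:
  assumes h: "continuous_on UNIV h" "\<And>y. \<bar>h y\<bar> \<le> M"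
    and sys: "\<And>k. eigensystem (\<lambda>x. h (p x)) k (u k) (l k)"
  shows "(\<lambda>k. (\<Sum>j\<in>V k. l k j ^ e) / grid_vol (\<nu> k)) \<longlonglongrightarrow> (LINT x:\<Omega>|lebesgue. h (p x) ^ e * walk_coeff dirs coef e 0)"
proof -
  have "(\<lambda>k. (\<Sum>i\<in>V k. matpow (V k) (gmat (\<lambda>x. h (p x)) k) e i i) / grid_vol (\<nu> k)) \<longlonglongrightarrow> (LINT x:\<Omega>|lebesgue. h (p x) ^ e * walk_coeff dirs coef e 0)"
  proof (rule grid_sum_comp_tendsto[where C = "(M * coef_norm) ^ e" and h = "\<lambda>y. h y ^ e * walk_coeff dirs coef e 0"])
    show "\<bar>matpow (V k) (gmat (\<lambda>x. h (p x)) k) e i i\<bar> \<le> (M * coef_norm) ^ e" for k i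
      unfolding coef_norm_def by (intro abs_matpow_le finite_immersed_set sum_abs_grid_matrix_le h)
    show "continuous_on UNIV (\<lambda>y. h y ^ e * walk_coeff dirs coef e 0)" by (intro continuous_intros h)
    fix x assume x: "x \<in> interior \<Omega>" "isCont p x"
    have "isCont h (p x)" using h(1) by (simp add: continuous_on_eq_continuous_at)
    then have "isCont (\<lambda>x. h (p x)) x" using x(2) by (rule isCont_o2[rotated])
    from matpow_tendsto[OF x(1) this, of e 0 0]
    show "(\<lambda>k. matpow (V k) (gmat (\<lambda>x. h (p x)) k) e (cell_index (\<nu> k) x) (cell_index (\<nu> k) x)) \<longlonglongrightarrow> h (p x) ^ e * walk_coeff dirs coef e 0"
      by simp
  qed
  then show ?thesis using sum_eigenvalue_powers[OF finite_immersed_set grid_matrix_sym sys] by simp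
qed

lemma card_tendsto: "(\<lambda>k. real (card (V k)) / grid_vol (\<nu> k)) \<longlonglongrightarrow> measure lebesgue \<Omega>"
proof -
  have "(\<lambda>k. (\<Sum>i\<in>V k. 1) / grid_vol (\<nu> k)) \<longlonglongrightarrow> (LINT x:\<Omega>|lebesgue. 1)"
    by (rule grid_sum_comp_tendsto[where h = "\<lambda>_. 1" and C = 1]) auto
  then show ?thesis using domain by (simp add: set_lebesgue_integral_def)
qed

end

section \<open>Bounded symbols\<close>

text \<open>Serves two exchanges of limits: replacing the test function by polynomials and replacing
  the weight by clipped ones.\<close>

lemma tendsto_approximation:
  fixes a :: "nat \<Rightarrow> real"
  assumes "\<And>e. e > 0 \<Longrightarrow> \<exists>a' b'. a' \<longlonglongrightarrow> b' \<and> (\<forall>\<^sub>F k in sequentially. \<bar>a k - a' k\<bar> \<le> e) \<and> \<bar>b - b'\<bar> \<le> e"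
  shows "a \<longlonglongrightarrow> b"
proof (rule tendstoI)
  fix e :: real assume "e > 0"
  then obtain a' b' where *: "a' \<longlonglongrightarrow> b'" "\<forall>\<^sub>F k in sequentially. \<bar>a k - a' k\<bar> \<le> e / 4" "\<bar>b - b'\<bar> \<le> e / 4"
    using assms[of "e / 4"] by auto
  have "\<forall>\<^sub>F k in sequentially. dist (a' k) b' < e / 4" using \<open>e > 0\<close> by (intro tendstoD[OF *(1)]) simp
  with *(2) show "\<forall>\<^sub>F k in sequentially. dist (a k) b < e"
  proof eventually_elim
    case (elim k)
    have "\<bar>a' k - b'\<bar> < e / 4" using elim by (simp add: dist_real_def)
    then have "\<bar>a k - b\<bar> < e" using elim *(3) \<open>e > 0\<close> by linarith
    then show ?case by (simp add: dist_real_def)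
  qed
qed

lemma integrable_indicator_lmeasurable: "S \<in> lmeasurable \<Longrightarrow> integrable lebesgue (indicat_real S)"
  unfolding fmeasurable_def by (blast intro: integrable_real_indicator)

lemma abs_set_integral_le:
  fixes G :: "'a::euclidean_space \<Rightarrow> real"
  assumes D: "D \<in> lmeasurable" and G: "set_integrable lebesgue D G" and C: "\<And>z. z \<in> D \<Longrightarrow> \<bar>G z\<bar> \<le> C"
  shows "\<bar>LINT z:D|lebesgue. G z\<bar> \<le> C * measure lebesgue D"
proof -
  have i: "integrable lebesgue (indicat_real D)" using D by (rule integrable_indicator_lmeasurable)
  have "\<bar>LINT z:D|lebesgue. G z\<bar> \<le> (LINT z|lebesgue. norm (indicator D z *\<^sub>R G z))"
    unfolding set_lebesgue_integral_def real_norm_def[symmetric] by (rule integral_norm_bound)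
  also have "\<dots> \<le> (LINT z|lebesgue. C * indicator D z)"
    using G i C unfolding set_integrable_def
    by (intro Bochner_Integration.integral_mono integrable_norm integrable_mult_right)
      (assumption | auto simp: indicator_def)+
  also have "\<dots> = C * measure lebesgue D" by simp
  finally show ?thesis .
qed

definition clip :: "real \<Rightarrow> real \<Rightarrow> real" where
  "clip m y = max (- m) (min m y)"

text \<open>A continuous majorant of the indicator of \<open>m \<le> |y|\<close>, vanishing for
  \<open>|y| \<le> m - 1\<close>. Continuity makes it accessible to the convergence of node
  sums.\<close>

definition excess :: "real \<Rightarrow> real \<Rightarrow> real" where
  "excess m y = max 0 (min 1 (\<bar>y\<bar> - m + 1))"

lemma continuous_on_clip: "continuous_on UNIV (clip m)"
  unfolding clip_def by (intro continuous_intros)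

lemma continuous_on_excess: "continuous_on UNIV (excess m)"
  unfolding excess_def by (intro continuous_intros)

lemma excess_bounds: "0 \<le> excess m y" "excess m y \<le> 1" "m \<le> \<bar>y\<bar> \<Longrightarrow> excess m y = 1"
  by (auto simp: excess_def)

section \<open>Integrals over position and frequency\<close>

context immersed_toeplitz_sequence
begin

abbreviation phase_space :: "((real ^ 'd::{finite,wellorder}) \<times> (real ^ 'd::{finite,wellorder})) set" where
  "phase_space \<equiv> \<Omega> \<times> torus"

lemma torus_content: "measure lborel (torus :: (real ^ 'd::{finite,wellorder}) set) = (2 * pi) ^ CARD('d::{finite,wellorder})"
proof -
  have "(0 :: real ^ 'd::{finite,wellorder}) \<in> torus" by (simp add: mem_box_cart)
  then show ?thesis by (subst content_cbox_cart) auto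
qed

lemma phase_space_measure:
  shows "phase_space \<in> lmeasurable" and "measure lebesgue phase_space = measure lebesgue \<Omega> * (2 * pi) ^ CARD('d::{finite,wellorder})"
proof -
  have f: "integrable lebesgue (indicat_real \<Omega>)"
    using domain(3) by (rule integrable_indicator_lmeasurable)
  have g: "integrable lborel (indicat_real (torus :: (real ^ 'd::{finite,wellorder}) set))"
    by (intro integrable_real_indicator) (auto simp: emeasure_lborel_cbox_eq)
  have eq: "(\<lambda>z. indicat_real \<Omega> (fst z) * indicat_real torus (snd z)) = indicat_real phase_space"
    by (auto simp: indicator_def fun_eq_iff)
  have i: "integrable lebesgue (indicat_real phase_space)"
    using integral_lebesgue_times(1)[OF f g] by (simp only: eq)
  then show "phase_space \<in> lmeasurable" by (simp add: integrable_indicator_iff fmeasurable_def less_top del: emeasure_completion)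
  then show "measure lebesgue phase_space = measure lebesgue \<Omega> * (2 * pi) ^ CARD('d::{finite,wellorder})"
    using integral_lebesgue_times(2)[OF f g] domain(2) by (simp add: eq torus_content)
qed

lemma phase_space_sets [measurable]: "phase_space \<in> sets lebesgue"
  using phase_space_measure(1) by (rule fmeasurableD)

lemma comp_symbol_measurable:
  fixes F h :: "real \<Rightarrow> real"
  assumes F: "continuous_on UNIV F" and h: "continuous_on UNIV h"
  shows "(\<lambda>z. indicator phase_space z *\<^sub>R F (h (p (fst z)) * symb (snd z))) \<in> borel_measurable lebesgue"
proof -
  have F'[measurable]: "F \<in> borel_measurable borel" using F by (rule borel_measurable_continuous_onI)
  have [measurable]: "(\<lambda>z :: (real ^ 'd::{finite,wellorder}) \<times> (real ^ 'd::{finite,wellorder}). indicator \<Omega> (fst z) * h (p (fst z))) \<in> borel_measurable lebesgue"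
    using measurable_compose[OF fst_measurable_lebesgue comp_p_measurable[OF h]] .
  have [measurable]: "(\<lambda>z :: (real ^ 'd::{finite,wellorder}) \<times> (real ^ 'd::{finite,wellorder}). symb (snd z)) \<in> borel_measurable lebesgue"
    by (intro measurable_completion)
      (auto intro!: borel_measurable_continuous_onI continuous_on_compose2[OF continuous_on_toeplitz_symbol[of UNIV]] continuous_intros)
  have "(\<lambda>z. indicator phase_space z *\<^sub>R F ((indicator \<Omega> (fst z) * h (p (fst z))) * symb (snd z))) \<in> borel_measurable lebesgue"
    by measurable
  also have "(\<lambda>z. indicator phase_space z *\<^sub>R F ((indicator \<Omega> (fst z) * h (p (fst z))) * symb (snd z)))
     = (\<lambda>z. indicator phase_space z *\<^sub>R F (h (p (fst z)) * symb (snd z)))"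
    by (auto simp: indicator_def fun_eq_iff)
  finally show ?thesis .
qed

lemma comp_symbol_integrable:
  fixes F h :: "real \<Rightarrow> real"
  assumes F: "continuous_on UNIV F" and h: "continuous_on UNIV h"
    and C: "\<And>y \<theta>. \<bar>F (h y * symb \<theta>)\<bar> \<le> C"
  shows "set_integrable lebesgue phase_space (\<lambda>z. F (h (p (fst z)) * symb (snd z)))"
  unfolding set_integrable_def
proof (rule Bochner_Integration.integrable_bound)
  show "integrable lebesgue (\<lambda>z. C * indicat_real phase_space z)"
    by (intro integrable_mult_right integrable_indicator_lmeasurable phase_space_measure)
  show "AE z in lebesgue. norm (indicat_real phase_space z *\<^sub>R F (h (p (fst z)) * symb (snd z))) \<le> norm (C * indicat_real phase_space z)"
    using C by (intro AE_I2) (auto simp: indicator_def intro: order_trans[OF C abs_ge_self])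
qed (rule comp_symbol_measurable[OF F h])

text \<open>The integrand is a product of a function of position and one of frequency; the frequency
  integral yields the weighted closed walks.\<close>

lemma moment_integral:
  assumes h: "continuous_on UNIV h" "\<And>y. \<bar>h y\<bar> \<le> M"
  shows "(LINT z:phase_space|lebesgue. (h (p (fst z)) * symb (snd z)) ^ e)
    = (LINT x:\<Omega>|lebesgue. h (p x) ^ e * walk_coeff dirs coef e 0) * (2 * pi) ^ CARD('d::{finite,wellorder})"
proof -
  let ?f = "\<lambda>x. indicator \<Omega> x * h (p x) ^ e" and ?g = "\<lambda>\<theta>. indicator torus \<theta> * symb \<theta> ^ e"
  have f: "integrable lebesgue ?f"
  proof (rule Bochner_Integration.integrable_bound)
    show "integrable lebesgue (\<lambda>z. M ^ e * indicat_real \<Omega> z)"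
      by (intro integrable_mult_right integrable_indicator_lmeasurable domain)
    show "?f \<in> borel_measurable lebesgue"
      by (rule comp_p_measurable) (intro continuous_intros h)
    have "\<bar>h (p x)\<bar> ^ e \<le> \<bar>M\<bar> ^ e" for x
      using h(2)[of "p x"] by (intro power_mono) auto
    then show "AE x in lebesgue. norm (?f x) \<le> norm (M ^ e * indicat_real \<Omega> x)"
      by (intro AE_I2) (auto simp: indicator_def power_abs)
  qed
  have g: "integrable lborel ?g"
    using borel_integrable_compact[OF compact_cbox continuous_on_power[OF continuous_on_toeplitz_symbol], of "- (\<chi> r. pi)" "\<chi> r. pi" ts w e]
    by simp
  have "(LINT z:phase_space|lebesgue. (h (p (fst z)) * symb (snd z)) ^ e) = (LINT z|lebesgue. ?f (fst z) * ?g (snd z))"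
    unfolding set_lebesgue_integral_def
    by (intro Bochner_Integration.integral_cong refl) (auto simp: indicator_def power_mult_distrib)
  also have "\<dots> = (LINT x|lebesgue. ?f x) * (LINT \<theta>|lborel. ?g \<theta>)"
    by (rule integral_lebesgue_times(2)[OF f g])
  also have "(LINT \<theta>|lborel. ?g \<theta>) = (2 * pi) ^ CARD('d::{finite,wellorder}) * walk_coeff dirs coef e 0"
    using integral_symbol_power[OF ts_sorted ts_nonzero, of w e] by (simp add: set_lebesgue_integral_def)
  also have "(LINT x|lebesgue. ?f x) * ((2 * pi) ^ CARD('d::{finite,wellorder}) * walk_coeff dirs coef e 0)
     = (LINT x:\<Omega>|lebesgue. h (p x) ^ e * walk_coeff dirs coef e 0) * (2 * pi) ^ CARD('d::{finite,wellorder})"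
    by (simp add: set_lebesgue_integral_def mult.assoc[symmetric])
  finally show ?thesis .
qed

lemma bounded_distribution_polynomial:
  assumes h: "continuous_on UNIV h" "\<And>y. \<bar>h y\<bar> \<le> M"
    and sys: "\<And>k. eigensystem (\<lambda>x. h (p x)) k (u k) (l k)"
    and F: "\<And>x. F x = (\<Sum>e\<le>N. a e * x ^ e)"
  shows "(\<lambda>k. (\<Sum>j\<in>V k. F (l k j)) / grid_vol (\<nu> k)) \<longlonglongrightarrow>
    (LINT z:phase_space|lebesgue. F (h (p (fst z)) * symb (snd z))) / (2 * pi) ^ CARD('d::{finite,wellorder})"
proof -
  let ?c = "(2 * pi) ^ CARD('d::{finite,wellorder})"
  have "(\<lambda>k. \<Sum>e\<le>N. a e * ((\<Sum>j\<in>V k. l k j ^ e) / grid_vol (\<nu> k)))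
     \<longlonglongrightarrow> (\<Sum>e\<le>N. a e * (LINT x:\<Omega>|lebesgue. h (p x) ^ e * walk_coeff dirs coef e 0))"
    by (intro tendsto_sum tendsto_mult tendsto_const moments_tendsto[OF h sys])
  moreover have "(\<Sum>e\<le>N. a e * ((\<Sum>j\<in>V k. l k j ^ e) / grid_vol (\<nu> k))) = (\<Sum>j\<in>V k. F (l k j)) / grid_vol (\<nu> k)" for k
    unfolding F by (subst sum.swap) (simp add: sum_distrib_left sum_divide_distrib)
  moreover have "(\<Sum>e\<le>N. a e * (LINT x:\<Omega>|lebesgue. h (p x) ^ e * walk_coeff dirs coef e 0))
      = (LINT z:phase_space|lebesgue. F (h (p (fst z)) * symb (snd z))) / ?c"
  proof -
    have int: "set_integrable lebesgue phase_space (\<lambda>z. a e * (h (p (fst z)) * symb (snd z)) ^ e)" for e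
    proof (rule comp_symbol_integrable[where F = "\<lambda>y. a e * y ^ e", OF _ h(1)])
      fix y \<theta>
      have "\<bar>h y * symb \<theta>\<bar> \<le> M * coef_norm"
        unfolding abs_mult using h(2)[of y] by (intro mult_mono abs_symb_le) auto
      then show "\<bar>a e * (h y * symb \<theta>) ^ e\<bar> \<le> \<bar>a e\<bar> * (M * coef_norm) ^ e"
        unfolding abs_mult[of "a e"] power_abs by (intro mult_left_mono power_mono) auto
    qed (intro continuous_intros)
    have "(LINT z:phase_space|lebesgue. F (h (p (fst z)) * symb (snd z))) = (\<Sum>e\<le>N. LINT z:phase_space|lebesgue. a e * (h (p (fst z)) * symb (snd z)) ^ e)"
      unfolding F set_lebesgue_integral_def scaleR_sum_right
      by (rule Bochner_Integration.integral_sum) (use int in \<open>simp add: set_integrable_def\<close>)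
    also have "\<dots> = (\<Sum>e\<le>N. a e * (LINT x:\<Omega>|lebesgue. h (p x) ^ e * walk_coeff dirs coef e 0)) * ?c"
      by (simp add: moment_integral[OF h] sum_distrib_right mult.assoc)
    finally show ?thesis by simp
  qed
  ultimately show ?thesis by simp
qed

lemma bounded_distribution:
  fixes F :: "real \<Rightarrow> real"
  assumes h: "continuous_on UNIV h" "\<And>y. \<bar>h y\<bar> \<le> M"
    and sys: "\<And>k. eigensystem (\<lambda>x. h (p x)) k (u k) (l k)"
    and F: "continuous_on UNIV F"
  shows "(\<lambda>k. (\<Sum>j\<in>V k. F (l k j)) / grid_vol (\<nu> k)) \<longlonglongrightarrow>
    (LINT z:phase_space|lebesgue. F (h (p (fst z)) * symb (snd z))) / (2 * pi) ^ CARD('d::{finite,wellorder})"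
proof (rule tendsto_approximation)
  fix e :: real assume e: "e > 0"
  let ?c = "(2 * pi) ^ CARD('d::{finite,wellorder}) :: real"
  have c: "?c > 0" by simp
  \<comment> \<open>The eigenvalue sums need \<open>e' \<le> e\<close>, the integral needs
    \<open>e'\<close> times the measure of \<open>\<Omega>\<close> to be at most \<open>e\<close>;
    the summand 1 secures the former and excludes division by zero.\<close>
  define e' where "e' = e / (1 + measure lebesgue \<Omega>)"
  have mu: "1 + measure lebesgue \<Omega> > 0" using measure_nonneg[of lebesgue \<Omega>] by linarith
  have e': "e' > 0" "e' \<le> e" "e' * measure lebesgue \<Omega> \<le> e"
  proof -
    show "e' > 0" unfolding e'_def using e mu by (rule divide_pos_pos)
    show "e' \<le> e" "e' * measure lebesgue \<Omega> \<le> e"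
      using e measure_nonneg[of lebesgue \<Omega>]
      by (simp_all only: e'_def times_divide_eq_left pos_divide_le_eq[OF mu]) (simp_all add: distrib_left)
  qed
  \<comment> \<open>One interval for both sides: it contains the eigenvalues by the row-sum bound
    and the values of the limit function by the bound on the symbol.\<close>
  define B where "B = M * coef_norm"
  have bnd: "\<bar>h y * symb \<theta>\<bar> \<le> B" for y \<theta>
    unfolding abs_mult B_def using h(2)[of y] by (intro mult_mono abs_symb_le) auto
  obtain P where P: "real_polynomial_function P" "\<And>x. x \<in> {-B..B} \<Longrightarrow> \<bar>F x - P x\<bar> < e'"
    using Stone_Weierstrass_real_polynomial_function[OF compact_Icc[of "-B" B] continuous_on_subset[OF F] e'(1)] by auto
  then obtain a N where a: "\<And>x. P x = (\<Sum>e\<le>N. a e * x ^ e)"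
    unfolding real_polynomial_function_iff_sum by auto
  let ?b' = "(LINT z:phase_space|lebesgue. P (h (p (fst z)) * symb (snd z))) / ?c"
  have 1: "(\<lambda>k. (\<Sum>j\<in>V k. P (l k j)) / grid_vol (\<nu> k)) \<longlonglongrightarrow> ?b'"
    by (rule bounded_distribution_polynomial[OF h sys a])
  have 2: "\<bar>(\<Sum>j\<in>V k. F (l k j)) / grid_vol (\<nu> k) - (\<Sum>j\<in>V k. P (l k j)) / grid_vol (\<nu> k)\<bar> \<le> e" for k
  proof -
    have "\<bar>\<Sum>j\<in>V k. F (l k j) - P (l k j)\<bar> \<le> (\<Sum>j\<in>V k. e')"
    proof (rule order_trans[OF sum_abs sum_mono])
      fix j assume "j \<in> V k"
      then have "\<bar>l k j\<bar> \<le> B" unfolding B_def by (rule eigenvalue_bound[OF sys]) (rule h)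
      then have "l k j \<in> {-B..B}" by (auto simp: abs_le_iff)
      then show "\<bar>F (l k j) - P (l k j)\<bar> \<le> e'" by (intro less_imp_le P(2))
    qed
    also have "\<dots> = e' * real (card (V k))" by simp
    also have "\<dots> \<le> e * grid_vol (\<nu> k)"
      using e' e card_immersed_set_le[of "\<nu> k" \<Omega>] by (intro mult_mono) auto
    finally show ?thesis
      using grid_vol_pos[of "\<nu> k"]
      by (simp add: diff_divide_distrib[symmetric] sum_subtractf pos_divide_le_eq)
  qed
  have 3: "\<bar>(LINT z:phase_space|lebesgue. F (h (p (fst z)) * symb (snd z))) / ?c - ?b'\<bar> \<le> e"
  proof -
    have cP: "continuous_on UNIV P" unfolding a by (intro continuous_intros)
    have ex: "\<exists>C. \<forall>y \<theta>. \<bar>Q (h y * symb \<theta>)\<bar> \<le> C" if "continuous_on UNIV Q" for Q :: "real \<Rightarrow> real"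
    proof -
      have "bounded (Q ` {-B..B})"
        by (intro compact_imp_bounded compact_continuous_image continuous_on_subset[OF that]) auto
      then obtain C where C: "\<And>x. x \<in> {-B..B} \<Longrightarrow> \<bar>Q x\<bar> \<le> C" unfolding bounded_iff real_norm_def by blast
      have "h y * symb \<theta> \<in> {-B..B}" for y \<theta> using bnd[of y \<theta>] by (auto simp: abs_le_iff)
      then show ?thesis using C by blast
    qed
    have iF: "set_integrable lebesgue phase_space (\<lambda>z. F (h (p (fst z)) * symb (snd z)))"
      using ex[OF F] comp_symbol_integrable[OF F h(1)] by blast
    have iP: "set_integrable lebesgue phase_space (\<lambda>z. P (h (p (fst z)) * symb (snd z)))"
      using ex[OF cP] comp_symbol_integrable[OF cP h(1)] by blast
    have "\<bar>(LINT z:phase_space|lebesgue. F (h (p (fst z)) * symb (snd z))) - (LINT z:phase_space|lebesgue. P (h (p (fst z)) * symb (snd z)))\<bar>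
      = \<bar>LINT z:phase_space|lebesgue. F (h (p (fst z)) * symb (snd z)) - P (h (p (fst z)) * symb (snd z))\<bar>"
      using set_integral_diff(2)[OF iF iP] by simp
    also have "\<dots> \<le> e' * measure lebesgue phase_space"
    proof (rule abs_set_integral_le[OF phase_space_measure(1) set_integral_diff(1)[OF iF iP]])
      fix z :: "(real ^ 'd::{finite,wellorder}) \<times> (real ^ 'd::{finite,wellorder})"
      show "\<bar>F (h (p (fst z)) * symb (snd z)) - P (h (p (fst z)) * symb (snd z))\<bar> \<le> e'"
        using bnd[of "p (fst z)" "snd z"] by (intro less_imp_le P(2)) (simp add: abs_le_iff)
    qed
    also have "\<dots> \<le> e * ?c"
      unfolding phase_space_measure(2) using e'(3) c by (simp add: mult.assoc[symmetric])
    finally show ?thesis using c by (simp add: diff_divide_distrib[symmetric] pos_divide_le_eq)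
  qed
  show "\<exists>a' b'. a' \<longlonglongrightarrow> b' \<and>
      (\<forall>\<^sub>F k in sequentially. \<bar>(\<Sum>j\<in>V k. F (l k j)) / grid_vol (\<nu> k) - a' k\<bar> \<le> e) \<and>
      \<bar>(LINT z:phase_space|lebesgue. F (h (p (fst z)) * symb (snd z))) / ?c - b'\<bar> \<le> e"
    using 1 2 3 by (intro exI[of _ "\<lambda>k. (\<Sum>j\<in>V k. P (l k j)) / grid_vol (\<nu> k)"] exI[of _ ?b']) auto
qed

section \<open>Unbounded symbols\<close>

abbreviation "midpoint_value k i j \<equiv> p ((1/2) *\<^sub>R (grid_pt (\<nu> k) i + grid_pt (\<nu> k) j))"

lemma eigensystem_sequence_exists: "\<exists>u l. \<forall>k. eigensystem q k (u k) (l k)"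
proof -
  have "\<forall>k. \<exists>u l. eigensystem q k u l" using eigensystem_exists by (rule allI)
  from choice[OF this] obtain u where "\<forall>k. \<exists>l. eigensystem q k (u k) l" by (rule exE)
  from choice[OF this] obtain l where "\<forall>k. eigensystem q k (u k) (l k)" by (rule exE)
  then show ?thesis by (intro exI)
qed

text \<open>The two matrices agree off the rows and columns in \<open>R\<close>, and the interlacing
  bound is applied in both directions. The size of \<open>R\<close> is then majorised by continuous
  cut-offs, whose node sums have a limit.\<close>

lemma clipped_eigenvalue_count:
  assumes sys: "eigensystem p k u l" and sys': "eigensystem (\<lambda>x. clip m (p x)) k u' l'"
  shows "\<bar>real (card {j\<in>V k. l j \<le> t}) - real (card {j\<in>V k. l' j \<le> t})\<bar>
    \<le> (\<Sum>i\<in>V k. \<Sum>v\<in>dirs. excess m (midpoint_value k i (i + v)))"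
proof -
  \<comment> \<open>Rows are selected by midpoint values, since these are what the entries contain.
    The neighbour \<open>i + v\<close> need not be a node; this can only enlarge
    \<open>R\<close>.\<close>
  define R where "R = {i\<in>V k. \<exists>v\<in>dirs. m < \<bar>midpoint_value k i (i + v)\<bar>}"
  have fin: "finite R" "R \<subseteq> V k" by (auto simp: R_def finite_immersed_set)
  have eq: "gmat p k i j = gmat (\<lambda>x. clip m (p x)) k i j" if "i \<in> V k - R" "j \<in> V k - R" for i j
  proof (cases "i - j \<in> dirs")
    case True
    \<comment> \<open>The directions are symmetric, so row \<open>i\<close> sees the entry at
      \<open>(i, j)\<close> through the direction \<open>j - i\<close>.\<close>
    then have "j - i \<in> dirs" using uminus_in_toeplitz_dirs[of "i - j" ts] by simp
    then have "\<not> m < \<bar>midpoint_value k i (i + (j - i))\<bar>" using that(1) unfolding R_def by blast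
    then have "clip m (midpoint_value k i j) = midpoint_value k i j" by (auto simp: clip_def)
    then show ?thesis by (simp add: grid_matrix_def)
  qed (simp add: grid_matrix_def toeplitz_coeff_def)
  have "card {j\<in>V k. l j \<le> t} \<le> card {j\<in>V k. l' j \<le> t} + card R"
    by (rule eigenvalue_count_le[OF finite_immersed_set fin(2) _ sys sys']) (simp add: eq)
  moreover have "card {j\<in>V k. l' j \<le> t} \<le> card {j\<in>V k. l j \<le> t} + card R"
    by (rule eigenvalue_count_le[OF finite_immersed_set fin(2) _ sys' sys]) (simp add: eq)
  ultimately have "\<bar>real (card {j\<in>V k. l j \<le> t}) - real (card {j\<in>V k. l' j \<le> t})\<bar> \<le> real (card R)" by linarith
  also have "\<dots> = (\<Sum>i\<in>R. 1)" by simp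
  also have "\<dots> \<le> (\<Sum>i\<in>R. \<Sum>v\<in>dirs. excess m (midpoint_value k i (i + v)))"
  proof (rule sum_mono)
    fix i assume "i \<in> R"
    then obtain v where v: "v \<in> dirs" "m < \<bar>midpoint_value k i (i + v)\<bar>" by (auto simp: R_def)
    have "1 = excess m (midpoint_value k i (i + v))" using v by (simp add: excess_bounds)
    also have "\<dots> \<le> (\<Sum>v\<in>dirs. excess m (midpoint_value k i (i + v)))"
      by (rule member_le_sum[OF v(1)]) (auto simp: excess_bounds finite_toeplitz_dirs)
    finally show "1 \<le> (\<Sum>v\<in>dirs. excess m (midpoint_value k i (i + v)))" .
  qed
  also have "\<dots> \<le> (\<Sum>i\<in>V k. \<Sum>v\<in>dirs. excess m (midpoint_value k i (i + v)))"
    using fin by (intro sum_mono2 finite_immersed_set sum_nonneg excess_bounds) auto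
  finally show ?thesis .
qed

text \<open>Values of \<open>excess\<close> lie between 0 and 1 whatever \<open>p\<close> does, so
  the uniform bound survives midpoints outside \<open>\<Omega>\<close>. At interior continuity
  points every direction contributes the same limit.\<close>

lemma excess_sum_tendsto:
  "(\<lambda>k. (\<Sum>i\<in>V k. \<Sum>v\<in>dirs. excess m (midpoint_value k i (i + v))) / grid_vol (\<nu> k))
    \<longlonglongrightarrow> (LINT x:\<Omega>|lebesgue. real (card dirs) * excess m (p x))"
proof (rule grid_sum_comp_tendsto[where C = "real (card dirs)" and h = "\<lambda>y. real (card dirs) * excess m y"])
  fix k i
  have "\<bar>\<Sum>v\<in>dirs. excess m (midpoint_value k i (i + v))\<bar> \<le> (\<Sum>v\<in>dirs. 1)"
    by (rule order_trans[OF sum_abs sum_mono]) (simp add: excess_bounds)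
  then show "\<bar>\<Sum>v\<in>dirs. excess m (midpoint_value k i (i + v))\<bar> \<le> real (card dirs)" by simp
next
  show "continuous_on UNIV (\<lambda>y. real (card dirs) * excess m y)"
    by (intro continuous_intros continuous_on_excess)
  fix x assume x: "x \<in> interior \<Omega>" "isCont p x"
  have "isCont (excess m) (p x)" using continuous_on_excess by (simp add: continuous_on_eq_continuous_at)
  then have c: "isCont (\<lambda>x. excess m (p x)) x" using x(2) by (rule isCont_o2[rotated])
  have "(\<lambda>k. \<Sum>v\<in>dirs. excess m (midpoint_value k (cell_index (\<nu> k) x + 0) (cell_index (\<nu> k) x + v))) \<longlonglongrightarrow> (\<Sum>v\<in>dirs. excess m (p x))"
    by (intro tendsto_sum isCont_tendsto_compose[OF c] midpoint_tendsto)
  then show "(\<lambda>k. \<Sum>v\<in>dirs. excess m (midpoint_value k (cell_index (\<nu> k) x) (cell_index (\<nu> k) x + v))) \<longlonglongrightarrow> real (card dirs) * excess m (p x)"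
    by simp
qed

text \<open>\<open>p\<close> is finite at every point, so the excess there vanishes once
  \<open>m\<close> reaches \<open>|p x| + 1\<close>; the finite measure of \<open>\<Omega>\<close>
  supplies the dominating function.\<close>

lemma excess_integral_tendsto_0:
  "(\<lambda>m. LINT x:\<Omega>|lebesgue. real (card dirs) * excess (real m) (p x)) \<longlonglongrightarrow> 0"
proof -
  have "(\<lambda>m. LINT x|lebesgue. indicator \<Omega> x *\<^sub>R (real (card dirs) * excess (real m) (p x))) \<longlonglongrightarrow> (LINT x|(lebesgue :: (real ^ 'd::{finite,wellorder}) measure). (0 :: real))"
  proof (rule integral_dominated_convergence)
    show "(\<lambda>x. indicator \<Omega> x *\<^sub>R (real (card dirs) * excess (real m) (p x))) \<in> borel_measurable lebesgue" for m
      using comp_p_measurable[of "\<lambda>y. real (card dirs) * excess (real m) y"]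
      by (simp add: continuous_intros continuous_on_excess)
    show "integrable lebesgue (\<lambda>x. real (card dirs) * indicat_real \<Omega> x)"
      by (intro integrable_mult_right integrable_indicator_lmeasurable domain)
    show "AE x in lebesgue. norm (indicator \<Omega> x *\<^sub>R (real (card dirs) * excess (real m) (p x))) \<le> real (card dirs) * indicat_real \<Omega> x" for m
      by (intro AE_I2) (auto simp: indicator_def excess_bounds abs_mult intro!: mult_left_le)
    show "AE x in lebesgue. (\<lambda>m. indicator \<Omega> x *\<^sub>R (real (card dirs) * excess (real m) (p x))) \<longlonglongrightarrow> 0"
    proof (rule AE_I2)
      fix x
      obtain N :: nat where N: "\<bar>p x\<bar> + 1 < real N" using reals_Archimedean2 by blast
      have "\<forall>\<^sub>F m in sequentially. 0 = indicator \<Omega> x *\<^sub>R (real (card dirs) * excess (real m) (p x))"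
        using eventually_ge_at_top[of N]
      proof eventually_elim
        case (elim m)
        then have "real N \<le> real m" by simp
        then have "excess (real m) (p x) = 0" using N by (simp add: excess_def)
        then show ?case by simp
      qed
      then show "(\<lambda>m. indicator \<Omega> x *\<^sub>R (real (card dirs) * excess (real m) (p x))) \<longlonglongrightarrow> 0"
        by (rule Lim_transform_eventually[OF tendsto_const])
    qed
  qed simp
  then show ?thesis by (simp only: set_lebesgue_integral_def integral_zero)
qed

text \<open>At each point the clipping is eventually invisible. Boundedness of \<open>F\<close>
  provides domination even if \<open>p\<close> itself is not integrable.\<close>

lemma clipped_symbol_integral_tendsto:
  fixes F :: "real \<Rightarrow> real"
  assumes F: "continuous_on UNIV F" and C: "\<And>y. \<bar>F y\<bar> \<le> C"
  shows "(\<lambda>m. LINT z:phase_space|lebesgue. F (clip (real m) (p (fst z)) * symb (snd z)))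
    \<longlonglongrightarrow> (LINT z:phase_space|lebesgue. F (p (fst z) * symb (snd z)))"
  unfolding set_lebesgue_integral_def
proof (rule integral_dominated_convergence)
  show "(\<lambda>z. indicator phase_space z *\<^sub>R F (p (fst z) * symb (snd z))) \<in> borel_measurable lebesgue"
    using comp_symbol_measurable[OF F continuous_on_id] by simp
  show "(\<lambda>z. indicator phase_space z *\<^sub>R F (clip (real m) (p (fst z)) * symb (snd z))) \<in> borel_measurable lebesgue" for m
    by (rule comp_symbol_measurable[OF F continuous_on_clip])
  show "integrable lebesgue (\<lambda>x. C * indicat_real phase_space x)"
    by (intro integrable_mult_right integrable_indicator_lmeasurable phase_space_measure)
  show "AE z in lebesgue. norm (indicator phase_space z *\<^sub>R F (clip (real m) (p (fst z)) * symb (snd z))) \<le> C * indicat_real phase_space z" for m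
    using C by (intro AE_I2) (auto simp: indicator_def)
  show "AE z in lebesgue. (\<lambda>m. indicator phase_space z *\<^sub>R F (clip (real m) (p (fst z)) * symb (snd z))) \<longlonglongrightarrow> indicator phase_space z *\<^sub>R F (p (fst z) * symb (snd z))"
  proof (rule AE_I2)
    fix z :: "(real ^ 'd::{finite,wellorder}) \<times> (real ^ 'd::{finite,wellorder})"
    obtain N :: nat where N: "\<bar>p (fst z)\<bar> < real N" using reals_Archimedean2 by blast
    have "\<forall>\<^sub>F m in sequentially. indicator phase_space z *\<^sub>R F (p (fst z) * symb (snd z)) = indicator phase_space z *\<^sub>R F (clip (real m) (p (fst z)) * symb (snd z))"
      using eventually_ge_at_top[of N]
    proof eventually_elim
      case (elim m)
      then have "real N \<le> real m" by simp
      then have "clip (real m) (p (fst z)) = p (fst z)" using N by (auto simp: clip_def)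
      then show ?case by simp
    qed
    then show "(\<lambda>m. indicator phase_space z *\<^sub>R F (clip (real m) (p (fst z)) * symb (snd z))) \<longlonglongrightarrow> indicator phase_space z *\<^sub>R F (p (fst z) * symb (snd z))"
      by (rule Lim_transform_eventually[OF tendsto_const])
  qed
qed

lemma distribution_real:
  fixes F :: "real \<Rightarrow> real"
  assumes sys: "\<And>k. eigensystem p k (u k) (l k)"
    and F: "continuous_on UNIV F" and supp: "\<And>x. L \<le> \<bar>x\<bar> \<Longrightarrow> F x = 0"
  shows "(\<lambda>k. (\<Sum>j\<in>V k. F (l k j)) / grid_vol (\<nu> k)) \<longlonglongrightarrow>
    (LINT z:phase_space|lebesgue. F (p (fst z) * symb (snd z))) / (2 * pi) ^ CARD('d::{finite,wellorder})"
proof (rule tendsto_approximation)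
  fix e :: real assume e: "e > 0"
  let ?c = "(2 * pi) ^ CARD('d::{finite,wellorder}) :: real"
  obtain C where C: "\<And>y. \<bar>F y\<bar> \<le> C"
  proof -
    have "bounded (F ` {-L..L})"
      by (intro compact_imp_bounded compact_continuous_image continuous_on_subset[OF F]) auto
    then obtain C where C: "\<And>x. x \<in> {-L..L} \<Longrightarrow> \<bar>F x\<bar> \<le> C" unfolding bounded_iff real_norm_def by blast
    have "\<bar>F y\<bar> \<le> \<bar>C\<bar>" for y
    proof (cases "L \<le> \<bar>y\<bar>")
      case False
      then have "y \<in> {-L..L}" by auto
      from C[OF this] show ?thesis by linarith
    qed (simp add: supp)
    then show ?thesis using that by blast
  qed
  \<comment> \<open>\<open>K\<close> is fixed before the clipping height \<open>m\<close>. One half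
    of \<open>e\<close> pays for the discretisation of \<open>F\<close>, the other for
    \<open>K\<close> times the bound on the proportion of altered rows.\<close>
  obtain K where K: "K \<ge> 0" and Kr: "\<And>(W :: (int ^ 'd::{finite,wellorder}) set) l m r. finite W \<Longrightarrow>
     (\<And>t. \<bar>real (card {j\<in>W. l j \<le> t}) - real (card {j\<in>W. m j \<le> t})\<bar> \<le> r) \<Longrightarrow>
     norm ((\<Sum>j\<in>W. F (l j)) - (\<Sum>j\<in>W. F (m j))) \<le> e / 2 * real (card W) + K * r"
    using sum_close_if_counting_functions_close[OF F supp, of L "e / 2"] e by fastforce
  have "(\<lambda>m. K * (LINT x:\<Omega>|lebesgue. real (card dirs) * excess (real m) (p x))) \<longlonglongrightarrow> K * 0"
    by (intro tendsto_intros excess_integral_tendsto_0)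
  then have ev1: "\<forall>\<^sub>F m in sequentially. K * (LINT x:\<Omega>|lebesgue. real (card dirs) * excess (real m) (p x)) < e / 2"
    using e by (intro order_tendstoD(2)[where y = "K * 0"]) auto
  have "(\<lambda>m. (LINT z:phase_space|lebesgue. F (clip (real m) (p (fst z)) * symb (snd z))) / ?c)
      \<longlonglongrightarrow> (LINT z:phase_space|lebesgue. F (p (fst z) * symb (snd z))) / ?c"
    by (intro tendsto_divide clipped_symbol_integral_tendsto[OF F C] tendsto_const) simp
  from tendstoD[OF this e]
  have ev2: "\<forall>\<^sub>F m in sequentially. \<bar>(LINT z:phase_space|lebesgue. F (p (fst z) * symb (snd z))) / ?c
      - (LINT z:phase_space|lebesgue. F (clip (real m) (p (fst z)) * symb (snd z))) / ?c\<bar> \<le> e"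
    by (rule eventually_mono) (simp add: dist_real_def abs_minus_commute)
  obtain m :: nat where m1: "K * (LINT x:\<Omega>|lebesgue. real (card dirs) * excess (real m) (p x)) < e / 2"
    and m2: "\<bar>(LINT z:phase_space|lebesgue. F (p (fst z) * symb (snd z))) / ?c
      - (LINT z:phase_space|lebesgue. F (clip (real m) (p (fst z)) * symb (snd z))) / ?c\<bar> \<le> e"
    using eventually_happens'[OF sequentially_bot eventually_conj[OF ev1 ev2]] by blast
  obtain u' l' where sys': "\<And>k. eigensystem (\<lambda>x. clip (real m) (p x)) k (u' k) (l' k)"
    using eigensystem_sequence_exists by blast
  have lim: "(\<lambda>k. (\<Sum>j\<in>V k. F (l' k j)) / grid_vol (\<nu> k)) \<longlonglongrightarrow>
    (LINT z:phase_space|lebesgue. F (clip (real m) (p (fst z)) * symb (snd z))) / ?c"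
    by (rule bounded_distribution[OF continuous_on_clip _ sys' F, of "real m"]) (auto simp: clip_def)
  let ?r = "\<lambda>k. \<Sum>i\<in>V k. \<Sum>v\<in>dirs. excess (real m) (midpoint_value k i (i + v))"
  have "(\<lambda>k. K * (?r k / grid_vol (\<nu> k))) \<longlonglongrightarrow> K * (LINT x:\<Omega>|lebesgue. real (card dirs) * excess (real m) (p x))"
    by (intro tendsto_mult tendsto_const excess_sum_tendsto)
  then have "\<forall>\<^sub>F k in sequentially. K * (?r k / grid_vol (\<nu> k)) < e / 2"
    using m1 by (rule order_tendstoD(2))
  then have close: "\<forall>\<^sub>F k in sequentially. \<bar>(\<Sum>j\<in>V k. F (l k j)) / grid_vol (\<nu> k) - (\<Sum>j\<in>V k. F (l' k j)) / grid_vol (\<nu> k)\<bar> \<le> e"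
  proof eventually_elim
    case (elim k)
    let ?v = "grid_vol (\<nu> k)"
    have v: "?v > 0" by (rule grid_vol_pos)
    have "\<bar>(\<Sum>j\<in>V k. F (l k j)) - (\<Sum>j\<in>V k. F (l' k j))\<bar> \<le> e / 2 * real (card (V k)) + K * ?r k"
      unfolding real_norm_def[symmetric]
      by (intro Kr finite_immersed_set) (rule clipped_eigenvalue_count[OF sys sys'])
    also have "e / 2 * real (card (V k)) \<le> e / 2 * ?v"
      using e by (intro mult_left_mono card_immersed_set_le) auto
    also have "K * ?r k \<le> e / 2 * ?v" using elim v by (simp add: field_simps)
    finally have "\<bar>(\<Sum>j\<in>V k. F (l k j)) - (\<Sum>j\<in>V k. F (l' k j))\<bar> \<le> e * ?v" by simp
    then show ?case using v by (simp add: diff_divide_distrib[symmetric] pos_divide_le_eq)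
  qed
  show "\<exists>a' b'. a' \<longlonglongrightarrow> b' \<and>
      (\<forall>\<^sub>F k in sequentially. \<bar>(\<Sum>j\<in>V k. F (l k j)) / grid_vol (\<nu> k) - a' k\<bar> \<le> e) \<and>
      \<bar>(LINT z:phase_space|lebesgue. F (p (fst z) * symb (snd z))) / ?c - b'\<bar> \<le> e"
    using lim close m2 by blast
qed

text \<open>Eigenvalue sums and node counts both converge after division by \<open>grid_vol\<close>,
  which cancels in their quotient; positivity of the measure of \<open>\<Omega>\<close> makes the
  quotient converge.\<close>

lemma distribution_complex:
  fixes F :: "complex \<Rightarrow> complex"
  assumes pos: "0 < measure lebesgue \<Omega>"
    and F: "continuous_on UNIV F" and supp: "compact (closure {z. F z \<noteq> 0})"
  shows "(\<lambda>k. (\<Sum>z\<in>#eigenvalues_mset (immersed_toeplitz_matrix ts w \<Omega> p (\<nu> k)). F z)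
        / of_nat (dim_row (immersed_toeplitz_matrix ts w \<Omega> p (\<nu> k))))
    \<longlonglongrightarrow> (LINT z:phase_space|lebesgue. F (complex_of_real (p (fst z) * symb (snd z)))) / complex_of_real (measure lebesgue phase_space)"
proof -
  let ?c = "(2 * pi) ^ CARD('d::{finite,wellorder}) :: real"
  obtain u l where sys: "\<And>k. eigensystem p k (u k) (l k)" using eigensystem_sequence_exists by blast
  have eig: "(\<Sum>z\<in>#eigenvalues_mset (immersed_toeplitz_matrix ts w \<Omega> p (\<nu> k)). F z) = (\<Sum>j\<in>V k. F (of_real (l k j)))" for k
  proof -
    have "eigenvalues_mset (immersed_toeplitz_matrix ts w \<Omega> p (\<nu> k)) = {#complex_of_real (l k j). j \<in># mset_set (V k)#}"
      unfolding immersed_toeplitz_matrix_eq immersed_nodes(2)[symmetric]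
      by (rule eigenvalues_mset_eigensystem[OF immersed_nodes(1)]) (unfold immersed_nodes(2), rule sys)
    then show ?thesis by (simp add: image_mset.compositionality o_def sum_unfold_sum_mset)
  qed
  obtain L where L: "\<And>z. F z \<noteq> 0 \<Longrightarrow> cmod z < L"
  proof -
    have "bounded {z. F z \<noteq> 0}" using compact_imp_bounded[OF supp] closure_subset by (rule bounded_subset)
    then obtain B where "\<And>z. F z \<noteq> 0 \<Longrightarrow> cmod z \<le> B" unfolding bounded_iff by blast
    then have "\<And>z. F z \<noteq> 0 \<Longrightarrow> cmod z < B + 1" by force
    then show ?thesis using that by blast
  qed
  \<comment> \<open>With \<open>Re\<close> or \<open>Im\<close> for \<open>g\<close> this splits
    \<open>F\<close> on the real line into real test functions; \<open>g 0 = 0\<close> preserves the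
    bounded support.\<close>
  define G where "G g x = g (F (complex_of_real x))" for g :: "complex \<Rightarrow> real" and x
  have parts: "(\<lambda>k. (\<Sum>j\<in>V k. G g (l k j)) / real (card (V k)))
       \<longlonglongrightarrow> (LINT z:phase_space|lebesgue. G g (p (fst z) * symb (snd z))) / measure lebesgue phase_space"
    and parts_int: "set_integrable lebesgue phase_space (\<lambda>z. G g (p (fst z) * symb (snd z)))"
    if g: "continuous_on UNIV g" "g 0 = 0" for g
  proof -
    have cG: "continuous_on UNIV (G g)" unfolding G_def
      by (intro continuous_on_compose2[OF g(1)] continuous_on_compose2[OF F] continuous_intros) auto
    have sG: "G g x = 0" if "L \<le> \<bar>x\<bar>" for x
    proof -
      have "F (complex_of_real x) = 0" using L[of "complex_of_real x"] that by fastforce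
      then show ?thesis by (simp add: G_def g(2))
    qed
    have "(\<lambda>k. ((\<Sum>j\<in>V k. G g (l k j)) / grid_vol (\<nu> k)) / (real (card (V k)) / grid_vol (\<nu> k)))
      \<longlonglongrightarrow> (LINT z:phase_space|lebesgue. G g (p (fst z) * symb (snd z))) / ?c / measure lebesgue \<Omega>"
      using pos by (intro tendsto_divide distribution_real[OF sys cG sG] card_tendsto) auto
    moreover have "((\<Sum>j\<in>V k. G g (l k j)) / grid_vol (\<nu> k)) / (real (card (V k)) / grid_vol (\<nu> k)) = (\<Sum>j\<in>V k. G g (l k j)) / real (card (V k))" for k
      using grid_vol_pos[of "\<nu> k"] by simp
    ultimately have "(\<lambda>k. (\<Sum>j\<in>V k. G g (l k j)) / real (card (V k)))
       \<longlonglongrightarrow> (LINT z:phase_space|lebesgue. G g (p (fst z) * symb (snd z))) / ?c / measure lebesgue \<Omega>"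
      by (simp only:)
    then show "(\<lambda>k. (\<Sum>j\<in>V k. G g (l k j)) / real (card (V k)))
       \<longlonglongrightarrow> (LINT z:phase_space|lebesgue. G g (p (fst z) * symb (snd z))) / measure lebesgue phase_space"
      by (simp only: phase_space_measure(2) divide_divide_eq_left mult.commute)
    have "bounded (G g ` {-L..L})"
      by (intro compact_imp_bounded compact_continuous_image continuous_on_subset[OF cG]) auto
    then obtain C where C: "\<And>x. x \<in> {-L..L} \<Longrightarrow> \<bar>G g x\<bar> \<le> C" unfolding bounded_iff real_norm_def by blast
    have "\<bar>G g y\<bar> \<le> \<bar>C\<bar>" for y
    proof (cases "L \<le> \<bar>y\<bar>")
      case False
      then have "y \<in> {-L..L}" by auto
      from C[OF this] show ?thesis by linarith
    qed (simp add: sG)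
    then show "set_integrable lebesgue phase_space (\<lambda>z. G g (p (fst z) * symb (snd z)))"
      by (intro comp_symbol_integrable[OF cG continuous_on_id]) auto
  qed
  have FG: "F (of_real x) = of_real (G Re x) + \<i> * of_real (G Im x)" for x
    by (simp add: G_def complex_eq_iff)
  have cRe: "continuous_on UNIV Re" "Re 0 = 0" and cIm: "continuous_on UNIV Im" "Im 0 = 0"
    by (auto intro: continuous_intros)
  let ?I = "\<lambda>g. LINT z:phase_space|lebesgue. G g (p (fst z) * symb (snd z))"
  have int: "(LINT z:phase_space|lebesgue. F (complex_of_real (p (fst z) * symb (snd z)))) = of_real (?I Re) + \<i> * of_real (?I Im)"
  proof -
    have "set_integrable lebesgue phase_space (\<lambda>z. complex_of_real (G g (p (fst z) * symb (snd z))))"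
      if "continuous_on UNIV g" "g 0 = 0" for g
      using integrable_of_real[OF parts_int[OF that, unfolded set_integrable_def], where 'a = complex]
      by (simp add: set_integrable_def scaleR_conv_of_real)
    from set_integral_add(2)[OF this[OF cRe] set_integrable_mult_right[OF this[OF cIm]], of \<i>]
    show ?thesis unfolding FG by (simp add: set_integral_complex_of_real)
  qed
  have "(\<lambda>k. of_real ((\<Sum>j\<in>V k. G Re (l k j)) / real (card (V k))) + \<i> * of_real ((\<Sum>j\<in>V k. G Im (l k j)) / real (card (V k))))
     \<longlonglongrightarrow> of_real (?I Re / measure lebesgue phase_space) + \<i> * of_real (?I Im / measure lebesgue phase_space)"
    by (intro tendsto_intros parts[OF cRe] parts[OF cIm])
  moreover have "of_real ((\<Sum>j\<in>V k. G Re (l k j)) / real (card (V k))) + \<i> * of_real ((\<Sum>j\<in>V k. G Im (l k j)) / real (card (V k)))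
     = (\<Sum>j\<in>V k. F (of_real (l k j))) / of_nat (card (V k))" for k
    unfolding FG sum.distrib sum_distrib_left[symmetric] by (simp add: add_divide_distrib)
  ultimately show ?thesis
    unfolding eig int dim_row_immersed_toeplitz_matrix by (simp add: add_divide_distrib)
qed

lemma card_filterlim:
  assumes pos: "0 < measure lebesgue \<Omega>"
  shows "filterlim (\<lambda>k. card (V k)) at_top sequentially"
proof -
  have vol: "filterlim (\<lambda>k. grid_vol (\<nu> k)) at_top sequentially"
  proof (rule filterlim_at_top_mono[OF filterlim_real_sequentially], rule always_eventually, rule allI)
    fix k
    \<comment> \<open>Any coordinate will do, because the other factors of \<open>grid_vol\<close>
      are at least 1.\<close>
    obtain r :: "'d" where True by simp
    have "real k \<le> real (vec_nth (\<nu> k) r) + 1" using \<nu>[of k r] by simp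
    also have "\<dots> = (\<Prod>r\<in>{r}. real (vec_nth (\<nu> k) r) + 1)" by simp
    also have "\<dots> \<le> grid_vol (\<nu> k)"
      unfolding grid_vol_def by (rule prod_mono2) auto
    finally show "real k \<le> grid_vol (\<nu> k)" .
  qed
  have "filterlim (\<lambda>k. real (card (V k)) / grid_vol (\<nu> k) * grid_vol (\<nu> k)) at_top sequentially"
    by (rule filterlim_tendsto_pos_mult_at_top[OF card_tendsto pos vol])
  moreover have "real (card (V k)) / grid_vol (\<nu> k) * grid_vol (\<nu> k) = real (card (V k))" for k
    using grid_vol_pos[of "\<nu> k"] by simp
  ultimately have "filterlim (\<lambda>k. real (card (V k))) at_top sequentially" by simp
  then have "\<forall>\<^sub>F k in sequentially. real Z \<le> real (card (V k))" for Z
    unfolding filterlim_at_top by blast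
  then show ?thesis unfolding filterlim_at_top of_nat_le_iff by blast
qed

end

theorem theorem4p7:
  fixes \<Omega> :: "(real ^ 'd::{finite,wellorder}) set"
    and p :: "real ^ 'd::{finite,wellorder} \<Rightarrow> real"
    and ts :: "(int ^ 'd::{finite,wellorder}) list"
    and w :: "int ^ 'd::{finite,wellorder} \<Rightarrow> real"
  assumes reg: "regular_domain \<Omega>"
    and pos_meas: "0 < emeasure lebesgue \<Omega>"
    and p_cont: "AE x in lebesgue. x \<in> \<Omega> \<longrightarrow> continuous (at x within \<Omega>) p"
    and ts_sorted: "sorted_wrt lex_less ts"
    and ts_dirs: "\<forall>t\<in>set ts. (\<forall>r. 0 \<le> t $ r) \<and> t \<noteq> 0"
    and w_nonzero: "\<forall>t\<in>set ts. \<forall>s\<in>dir_pos_reps t. w s \<noteq> 0"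
  shows "eig_distributed (immersed_toeplitz_matrix ts w \<Omega> p) multi_top
           (\<lambda>(x, \<theta>). p x * toeplitz_symbol ts w \<theta>)
           (\<Omega> \<times> cbox (- (\<chi> r. pi)) (\<chi> r. pi))"
proof -
  have seq: "immersed_toeplitz_sequence \<Omega> p ts \<nu>" if "\<And>k r. k \<le> vec_nth (\<nu> k) r" for \<nu>
    using reg p_cont ts_sorted ts_dirs that by unfold_locales auto
  \<comment> \<open>Measure and measurability on the limit domain do not involve the sizes, so any
    admissible sequence gives access to them; this is the diagonal one.\<close>
  interpret base: immersed_toeplitz_sequence \<Omega> p ts w "\<lambda>k. \<chi> r. k"
    by (rule seq) simp
  have pos: "0 < measure lebesgue \<Omega>"
    using pos_meas unfolding emeasure_eq_measure2[OF base.domain(3)] by simp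
  have pos2: "0 < emeasure lebesgue base.phase_space"
    unfolding emeasure_eq_measure2[OF base.phase_space_measure(1)] base.phase_space_measure(2)
    using pos by simp
  have meas: "(\<lambda>(x, \<theta>). p x * toeplitz_symbol ts w \<theta>) \<in> borel_measurable (lebesgue_on base.phase_space)"
  proof (rule borel_measurable_if_D)
    have "(\<lambda>z. indicator base.phase_space z *\<^sub>R (p (fst z) * toeplitz_symbol ts w (snd z))) \<in> borel_measurable lebesgue"
      using base.comp_symbol_measurable[OF continuous_on_id continuous_on_id] by simp
    also have "(\<lambda>z. indicator base.phase_space z *\<^sub>R (p (fst z) * toeplitz_symbol ts w (snd z)))
       = (\<lambda>z. if z \<in> base.phase_space then (\<lambda>(x, \<theta>). p x * toeplitz_symbol ts w \<theta>) z else 0)"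
      by (auto simp: fun_eq_iff)
    finally show "(\<lambda>z. if z \<in> base.phase_space then (\<lambda>(x, \<theta>). p x * toeplitz_symbol ts w \<theta>) z else 0) \<in> borel_measurable lebesgue" .
  qed
  have size: "filterlim (\<lambda>n. dim_row (immersed_toeplitz_matrix ts w \<Omega> p n)) at_top multi_top"
    unfolding dim_row_immersed_toeplitz_matrix
    by (rule filterlim_multi_top_sequentially, rule immersed_toeplitz_sequence.card_filterlim[OF seq pos])
  have lim: "((\<lambda>n. (\<Sum>z\<in>#eigenvalues_mset (immersed_toeplitz_matrix ts w \<Omega> p n). F z) / of_nat (dim_row (immersed_toeplitz_matrix ts w \<Omega> p n)))
      \<longlongrightarrow> (LINT y:base.phase_space|lebesgue. F (complex_of_real ((\<lambda>(x, \<theta>). p x * toeplitz_symbol ts w \<theta>) y)))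
          / complex_of_real (measure lebesgue base.phase_space)) multi_top"
    if "continuous_on UNIV F" "compact (closure {z. F z \<noteq> 0})" for F :: "complex \<Rightarrow> complex"
    unfolding case_prod_beta
    by (rule filterlim_multi_top_sequentially, rule immersed_toeplitz_sequence.distribution_complex[OF seq pos that])
  show ?thesis
    unfolding eig_distributed_def
    using size pos2 meas lim base.phase_space_sets fmeasurableD2[OF base.phase_space_measure(1)]
    by (auto simp: less_top)
qed

end
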